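(* Let $D_n$ be the graph distance between the root node $0_1$ and node $n$ in a random ordered increasing $k$-tree of size $n\ge1$. Then \[ \mathbb{E}(D_n)=\frac{1}{(k+1)H_k}\log n+O(1),\qquad \mathbb{V}(D_n)=\frac{H_k^{(2)}}{(k+1)H_k^3}\log n+O(1), \] and $D_n$ is asymptotically Gaussian with \[ \sup_{x\in\mathbb{R}}\left|\mathbb{P}\left\{\frac{D_n-\mathbb{E}(D_n)}{\sqrt{\mathbb{V}(D_n)}}\le x\right\}-\Phi(x)\right|=O\!\left(\frac{1}{\sqrt{\log n}}\right)\quad(n\to\infty), \] where $\Phi$ is the standard normal distribution function.
   Context: Fix an integer $k\ge1$. An ordered increasing $k$-tree of size $n\ge0$ is built as follows. Start with the root-clique $K_0$: $k$ pairwise adjacent vertices labelled $0_1,\dots,0_k$ (the root nodes; each label $0_\ell$ has value $0$). For $j=1,\dots,n$ in turn, node $j$ is inserted by choosing a currently existing $k$-clique $K$ and attaching $j$ to it, i.e. adding edges from $j$ to all $k$ vertices of $K$; $j$ is then a child of $K$ and the vertices of $K$ are the parents of $j$. The $k$-cliques available for attachment are the root-clique and, for every previously inserted node $x$ attached to a clique $K'$, the $k$ cliques $\{x\}\cup(K'\setminus\{w\})$, $w\in K'$. The children of each $k$-clique are linearly ordered: if $K$ currently has $d^+(K)$ children, there are $d^+(K)+1$ positions at which the new child may be placed, and the choice of position is part of the structure. Thus there are $1+(k+1)(j-1)$ ways to insert node $j$, and distinct sequences of choices give distinct trees. A random ordered increasing $k$-tree of size $n$ is one chosen uniformly among all of them;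 equivalently, it is produced by the process in which node $n$ is attached to the clique $K$ with probability $\frac{d^+(K)+1}{1+(k+1)(n-1)}$ (and a uniformly random position among the $d^+(K)+1$). Distance is the usual graph distance (minimal number of edges on a connecting path). $H_k=\sum_{\ell=1}^k\frac1\ell$ and $H_k^{(2)}=\sum_{\ell=1}^k\frac1{\ell^2}$. *)

theory Defs
  imports "HOL-Probability.Probability" "HOL-Library.Landau_Symbols"
begin

text \<open>Vertices: root nodes 0_1..0_k are Root 1..Root k; inserted node j is Node j.\<close>
datatype vert = Root nat | Node nat

text \<open>State of an ordered increasing k-tree during construction:
  list of the currently available k-cliques (as vertex lists) together with their
  current number of children, and the (symmetric) edge relation of the graph.\<close>
type_synonym ktree_state = "(vert list \<times> nat) list \<times> (vert \<times> vert) set"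

definition init_state :: "nat \<Rightarrow> ktree_state" where
  "init_state k = ([(map Root [1..<Suc k], 0)],
                   {(Root a, Root b) | a b. a \<in> {1..k} \<and> b \<in> {1..k} \<and> a \<noteq> b})"

text \<open>Insertion choices: a clique index i and one of its d^+(K)+1 positions.\<close>
definition choices :: "ktree_state \<Rightarrow> (nat \<times> nat) set" where
  "choices s = {(i, p). i < length (fst s) \<and> p \<le> snd (fst s ! i)}"

text \<open>Insert node j into clique number i (the position only matters for the count).\<close>
definition insert_node :: "nat \<Rightarrow> ktree_state \<Rightarrow> nat \<Rightarrow> ktree_state" where
  "insert_node j s i =
     (let L = fst s; E = snd s; K = fst (L ! i); c = snd (L ! i); v = Node j in
      (L[i := (K, Suc c)] @ map (\<lambda>w. (v # remove1 w K, 0)) K,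
       E \<union> {(v, w) | w. w \<in> set K} \<union> {(w, v) | w. w \<in> set K}))"

definition step :: "nat \<Rightarrow> ktree_state \<Rightarrow> ktree_state pmf" where
  "step j s = map_pmf (\<lambda>(i, p). insert_node j s i) (pmf_of_set (choices s))"

text \<open>Random ordered increasing k-tree of size n (uniform over all such trees;
  each insertion chooses uniformly among the 1+(k+1)(j-1) clique/position options).\<close>
fun ktree :: "nat \<Rightarrow> nat \<Rightarrow> ktree_state pmf" where
  "ktree k 0 = return_pmf (init_state k)"
| "ktree k (Suc n) = ktree k n \<bind> step (Suc n)"

definition graph_dist :: "(vert \<times> vert) set \<Rightarrow> vert \<Rightarrow> vert \<Rightarrow> nat" where
  "graph_dist E u v = (LEAST m. (u, v) \<in> E ^^ m)"

definition Dist :: "nat \<Rightarrow> nat \<Rightarrow> nat pmf" where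
  "Dist k n = map_pmf (\<lambda>s. graph_dist (snd s) (Root 1) (Node n)) (ktree k n)"

definition harm2 :: "nat \<Rightarrow> real" where
  "harm2 k = (\<Sum>l=1..k. 1 / (real l)^2)"

definition Phi :: "real \<Rightarrow> real" where
  "Phi x = measure (density lborel std_normal_density) {..x}"

end

theory Submission
  imports Defs
begin

text \<open>A clique whose vertices have distances m and m + 1 from the root node is described by one number r,
  the sum of these distances: r div k = m, and r mod k vertices are at distance m + 1. Attaching a node to
  such a clique creates a node at distance m + 1 and k new cliques, k - r mod k of which have type r + 1,
  the others type r. Hence the type of a uniformly chosen insertion place evolves in law as a pure birth
  chain with the periodic rates k, k - 1, ..., 1, slowed down by the total number of insertion places.

  Since the drift of the chain is periodic, additive functions with constant drift give the mean and, up to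
  a bounded corrector, the variance. For the limit law the chain is Fourier transformed in the distance
  only, which leaves a linear recursion on the k residues. An energy estimate for the phased cyclic flow
  makes all its solutions decay like exp (- c theta^2 log n), and an approximate eigenvector identifies the
  Gaussian main term; Esseen smoothing turns this into the Berry-Esseen bound.\<close>

section \<open>The pure birth chain\<close>

text \<open>An insertion at a place of type r creates k + 1 new places: one more at the chosen
  clique and one on each new clique, \<open>rate k r\<close> of the latter of type r + 1. A uniform
  place of the next tree is thus new with probability (k + 1) / \<open>tok k (n + 1)\<close>, and
  then of type r + 1 with probability \<open>rate k r\<close> / (k + 1); the product is the jump
  probability. For k > 1 the distance r div k alone is not Markov, hence vectors indexed by
  residues. An exact eigenvector would require a root of a polynomial of degree k; truncating that
  root at second order leaves a defect of order theta^3 per unit of the clock sum 1 / tok. Damped by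
  exp (- c theta^2 log n), all errors amount to O(|theta|) / (1 + theta^2 log n), which is what
  smoothing tolerates: divided by theta and integrated over [0, 1] it gives O(1 / sqrt (log n)). The
  fixed frequency window [0, 1] suffices because distances are compared before standardization, with
  a normal law whose density is already O(1 / sqrt (log n)).\<close>

definition rate :: "nat \<Rightarrow> nat \<Rightarrow> real" where
  "rate k r = real (k - r mod k)"

text \<open>The number of insertion places of a tree with n inserted nodes, from which node n + 1
  chooses.\<close>

definition tok :: "nat \<Rightarrow> nat \<Rightarrow> real" where
  "tok k n = 1 + (real k + 1) * real n"

text \<open>The expectation of phi over the chain after n steps, as a functional of phi: the chain starts in
  k - 1 (the root clique) and moves from r to r + 1 in step n + 1 with probability rate k r / tok k (n + 1).\<close>

primrec birth :: "nat \<Rightarrow> nat \<Rightarrow> (nat \<Rightarrow> 'a::real_vector) \<Rightarrow> 'a" where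
  "birth k 0 \<phi> = \<phi> (k - 1)"
| "birth k (Suc n) \<phi> =
     birth k n (\<lambda>r. \<phi> r + (rate k r / tok k (Suc n)) *\<^sub>R (\<phi> (Suc r) - \<phi> r))"

lemma tok_pos: "tok k n > 0"
  unfolding tok_def by (intro add_pos_nonneg) auto

lemma tok_Suc: "tok k (Suc n) = tok k n + (real k + 1)"
  by (simp add: tok_def algebra_simps)

lemma tok_Suc_ge: "tok k (Suc n) \<ge> real k + 2"
  by (simp add: tok_def algebra_simps)

lemma rate_nonneg: "rate k r \<ge> 0"
  by (simp add: rate_def)

lemma rate_le: "rate k r \<le> real k"
  by (simp add: rate_def)

lemma rate_ge_1: "k \<ge> 1 \<Longrightarrow> rate k r \<ge> 1"
  using mod_less_divisor[of k r] unfolding rate_def by linarith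

lemma rate_div_tok: "0 \<le> rate k r / tok k (Suc n)" "rate k r / tok k (Suc n) \<le> 1"
  using rate_nonneg[of k r] rate_le[of k r] tok_Suc_ge[of k n] by (auto simp: divide_simps)

lemma birth_add: "birth k n (\<lambda>r. \<phi> r + \<psi> r) = birth k n \<phi> + birth k n \<psi>"
proof (induction n arbitrary: \<phi> \<psi>)
  case (Suc n)
  show ?case
    by (simp add: Suc[symmetric] algebra_simps)
qed simp

lemma birth_linear:
  assumes "linear L"
  shows "L (birth k n \<phi>) = birth k n (\<lambda>r. L (\<phi> r))"
proof (induction n arbitrary: \<phi>)
  case (Suc n)
  show ?case
    by (simp add: Suc linear_add[OF assms] linear_scale[OF assms] linear_diff[OF assms])
qed simp

lemma birth_scaleR: "birth k n (\<lambda>r. c *\<^sub>R \<phi> r) = c *\<^sub>R birth k n \<phi>"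
  by (rule birth_linear[symmetric]) (simp add: linear_scale_self)

lemma birth_mult: "birth k n (\<lambda>r. c * \<phi> r) = c * birth k n (\<phi> :: nat \<Rightarrow> 'a::real_algebra)"
  by (rule birth_linear[symmetric]) (simp add: linear_iff algebra_simps)

lemma birth_minus: "birth k n (\<lambda>r. - \<phi> r) = - birth k n \<phi>"
  using birth_scaleR[of k n "-1" \<phi>] by simp

lemma birth_diff: "birth k n (\<lambda>r. \<phi> r - \<psi> r) = birth k n \<phi> - birth k n \<psi>"
  using birth_add[of k n \<phi> "\<lambda>r. - \<psi> r"] by (simp add: birth_minus)

lemma birth_sum: "finite A \<Longrightarrow> birth k n (\<lambda>r. \<Sum>j\<in>A. \<phi> j r) = (\<Sum>j\<in>A. birth k n (\<phi> j))"
proof (induction A rule: finite_induct)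
  case empty
  show ?case using birth_scaleR[of k n 0 "\<lambda>_. 0"] by simp
next
  case (insert x F)
  then show ?case by (simp add: birth_add)
qed

lemma birth_const: "birth k n (\<lambda>_. c) = c"
  by (induction n) simp_all

lemma birth_mono:
  fixes \<phi> \<psi> :: "nat \<Rightarrow> real"
  assumes "\<And>r. \<phi> r \<le> \<psi> r"
  shows "birth k n \<phi> \<le> birth k n \<psi>"
  using assms
proof (induction n arbitrary: \<phi> \<psi>)
  case (Suc n)
  have "\<phi> r + (rate k r / tok k (Suc n)) * (\<phi> (Suc r) - \<phi> r)
      \<le> \<psi> r + (rate k r / tok k (Suc n)) * (\<psi> (Suc r) - \<psi> r)" for r
  proof -
    define c where "c = rate k r / tok k (Suc n)"
    have "0 \<le> c" "c \<le> 1" using rate_div_tok by (auto simp: c_def)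
    then have "(1 - c) * \<phi> r + c * \<phi> (Suc r) \<le> (1 - c) * \<psi> r + c * \<psi> (Suc r)"
      using Suc.prems by (intro add_mono mult_left_mono) auto
    then show ?thesis unfolding c_def[symmetric] by (simp add: algebra_simps)
  qed
  then show ?case by (auto intro: Suc.IH)
qed simp

lemma norm_birth_le:
  fixes \<phi> :: "nat \<Rightarrow> 'a::real_normed_vector"
  shows "norm (birth k n \<phi>) \<le> birth k n (\<lambda>r. norm (\<phi> r))"
proof (induction n arbitrary: \<phi>)
  case (Suc n)
  have "norm (\<phi> r + (rate k r / tok k (Suc n)) *\<^sub>R (\<phi> (Suc r) - \<phi> r))
      \<le> norm (\<phi> r) + (rate k r / tok k (Suc n)) *\<^sub>R (norm (\<phi> (Suc r)) - norm (\<phi> r))" for r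
  proof -
    define c where "c = rate k r / tok k (Suc n)"
    have c: "0 \<le> c" "c \<le> 1" using rate_div_tok by (auto simp: c_def)
    have "norm ((1 - c) *\<^sub>R \<phi> r + c *\<^sub>R \<phi> (Suc r)) \<le> (1 - c) * norm (\<phi> r) + c * norm (\<phi> (Suc r))"
      using c by (intro norm_triangle_le) simp
    then show ?thesis unfolding c_def[symmetric] by (simp add: algebra_simps)
  qed
  then show ?case by (auto intro!: order_trans[OF Suc.IH] birth_mono)
qed simp

lemma norm_birth_bound:
  fixes \<phi> :: "nat \<Rightarrow> 'a::real_normed_vector"
  assumes "\<And>r. norm (\<phi> r) \<le> B"
  shows "norm (birth k n \<phi>) \<le> B"
  using order_trans[OF norm_birth_le birth_mono, of \<phi> "\<lambda>_. B" k n] assms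
  by (simp add: birth_const)

section \<open>From trees to the birth chain\<close>

definition verts :: "nat \<Rightarrow> nat \<Rightarrow> vert set" where
  "verts k n = Root ` {1..k} \<union> Node ` {1..n}"

text \<open>Requiring level m to be attained makes m the minimum, so that it can be recovered from
  the sum of the distances.\<close>

definition two_level :: "(vert \<Rightarrow> nat) \<Rightarrow> vert list \<Rightarrow> bool" where
  "two_level d K \<longleftrightarrow> (\<exists>m. (\<forall>w\<in>set K. d w = m \<or> d w = Suc m) \<and> (\<exists>w\<in>set K. d w = m))"

definition clique_type :: "(vert \<Rightarrow> nat) \<Rightarrow> vert list \<Rightarrow> nat" where
  "clique_type d K = sum_list (map d K)"

text \<open>A local certificate that \<open>d\<close> is the distance from \<open>Root 1\<close>: it
  grows by at most 1 along edges, and every other vertex has a neighbour one step closer. Such a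
  certificate extends to a new node without any reasoning about paths. The last conjunct counts the
  insertion places.\<close>

definition dist_inv :: "nat \<Rightarrow> nat \<Rightarrow> ktree_state \<Rightarrow> (vert \<Rightarrow> nat) \<Rightarrow> bool" where
  "dist_inv k n s d \<longleftrightarrow>
     d (Root 1) = 0 \<and>
     (\<forall>u w. (u, w) \<in> snd s \<longrightarrow> u \<in> verts k n \<and> w \<in> verts k n \<and> d w \<le> Suc (d u)) \<and>
     (\<forall>v\<in>verts k n. v \<noteq> Root 1 \<longrightarrow> (\<exists>u. (u, v) \<in> snd s \<and> d v = Suc (d u))) \<and>
     (\<forall>x\<in>set (fst s). set (fst x) \<subseteq> verts k n \<and> length (fst x) = k \<and> two_level d (fst x)) \<and>
     (\<Sum>x\<leftarrow>fst s. real (Suc (snd x))) = tok k n"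

text \<open>The growth condition bounds every walk from below by \<open>d\<close>; following closer
  neighbours backwards, by induction on \<open>d v\<close>, produces a walk of that length.\<close>

lemma graph_dist_eq:
  assumes inv: "dist_inv k n s d" and v: "v \<in> verts k n"
  shows "graph_dist (snd s) (Root 1) v = d v"
proof -
  have low: "d w \<le> m" if "(Root 1, w) \<in> snd s ^^ m" for w m
    using that
  proof (induction m arbitrary: w)
    case 0
    then show ?case using inv by (auto simp: dist_inv_def)
  next
    case (Suc m)
    then obtain u where u: "(Root 1, u) \<in> snd s ^^ m" "(u, w) \<in> snd s" by auto
    then have "d w \<le> Suc (d u)" using inv by (auto simp: dist_inv_def)
    then show ?case using Suc.IH[OF u(1)] by simp
  qed
  have ex: "(Root 1, v) \<in> snd s ^^ m" if "v \<in> verts k n" "d v = m" for v m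
    using that
  proof (induction m arbitrary: v)
    case 0
    then have "v = Root 1" using inv by (fastforce simp: dist_inv_def)
    then show ?case by simp
  next
    case (Suc m)
    then have "v \<noteq> Root 1" using inv by (auto simp: dist_inv_def)
    then obtain u where u: "(u, v) \<in> snd s" "d v = Suc (d u)"
      using Suc.prems inv unfolding dist_inv_def by blast
    then have "u \<in> verts k n" using inv by (auto simp: dist_inv_def)
    then show ?case using Suc u by auto
  qed
  show ?thesis unfolding graph_dist_def
    using low ex[OF v refl] by (intro Least_equality) auto
qed

lemma clique_type_two_level:
  assumes "\<forall>w\<in>set K. d w = m \<or> d w = Suc m"
  shows "clique_type d K + length (filter (\<lambda>w. d w = m) K) = length K * Suc m"
  using assms by (induction K) (auto simp: clique_type_def)

text \<open>With i vertices on the lower level the type is k (m + 1) - i = m k + (k - i). As i lies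
  between 1 and k, this is division with remainder by k.\<close>

lemma clique_type_facts:
  assumes K: "\<forall>w\<in>set K. d w = m \<or> d w = Suc m" and w: "w \<in> set K" "d w = m" and len: "length K = k"
  shows "clique_type d K div k = m"
    and "rate k (clique_type d K) = real (length (filter (\<lambda>w. d w = m) K))"
proof -
  define i where "i = length (filter (\<lambda>w. d w = m) K)"
  have "i > 0" using w by (auto simp: i_def filter_empty_conv)
  moreover have "i \<le> k" using len by (auto simp: i_def)
  moreover have "clique_type d K + i = k * Suc m"
    using clique_type_two_level[OF K] len by (simp add: i_def)
  moreover define j where "j = k - i"
  ultimately have *: "clique_type d K = j + m * k" "j < k" "i + j = k"
    by (auto simp: algebra_simps)
  then show "clique_type d K div k = m" by simp
  have "clique_type d K mod k = j" using *(1,2) by simp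
  then show "rate k (clique_type d K) = real i" using *(3) by (simp add: rate_def)
qed

lemma clique_type_remove1:
  assumes "w \<in> set K"
  shows "clique_type d (v # remove1 w K) + d w = clique_type d K + d v"
  using sum_list_map_remove1[OF assms, of d] by (simp add: clique_type_def)

lemma clique_type_cong: "(\<And>w. w \<in> set K \<Longrightarrow> d w = d' w) \<Longrightarrow> clique_type d K = clique_type d' K"
  unfolding clique_type_def by (metis map_cong)

text \<open>The sum of \<open>\<phi>\<close> over the types of all insertion places, a clique with c
  children offering c + 1 of them.\<close>

definition wsum :: "ktree_state \<Rightarrow> (vert \<Rightarrow> nat) \<Rightarrow> (nat \<Rightarrow> 'a::real_vector) \<Rightarrow> 'a" where
  "wsum s d \<phi> = (\<Sum>x\<leftarrow>fst s. real (Suc (snd x)) *\<^sub>R \<phi> (clique_type d (fst x)))"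

lemma sum_list_update_vec:
  fixes g :: "'b \<Rightarrow> 'a::ab_group_add"
  shows "i < length L \<Longrightarrow> sum_list (map g (L[i := y])) = sum_list (map g L) - g (L ! i) + g y"
proof (induction L arbitrary: i)
  case (Cons a L)
  then show ?case by (cases i) (auto simp: algebra_simps)
qed simp

lemma sum_list_if_vec:
  fixes \<phi> :: "'b \<Rightarrow> 'a::real_vector"
  shows "(\<Sum>w\<leftarrow>L. \<phi> (if P w then x else y)) =
    (real (length L) - real (length (filter P L))) *\<^sub>R \<phi> y + real (length (filter P L)) *\<^sub>R \<phi> x"
  by (induction L) (auto simp: algebra_simps)

locale node_insertion =
  fixes k n :: nat and s :: ktree_state and d :: "vert \<Rightarrow> nat" and i :: nat
  assumes k: "k \<ge> 1" and inv: "dist_inv k n s d" and i: "i < length (fst s)"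
begin

definition "K = fst (fst s ! i)"
definition "c = snd (fst s ! i)"
definition "r = clique_type d K"
definition "v = Node (Suc n)"
text \<open>The new node lies one step beyond the lower level of its clique. Old distances survive,
  since any two parents of the new node differ by at most 1 in distance.\<close>

definition "d' = d(v := Suc (r div k))"
definition "s' = insert_node (Suc n) s i"

lemma s'_eq: "s' = ((fst s)[i := (K, Suc c)] @ map (\<lambda>w. (v # remove1 w K, 0)) K,
    snd s \<union> {(v, w) | w. w \<in> set K} \<union> {(w, v) | w. w \<in> set K})"
  by (simp add: s'_def insert_node_def Let_def K_def c_def v_def)

lemma K: "set K \<subseteq> verts k n" "length K = k" "two_level d K"
  using inv nth_mem[OF i] by (auto simp: dist_inv_def K_def)

lemma v_notin: "v \<notin> verts k n" by (auto simp: v_def verts_def)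

lemma d'_old: "w \<in> verts k n \<Longrightarrow> d' w = d w" using v_notin by (auto simp: d'_def)

lemma K_level: "\<forall>w\<in>set K. d w = r div k \<or> d w = Suc (r div k)" "\<exists>w\<in>set K. d w = r div k"
  and K_rate: "rate k r = real (length (filter (\<lambda>w. d w = r div k) K))"
proof -
  obtain m where m: "\<forall>w\<in>set K. d w = m \<or> d w = Suc m" "\<exists>w\<in>set K. d w = m"
    using K(3) by (auto simp: two_level_def)
  then have "r div k = m" "rate k r = real (length (filter (\<lambda>w. d w = m) K))"
    using clique_type_facts[OF m(1) _ _ K(2)] by (auto simp: r_def)
  then show "\<forall>w\<in>set K. d w = r div k \<or> d w = Suc (r div k)" "\<exists>w\<in>set K. d w = r div k"
     "rate k r = real (length (filter (\<lambda>w. d w = r div k) K))"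
    using m by auto
qed

text \<open>Exchanging w for v changes the sum of distances by m + 1 - d w, which is 1 on the lower
  level and 0 on the upper one.\<close>

lemma new_type:
  assumes "w \<in> set K"
  shows "clique_type d' (v # remove1 w K) = (if d w = r div k then Suc r else r)"
proof -
  have "clique_type d' K = r"
    unfolding r_def using K(1) d'_old by (intro clique_type_cong) auto
  moreover have "d' w = d w" using K(1) d'_old assms by auto
  moreover have "d' v = Suc (r div k)" by (simp add: d'_def)
  ultimately show ?thesis
    using clique_type_remove1[OF assms, of d' v] K_level(1) assms by auto
qed

lemma new_two_level:
  assumes "w \<in> set K"
  shows "two_level d' (v # remove1 w K)"
proof -
  define m where "m = r div k"
  let ?L = "v # remove1 w K"
  have 1: "\<forall>x\<in>set ?L. d' x = m \<or> d' x = Suc m"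
    using K_level(1) K(1) d'_old notin_set_remove1[of _ K w] by (auto simp: m_def d'_def)
  show ?thesis
  proof (cases "\<exists>x\<in>set ?L. d' x = m")
    case True
    then show ?thesis using 1 unfolding two_level_def by blast
  next
    case False
    \<comment> \<open>Here w was the only vertex of the lower level, so m + 1 becomes the lower
      level of the new clique.\<close>
    then have "\<forall>x\<in>set ?L. d' x = Suc m" using 1 by blast
    then show ?thesis unfolding two_level_def by (intro exI[of _ "Suc m"]) auto
  qed
qed

lemma wsum_old: "wsum s d' \<phi> = wsum s d \<phi>"
proof -
  have "clique_type d' (fst x) = clique_type d (fst x)" if "x \<in> set (fst s)" for x
  proof (rule clique_type_cong)
    fix w assume "w \<in> set (fst x)"
    then have "w \<in> verts k n" using that inv unfolding dist_inv_def by blast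
    then show "d' w = d w" by (rule d'_old)
  qed
  then show ?thesis unfolding wsum_def by (intro arg_cong[where f = sum_list] map_cong) auto
qed

text \<open>Of the k + 1 new places, the extra one at \<open>K\<close> has type r, and the one on
  the clique without w has type r + 1 exactly when w is on the lower level, which happens
  \<open>rate k r\<close> times.\<close>

lemma wsum_insert:
  "wsum s' d' \<phi> = wsum s d \<phi> + ((real k + 1 - rate k r) *\<^sub>R \<phi> r + rate k r *\<^sub>R \<phi> (Suc r))"
proof -
  let ?m = "r div k"
  have tK: "clique_type d' K = r"
    unfolding r_def using K(1) d'_old by (intro clique_type_cong) auto
  have len: "length K = k" by (rule K)
  have "(\<Sum>w\<leftarrow>K. \<phi> (clique_type d' (v # remove1 w K))) = (\<Sum>w\<leftarrow>K. \<phi> (if d w = ?m then Suc r else r))"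
    using new_type by (intro arg_cong[where f = sum_list] map_cong) auto
  also have "\<dots> = (real (length K) - real (length (filter (\<lambda>w. d w = ?m) K))) *\<^sub>R \<phi> r
      + real (length (filter (\<lambda>w. d w = ?m) K)) *\<^sub>R \<phi> (Suc r)"
    by (rule sum_list_if_vec)
  also have "\<dots> = (real k - rate k r) *\<^sub>R \<phi> r + rate k r *\<^sub>R \<phi> (Suc r)"
    using K_rate len by simp
  finally have new: "(\<Sum>w\<leftarrow>K. \<phi> (clique_type d' (v # remove1 w K))) = \<dots>" .
  have "wsum s' d' \<phi> = wsum s d' \<phi> - real (Suc c) *\<^sub>R \<phi> r + real (Suc (Suc c)) *\<^sub>R \<phi> r
      + (\<Sum>w\<leftarrow>K. \<phi> (clique_type d' (v # remove1 w K)))"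
    using sum_list_update_vec[OF i, of "\<lambda>x. real (Suc (snd x)) *\<^sub>R \<phi> (clique_type d' (fst x))" "(K, Suc c)"]
    by (simp add: wsum_def s'_eq comp_def tK K_def[symmetric] c_def[symmetric] del: of_nat_Suc) simp
  then show ?thesis unfolding new wsum_old by (simp add: algebra_simps scaleR_2)
qed

lemma verts_Suc: "verts k (Suc n) = insert v (verts k n)"
  by (auto simp: verts_def v_def atLeastAtMostSuc_conv)

lemma total_eq_wsum: "(\<Sum>x\<leftarrow>fst s. real (Suc (snd x))) = wsum s d (\<lambda>_. 1)"
  by (simp add: wsum_def)

text \<open>New edges join v, at level m + 1, to vertices at level m or m + 1, so the growth
  condition holds in both directions; a parent at level m is the closer neighbour of v.\<close>

lemma dist_inv_insert: "dist_inv k (Suc n) s' d'"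
  unfolding dist_inv_def
proof (intro conjI allI impI ballI)
  have R1: "Root 1 \<in> verts k n" using k by (auto simp: verts_def)
  show "d' (Root 1) = 0" using d'_old[OF R1] inv by (simp add: dist_inv_def)
  fix u w assume uw: "(u, w) \<in> snd s'"
  consider "(u, w) \<in> snd s" | "u = v" "w \<in> set K" | "w = v" "u \<in> set K"
    using uw by (auto simp: s'_eq)
  then show "u \<in> verts k (Suc n)" "w \<in> verts k (Suc n)" "d' w \<le> Suc (d' u)"
    unfolding verts_Suc
  proof (atomize (full), cases)
    case 1
    then have "u \<in> verts k n" "w \<in> verts k n" "d w \<le> Suc (d u)" using inv by (auto simp: dist_inv_def)
    then show "u \<in> insert v (verts k n) \<and> w \<in> insert v (verts k n) \<and> d' w \<le> Suc (d' u)"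
      by (simp add: d'_old)
  next
    case 2
    then have "w \<in> verts k n" using K by auto
    moreover have "d w = r div k \<or> d w = Suc (r div k)" using 2 K_level by auto
    ultimately show "u \<in> insert v (verts k n) \<and> w \<in> insert v (verts k n) \<and> d' w \<le> Suc (d' u)"
      using d'_old[of w] 2 by (auto simp: d'_def)
  next
    case 3
    then have "u \<in> verts k n" using K by auto
    moreover have "d u = r div k \<or> d u = Suc (r div k)" using 3 K_level by auto
    ultimately show "u \<in> insert v (verts k n) \<and> w \<in> insert v (verts k n) \<and> d' w \<le> Suc (d' u)"
      using d'_old[of u] 3 by (auto simp: d'_def)
  qed
next
  fix x assume x: "x \<in> verts k (Suc n)" "x \<noteq> Root 1"
  show "\<exists>u. (u, x) \<in> snd s' \<and> d' x = Suc (d' u)"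
  proof (cases "x = v")
    case True
    obtain w where w: "w \<in> set K" "d w = r div k" using K_level(2) by auto
    moreover have "d' w = d w" using w(1) K(1) d'_old by auto
    ultimately show ?thesis using True by (intro exI[of _ w]) (auto simp: s'_eq d'_def)
  next
    case False
    then have xv: "x \<in> verts k n" using x by (simp add: verts_Suc)
    then obtain u where u: "(u, x) \<in> snd s" "d x = Suc (d u)"
      using x(2) inv unfolding dist_inv_def by blast
    then have "u \<in> verts k n" using inv by (auto simp: dist_inv_def)
    then show ?thesis using u d'_old xv by (intro exI[of _ u]) (auto simp: s'_eq)
  qed
next
  fix x assume x: "x \<in> set (fst s')"
  have "x = (K, Suc c) \<or> x \<in> set (fst s) \<or> (\<exists>w\<in>set K. x = (v # remove1 w K, 0))"
    using x set_update_subset_insert[of "fst s" i "(K, Suc c)"] by (auto simp: s'_eq)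
  then consider "x = (K, Suc c)" | "x \<in> set (fst s)" | w where "w \<in> set K" "x = (v # remove1 w K, 0)"
    by blast
  then have "set (fst x) \<subseteq> verts k (Suc n) \<and> length (fst x) = k \<and> two_level d' (fst x)"
  proof cases
    case 1
    have "two_level d' K \<longleftrightarrow> two_level d K"
      unfolding two_level_def using d'_old K(1) by (auto simp: subset_iff)
    then show ?thesis using 1 K by (auto simp: verts_Suc)
  next
    case 2
    then have *: "set (fst x) \<subseteq> verts k n" "length (fst x) = k" "two_level d (fst x)"
      using inv by (auto simp: dist_inv_def)
    then have "two_level d' (fst x) \<longleftrightarrow> two_level d (fst x)"
      unfolding two_level_def using d'_old by (auto simp: subset_iff)
    then show ?thesis using * by (auto simp: verts_Suc)
  next
    case 3
    then show ?thesis using K new_two_level set_remove1_subset[of w K]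
      by (auto simp: verts_Suc length_remove1 dest: length_pos_if_in_set)
  qed
  then show "set (fst x) \<subseteq> verts k (Suc n)" "length (fst x) = k" "two_level d' (fst x)" by auto
next
  have "(\<Sum>x\<leftarrow>fst s'. real (Suc (snd x))) = wsum s' d' (\<lambda>_. 1)" by (simp add: wsum_def)
  also have "\<dots> = (\<Sum>x\<leftarrow>fst s. real (Suc (snd x))) + (real k + 1)"
    unfolding wsum_insert total_eq_wsum by simp
  also have "\<dots> = tok k (Suc n)" using inv by (simp add: dist_inv_def tok_Suc)
  finally show "(\<Sum>x\<leftarrow>fst s'. real (Suc (snd x))) = tok k (Suc n)" .
qed

lemma d'_new: "d' (Node (Suc n)) = Suc (r div k)" by (simp add: d'_def v_def)

end

lemma dist_inv_init:
  assumes "k \<ge> 1"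
  shows "dist_inv k 0 (init_state k) (\<lambda>v. if v = Root 1 then 0 else 1)"
    and "clique_type (\<lambda>v. if v = Root 1 then 0 else 1) (map Root [1..<Suc k]) = k - 1"
proof -
  let ?d = "\<lambda>v. if v = Root 1 then 0 else 1 :: nat"
  show "dist_inv k 0 (init_state k) ?d"
    using assms unfolding dist_inv_def init_state_def two_level_def
    by (auto simp: verts_def tok_def intro!: exI[of _ "0::nat"] simp del: upt_Suc)
  have "clique_type ?d (map Root [1..<Suc m]) = m - 1" for m
    by (induction m) (auto simp: clique_type_def)
  then show "clique_type ?d (map Root [1..<Suc k]) = k - 1" .
qed

text \<open>Distance as a function of the state alone. This allows \<open>wsum\<close> to be
  averaged over random states, for which a certificate \<open>d\<close> is only known to
  exist.\<close>

definition root_dist :: "ktree_state \<Rightarrow> vert \<Rightarrow> nat" where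
  "root_dist s = graph_dist (snd s) (Root 1)"

lemma wsum_root_dist:
  assumes "dist_inv k n s d"
  shows "wsum s (root_dist s) \<phi> = wsum s d \<phi>"
proof -
  have "clique_type (root_dist s) (fst x) = clique_type d (fst x)" if "x \<in> set (fst s)" for x
  proof (rule clique_type_cong)
    fix w assume "w \<in> set (fst x)"
    then have "w \<in> verts k n" using that assms unfolding dist_inv_def by blast
    then show "root_dist s w = d w" using graph_dist_eq[OF assms] by (simp add: root_dist_def)
  qed
  then show ?thesis unfolding wsum_def by (intro arg_cong[where f = sum_list] map_cong) auto
qed

section \<open>Averaging over the random insertion\<close>

lemma choices_Sigma: "choices s = (SIGMA i:{..<length (fst s)}. {..snd (fst s ! i)})"
  by (auto simp: choices_def)

lemma finite_choices: "finite (choices s)"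
  by (simp add: choices_Sigma)

lemma card_choices: "real (card (choices s)) = (\<Sum>x\<leftarrow>fst s. real (Suc (snd x)))"
  by (simp add: choices_Sigma sum_list_sum_nth atLeast0LessThan)

lemma choices_nonempty:
  assumes "dist_inv k n s d"
  shows "choices s \<noteq> {}"
  using card_choices[of s] assms tok_pos[of k n] by (auto simp: dist_inv_def)

lemma expectation_step:
  fixes h :: "ktree_state \<Rightarrow> 'a::{banach, second_countable_topology}"
  assumes inv: "dist_inv k n s d"
  shows "measure_pmf.expectation (step j s) h =
    (1 / tok k n) *\<^sub>R (\<Sum>i<length (fst s). real (Suc (snd (fst s ! i))) *\<^sub>R h (insert_node j s i))"
proof -
  have ne: "choices s \<noteq> {}" using choices_nonempty[OF inv] .
  have card: "real (card (choices s)) = tok k n"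
    using card_choices inv by (simp add: dist_inv_def)
  have "measure_pmf.expectation (step j s) h
      = measure_pmf.expectation (pmf_of_set (choices s)) (\<lambda>x. h (insert_node j s (fst x)))"
    by (simp add: step_def case_prod_beta)
  also have "\<dots> = (\<Sum>x\<in>choices s. pmf (pmf_of_set (choices s)) x *\<^sub>R h (insert_node j s (fst x)))"
    using ne finite_choices by (intro integral_measure_pmf) auto
  also have "\<dots> = (\<Sum>x\<in>choices s. (1 / tok k n) *\<^sub>R h (insert_node j s (fst x)))"
    using ne finite_choices card by (intro sum.cong) auto
  also have "\<dots> = (1 / tok k n) *\<^sub>R (\<Sum>x\<in>choices s. h (insert_node j s (fst x)))"
    by (rule scaleR_sum_right[symmetric])
  also have "(\<Sum>x\<in>choices s. h (insert_node j s (fst x)))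
     = (\<Sum>i<length (fst s). \<Sum>p\<le>snd (fst s ! i). h (insert_node j s i))"
    unfolding choices_Sigma by (subst sum.Sigma) (auto simp: case_prod_beta)
  also have "\<dots> = (\<Sum>i<length (fst s). real (Suc (snd (fst s ! i))) *\<^sub>R h (insert_node j s i))"
    by (simp add: sum_constant_scaleR del: of_nat_Suc)
  finally show ?thesis .
qed

lemma wsum_nth:
  "wsum s d \<phi> = (\<Sum>i<length (fst s). real (Suc (snd (fst s ! i))) *\<^sub>R \<phi> (clique_type d (fst (fst s ! i))))"
  by (simp add: wsum_def sum_list_sum_nth atLeast0LessThan)

text \<open>The increment of \<open>wsum\<close> depends only on the type of the chosen clique, so
  its mean is again a \<open>wsum\<close> divided by the number of places. This closes the recursion
  on \<open>wsum\<close>.\<close>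

lemma expectation_step_wsum:
  fixes \<phi> :: "nat \<Rightarrow> 'a::{banach, second_countable_topology}"
  assumes k: "k \<ge> 1" and inv: "dist_inv k n s d"
  shows "measure_pmf.expectation (step (Suc n) s) (\<lambda>s'. wsum s' (root_dist s') \<phi>)
    = wsum s d (\<lambda>r. \<phi> r + (1 / tok k n) *\<^sub>R ((real k + 1 - rate k r) *\<^sub>R \<phi> r + rate k r *\<^sub>R \<phi> (Suc r)))"
proof -
  define B where "B r = (real k + 1 - rate k r) *\<^sub>R \<phi> r + rate k r *\<^sub>R \<phi> (Suc r)" for r
  have 1: "wsum (insert_node (Suc n) s i) (root_dist (insert_node (Suc n) s i)) \<phi>
      = wsum s d \<phi> + B (clique_type d (fst (fst s ! i)))" if "i < length (fst s)" for i
  proof -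
    interpret I: node_insertion k n s d i using k inv that by unfold_locales
    show ?thesis
      using wsum_root_dist[OF I.dist_inv_insert, of \<phi>] I.wsum_insert[of \<phi>]
      by (simp add: I.s'_def B_def I.r_def I.K_def)
  qed
  have tot: "(\<Sum>i<length (fst s). real (Suc (snd (fst s ! i)))) = tok k n"
    using inv by (simp add: dist_inv_def sum_list_sum_nth atLeast0LessThan)
  have "measure_pmf.expectation (step (Suc n) s) (\<lambda>s'. wsum s' (root_dist s') \<phi>)
     = (1 / tok k n) *\<^sub>R (\<Sum>i<length (fst s). real (Suc (snd (fst s ! i))) *\<^sub>R
         (wsum s d \<phi> + B (clique_type d (fst (fst s ! i)))))"
    unfolding expectation_step[OF inv] using 1 by simp
  also have "\<dots> = (1 / tok k n) *\<^sub>R (tok k n *\<^sub>R wsum s d \<phi> + wsum s d B)"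
    unfolding scaleR_add_right sum.distrib scaleR_sum_left[symmetric] tot wsum_nth[of s d B] ..
  also have "\<dots> = wsum s d \<phi> + (1 / tok k n) *\<^sub>R wsum s d B"
    using tok_pos[of k n] by (simp add: scaleR_add_right)
  also have "\<dots> = wsum s d (\<lambda>r. \<phi> r + (1 / tok k n) *\<^sub>R B r)"
    unfolding wsum_nth by (simp add: scaleR_add_right sum.distrib scaleR_sum_right mult.commute)
  finally show ?thesis by (simp add: B_def)
qed

lemma finite_set_step: "dist_inv k n s d \<Longrightarrow> finite (set_pmf (step j s))"
  using choices_nonempty finite_choices by (simp add: step_def)

lemma ktree_support:
  assumes "k \<ge> 1"
  shows "finite (set_pmf (ktree k n)) \<and> (\<forall>s\<in>set_pmf (ktree k n). \<exists>d. dist_inv k n s d)"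
proof (induction n)
  case 0
  show ?case using dist_inv_init(1)[OF assms] by auto
next
  case (Suc n)
  have "\<exists>d. dist_inv k (Suc n) s' d" if s: "s \<in> set_pmf (ktree k n)" "s' \<in> set_pmf (step (Suc n) s)" for s s'
  proof -
    obtain d where d: "dist_inv k n s d" using Suc s by auto
    then obtain i p where "(i, p) \<in> choices s" and s': "s' = insert_node (Suc n) s i"
      using s(2) choices_nonempty[OF d] finite_choices by (auto simp: step_def)
    then have "i < length (fst s)" by (simp add: choices_def)
    then interpret I: node_insertion k n s d i using assms d by unfold_locales
    show ?thesis using I.dist_inv_insert s' I.s'_def by auto
  qed
  moreover have "finite (set_pmf (step (Suc n) s))" if "s \<in> set_pmf (ktree k n)" for s
    using Suc that finite_set_step by blast
  ultimately show ?case using Suc by auto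
qed

lemma expectation_ktree_Suc:
  fixes h :: "ktree_state \<Rightarrow> 'a::{banach, second_countable_topology}"
  assumes "k \<ge> 1"
  shows "measure_pmf.expectation (ktree k (Suc n)) h
    = measure_pmf.expectation (ktree k n) (\<lambda>s. measure_pmf.expectation (step (Suc n) s) h)"
proof -
  have fin: "finite (set_pmf (ktree k n))" "\<And>s. s \<in> set_pmf (ktree k n) \<Longrightarrow> finite (set_pmf (step (Suc n) s))"
    using ktree_support[OF assms] finite_set_step by blast+
  show ?thesis
    by (simp add: pmf_expectation_bind[OF fin order_refl, where h = h]
        integral_measure_pmf[OF fin(1), of "ktree k n"])
qed

text \<open>Divided by \<open>tok k n\<close> the left-hand side is the mean of
  \<open>\<phi>\<close> at a uniform insertion place of a random tree, which identifies the law of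
  its type with the birth chain.\<close>

theorem expectation_wsum:
  fixes \<phi> :: "nat \<Rightarrow> 'a::{banach, second_countable_topology}"
  assumes "k \<ge> 1"
  shows "measure_pmf.expectation (ktree k n) (\<lambda>s. wsum s (root_dist s) \<phi>) = tok k n *\<^sub>R birth k n \<phi>"
proof (induction n arbitrary: \<phi>)
  case 0
  have "wsum (init_state k) (root_dist (init_state k)) \<phi> = \<phi> (k - 1)"
    unfolding wsum_root_dist[OF dist_inv_init(1)[OF assms]]
    using dist_inv_init(2)[OF assms] by (simp add: wsum_def init_state_def del: upt_Suc)
  then show ?case by (simp add: tok_def)
next
  case (Suc n)
  let ?B = "\<lambda>r. \<phi> r + (1 / tok k n) *\<^sub>R ((real k + 1 - rate k r) *\<^sub>R \<phi> r + rate k r *\<^sub>R \<phi> (Suc r))"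
  have "measure_pmf.expectation (ktree k (Suc n)) (\<lambda>s. wsum s (root_dist s) \<phi>)
    = measure_pmf.expectation (ktree k n) (\<lambda>s. wsum s (root_dist s) ?B)"
    unfolding expectation_ktree_Suc[OF assms]
  proof (intro integral_cong_AE AE_pmfI)
    fix s assume "s \<in> set_pmf (ktree k n)"
    then obtain d where d: "dist_inv k n s d" using ktree_support[OF assms] by auto
    show "measure_pmf.expectation (step (Suc n) s) (\<lambda>s. wsum s (root_dist s) \<phi>) = wsum s (root_dist s) ?B"
      unfolding expectation_step_wsum[OF assms d] wsum_root_dist[OF d] ..
  qed auto
  also have "\<dots> = birth k n (\<lambda>r. tok k n *\<^sub>R ?B r)"
    unfolding Suc birth_scaleR ..
  \<comment> \<open>Both sides equal tok (n + 1) times phi r plus rate times the increment of phi: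
    the old places and the k + 1 new ones make up \<open>tok k (Suc n)\<close>.\<close>
  also have "(\<lambda>r. tok k n *\<^sub>R ?B r)
    = (\<lambda>r. tok k (Suc n) *\<^sub>R (\<phi> r + (rate k r / tok k (Suc n)) *\<^sub>R (\<phi> (Suc r) - \<phi> r)))"
  proof
    fix r
    have "tok k (Suc n) *\<^sub>R (\<phi> r + (rate k r / tok k (Suc n)) *\<^sub>R (\<phi> (Suc r) - \<phi> r))
        = tok k (Suc n) *\<^sub>R \<phi> r + rate k r *\<^sub>R (\<phi> (Suc r) - \<phi> r)"
      using tok_pos[of k "Suc n"] by (simp add: scaleR_add_right)
    moreover have "tok k n *\<^sub>R ?B r
        = tok k n *\<^sub>R \<phi> r + ((real k + 1 - rate k r) *\<^sub>R \<phi> r + rate k r *\<^sub>R \<phi> (Suc r))"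
      using tok_pos[of k n] by (simp add: scaleR_add_right)
    moreover have "tok k n *\<^sub>R \<phi> r + ((real k + 1 - rate k r) *\<^sub>R \<phi> r + rate k r *\<^sub>R \<phi> (Suc r))
        = tok k (Suc n) *\<^sub>R \<phi> r + rate k r *\<^sub>R (\<phi> (Suc r) - \<phi> r)"
      by (simp add: tok_Suc algebra_simps)
    ultimately show "tok k n *\<^sub>R ?B r
        = tok k (Suc n) *\<^sub>R (\<phi> r + (rate k r / tok k (Suc n)) *\<^sub>R (\<phi> (Suc r) - \<phi> r))"
      by (simp only:)
  qed
  finally show ?case by (simp add: birth_scaleR)
qed

text \<open>Node n + 1 is attached at a uniform place of the tree of size n, one step beyond the
  lower level r div k of that place. Hence the index shift between \<open>Dist\<close> and
  \<open>birth\<close>.\<close>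

theorem expectation_Dist:
  fixes h :: "nat \<Rightarrow> 'a::{banach, second_countable_topology}"
  assumes "k \<ge> 1"
  shows "measure_pmf.expectation (Dist k (Suc n)) h = birth k n (\<lambda>r. h (Suc (r div k)))"
proof -
  let ?g = "\<lambda>r. h (Suc (r div k))"
  have "measure_pmf.expectation (Dist k (Suc n)) h
     = measure_pmf.expectation (ktree k (Suc n)) (\<lambda>s. h (root_dist s (Node (Suc n))))"
    by (simp add: Dist_def root_dist_def del: ktree.simps)
  also have "\<dots> = measure_pmf.expectation (ktree k n) (\<lambda>s. (1 / tok k n) *\<^sub>R wsum s (root_dist s) ?g)"
    unfolding expectation_ktree_Suc[OF assms]
  proof (intro integral_cong_AE AE_pmfI)
    fix s assume "s \<in> set_pmf (ktree k n)"
    then obtain d where d: "dist_inv k n s d" using ktree_support[OF assms] by auto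
    have *: "root_dist (insert_node (Suc n) s i) (Node (Suc n)) = Suc (clique_type d (fst (fst s ! i)) div k)"
      if "i < length (fst s)" for i
    proof -
      interpret I: node_insertion k n s d i using assms d that by unfold_locales
      show ?thesis using graph_dist_eq[OF I.dist_inv_insert, of "Node (Suc n)"] I.d'_new
        by (simp add: root_dist_def I.s'_def I.r_def I.K_def verts_def)
    qed
    show "measure_pmf.expectation (step (Suc n) s) (\<lambda>s. h (root_dist s (Node (Suc n))))
       = (1 / tok k n) *\<^sub>R wsum s (root_dist s) ?g"
      unfolding expectation_step[OF d] wsum_root_dist[OF d, of ?g]
      unfolding wsum_nth[of s d] using * by simp
  qed auto
  also have "\<dots> = birth k n ?g"
    using expectation_wsum[OF assms, of n ?g] tok_pos[of k n] by simp
  finally show ?thesis .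
qed

section \<open>Energy decay on the residues\<close>

text \<open>The clock of the chain, equal to log n / (k + 1) up to a bounded error.\<close>

definition hsum :: "nat \<Rightarrow> nat \<Rightarrow> real" where
  "hsum k n = (\<Sum>i=1..n. 1 / tok k i)"

definition cpred :: "nat \<Rightarrow> nat \<Rightarrow> nat" where
  "cpred k j = (if j = 0 then k - 1 else j - 1)"

text \<open>The forward equation on the residues: inflow from the preceding residue minus outflow.
  The passage from k - 1 to 0 completes a level and picks up the phase
  \<open>\<omega>\<close>.\<close>

definition cycle_flow :: "nat \<Rightarrow> complex \<Rightarrow> (nat \<Rightarrow> complex) \<Rightarrow> nat \<Rightarrow> complex" where
  "cycle_flow k \<omega> v j =
     (if j = 0 then \<omega> else 1) * (rate k (cpred k j) *\<^sub>R v (cpred k j)) - rate k j *\<^sub>R v j"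

text \<open>The weight \<open>rate\<close> turns the derivative of the energy along the flow into
  twice the inner product of rate times v with the flow.\<close>

definition cycle_energy :: "nat \<Rightarrow> (nat \<Rightarrow> complex) \<Rightarrow> real" where
  "cycle_energy k v = (\<Sum>j<k. rate k j * (norm (v j))\<^sup>2)"

definition cycle_dissip :: "nat \<Rightarrow> complex \<Rightarrow> (nat \<Rightarrow> complex) \<Rightarrow> real" where
  "cycle_dissip k \<omega> v = (\<Sum>j<k. (norm (cycle_flow k \<omega> v j))\<^sup>2)"

lemma cycle_dissip_nonneg: "cycle_dissip k \<omega> v \<ge> 0"
  by (simp add: cycle_dissip_def sum_nonneg)

lemma sum_cpred:
  assumes "k \<ge> 1"
  shows "(\<Sum>j<k. g (cpred k j)) = (\<Sum>j<k. g j)"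
  using assms
  by (intro sum.reindex_bij_witness[where j = "cpred k" and i = "\<lambda>j. if j = k - 1 then 0 else Suc j"])
     (auto simp: cpred_def)

text \<open>Polarization: the cross term is expressed by norms, so that the isometry of the shift
  can be applied to the norm of \<open>\<rho> *\<^sub>R v + \<delta>\<close>.\<close>

lemma weighted_norm_add:
  fixes v \<delta> :: "'a::real_inner"
  shows "\<rho> * (norm (v + h *\<^sub>R \<delta>))\<^sup>2 = \<rho> * (norm v)\<^sup>2
    + h * ((norm (\<rho> *\<^sub>R v + \<delta>))\<^sup>2 - (norm (\<rho> *\<^sub>R v))\<^sup>2 - (norm \<delta>)\<^sup>2) + h\<^sup>2 * \<rho> * (norm \<delta>)\<^sup>2"
  unfolding power2_norm_eq_inner
  by (simp add: inner_add_left inner_add_right inner_commute[of \<delta> v] algebra_simps power2_eq_square)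

text \<open>With y = rate * v the flow is S y - y for a phased cyclic shift S. As S is an isometry,
  twice the inner product of y and S y - y is minus the square of the norm of S y - y.\<close>

lemma cycle_energy_step:
  assumes k: "k \<ge> 1" and \<omega>: "norm \<omega> = 1"
  shows "cycle_energy k (\<lambda>j. v j + h *\<^sub>R cycle_flow k \<omega> v j)
    \<le> cycle_energy k v - h * (1 - h * real k) * cycle_dissip k \<omega> v"
proof -
  let ?y = "\<lambda>j. rate k j *\<^sub>R v j" and ?f = "cycle_flow k \<omega> v"
  have "(norm (?y j + ?f j))\<^sup>2 = (norm (?y (cpred k j)))\<^sup>2" for j
    using \<omega> by (simp add: cycle_flow_def norm_mult)
  then have *: "(\<Sum>j<k. (norm (?y j + ?f j))\<^sup>2) = (\<Sum>j<k. (norm (?y j))\<^sup>2)"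
    using sum_cpred[OF k, of "\<lambda>j. (norm (?y j))\<^sup>2"] by simp
  have "cycle_energy k (\<lambda>j. v j + h *\<^sub>R ?f j) = (\<Sum>j<k. rate k j * (norm (v j))\<^sup>2
      + h * ((norm (?y j + ?f j))\<^sup>2 - (norm (?y j))\<^sup>2 - (norm (?f j))\<^sup>2) + h\<^sup>2 * rate k j * (norm (?f j))\<^sup>2)"
    unfolding cycle_energy_def by (intro sum.cong refl weighted_norm_add)
  also have "\<dots> = cycle_energy k v + h * ((\<Sum>j<k. (norm (?y j + ?f j))\<^sup>2) - (\<Sum>j<k. (norm (?y j))\<^sup>2)
      - cycle_dissip k \<omega> v) + h\<^sup>2 * (\<Sum>j<k. rate k j * (norm (?f j))\<^sup>2)"
    by (simp add: sum.distrib sum_subtractf sum_distrib_left cycle_energy_def cycle_dissip_def algebra_simps)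
  also have "\<dots> = cycle_energy k v - h * cycle_dissip k \<omega> v + h\<^sup>2 * (\<Sum>j<k. rate k j * (norm (?f j))\<^sup>2)"
    unfolding * by simp
  also have "h\<^sup>2 * (\<Sum>j<k. rate k j * (norm (?f j))\<^sup>2) \<le> h\<^sup>2 * (real k * cycle_dissip k \<omega> v)"
    unfolding cycle_dissip_def sum_distrib_left[of "real k"]
    by (intro mult_left_mono sum_mono mult_right_mono rate_le) auto
  finally have "cycle_energy k (\<lambda>j. v j + h *\<^sub>R ?f j)
      \<le> cycle_energy k v - h * cycle_dissip k \<omega> v + h\<^sup>2 * (real k * cycle_dissip k \<omega> v)"
    by simp
  then show ?thesis by (simp add: algebra_simps power2_eq_square)
qed

lemma cycle_flow_le: "j < k \<Longrightarrow> norm (cycle_flow k \<omega> v j) \<le> sqrt (cycle_dissip k \<omega> v)"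
  unfolding cycle_dissip_def
  by (intro real_le_rsqrt member_le_sum) auto

text \<open>Away from the wrap-around the flow is the difference of consecutive y = rate times v, so
  the difference of two y telescopes into flow terms.\<close>

lemma cycle_chain:
  assumes "i \<le> j" "j < k"
  shows "norm (rate k j *\<^sub>R v j - rate k i *\<^sub>R v i) \<le> real (j - i) * sqrt (cycle_dissip k \<omega> v)"
  using assms
proof (induction j rule: dec_induct)
  case (step j)
  have "cycle_flow k \<omega> v (Suc j) = rate k j *\<^sub>R v j - rate k (Suc j) *\<^sub>R v (Suc j)"
    by (simp add: cycle_flow_def cpred_def)
  then have "norm (rate k (Suc j) *\<^sub>R v (Suc j) - rate k j *\<^sub>R v j) \<le> sqrt (cycle_dissip k \<omega> v)"
    using cycle_flow_le[OF step.prems, of \<omega> v] by (simp add: norm_minus_commute)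
  moreover have "norm (rate k j *\<^sub>R v j - rate k i *\<^sub>R v i) \<le> real (j - i) * sqrt (cycle_dissip k \<omega> v)"
    using step by simp
  ultimately have "norm (rate k (Suc j) *\<^sub>R v (Suc j) - rate k i *\<^sub>R v i)
     \<le> sqrt (cycle_dissip k \<omega> v) + real (j - i) * sqrt (cycle_dissip k \<omega> v)"
    using norm_triangle_mono[of "rate k (Suc j) *\<^sub>R v (Suc j) - rate k j *\<^sub>R v j" _ "rate k j *\<^sub>R v j - rate k i *\<^sub>R v i"]
    by simp
  moreover have "real (Suc j - i) = real (j - i) + 1" using step by simp
  ultimately show ?case by (simp add: algebra_simps)
qed simp

text \<open>One full turn around the cycle, starting and ending at j, multiplies y by omega and uses
  k flow terms. A nontrivial phase therefore forces y to be small when the dissipation is.\<close>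

lemma cycle_gap_phase:
  assumes j: "j < k" and \<omega>: "norm \<omega> = 1"
  shows "norm (\<omega> - 1) * norm (rate k j *\<^sub>R v j) \<le> real k * sqrt (cycle_dissip k \<omega> v)"
proof -
  let ?y = "\<lambda>j. rate k j *\<^sub>R v j" and ?d = "sqrt (cycle_dissip k \<omega> v)"
  have 1: "norm (\<omega> * (?y j - ?y (k - 1))) \<le> real (k - 1 - j) * ?d"
    using cycle_chain[of j "k - 1" k v \<omega>] j \<omega> by (simp add: norm_mult norm_minus_commute)
  have 2: "norm (\<omega> * ?y (k - 1) - ?y 0) \<le> ?d"
    using cycle_flow_le[of 0 k \<omega> v] j by (simp add: cycle_flow_def cpred_def)
  have 3: "norm (?y 0 - ?y j) \<le> real j * ?d"
    using cycle_chain[of 0 j k v \<omega>] j by (simp add: norm_minus_commute)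
  have "norm (\<omega> - 1) * norm (?y j) = norm (\<omega> * (?y j - ?y (k - 1)) + (\<omega> * ?y (k - 1) - ?y 0) + (?y 0 - ?y j))"
    unfolding norm_mult[symmetric] by (simp add: algebra_simps)
  also have "\<dots> \<le> real (k - 1 - j) * ?d + ?d + real j * ?d"
    by (intro norm_triangle_mono 1 2 3)
  also have "\<dots> = (real (k - 1 - j) + 1 + real j) * ?d" by (simp add: algebra_simps)
  also have "real (k - 1 - j) + 1 + real j = real k" using j by simp
  finally show ?thesis .
qed

text \<open>For phase 1 the flow vanishes on constant y, that is on v proportional to 1 / rate, and
  zero sum excludes this direction: weighting the differences of y by 1 / rate leaves a multiple of
  y at j alone.\<close>

lemma cycle_gap_zero_sum:
  assumes j: "j < k" and sum0: "(\<Sum>i<k. v i) = 0"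
  shows "norm (rate k j *\<^sub>R v j) \<le> real k * sqrt (cycle_dissip k 1 v)"
proof -
  let ?y = "\<lambda>j. rate k j *\<^sub>R v j" and ?d = "sqrt (cycle_dissip k 1 v)"
  have d0: "?d \<ge> 0" using cycle_dissip_nonneg by simp
  have k: "k \<ge> 1" using j by simp
  define H where "H = (\<Sum>i<k. 1 / rate k i)"
  have r: "rate k i \<ge> 1" for i using rate_ge_1[OF k] .
  have rp: "rate k i > 0" for i using r[of i] by linarith
  have H: "H > 0" unfolding H_def using j rp by (intro sum_pos) auto
  have diff: "norm (?y j - ?y i) \<le> real k * ?d" if "i < k" for i
  proof -
    have "norm (?y j - ?y i) \<le> real (if i \<le> j then j - i else i - j) * ?d"
      using cycle_chain[of i j k v 1] cycle_chain[of j i k v 1] j that by (auto simp: norm_minus_commute)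
    also have "\<dots> \<le> real k * ?d"
      using j that by (intro mult_right_mono d0) auto
    finally show ?thesis .
  qed
  have "(\<Sum>i<k. (1 / rate k i) *\<^sub>R (?y j - ?y i)) = H *\<^sub>R ?y j - (\<Sum>i<k. (1 / rate k i) *\<^sub>R ?y i)"
    unfolding H_def scaleR_sum_left scaleR_diff_right sum_subtractf ..
  also have "(\<Sum>i<k. (1 / rate k i) *\<^sub>R ?y i) = (\<Sum>i<k. v i)"
    using rp by (intro sum.cong) (auto simp: less_imp_neq[THEN not_sym])
  finally have "H * norm (?y j) = norm (\<Sum>i<k. (1 / rate k i) *\<^sub>R (?y j - ?y i))"
    using sum0 H by (simp add: abs_mult)
  also have "\<dots> \<le> (\<Sum>i<k. (1 / rate k i) * (real k * ?d))"
  proof (intro sum_norm_le)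
    fix i assume "i \<in> {..<k}"
    then show "norm ((1 / rate k i) *\<^sub>R (?y j - ?y i)) \<le> 1 / rate k i * (real k * ?d)"
      using mult_left_mono[OF diff[of i], of "1 / rate k i"] rp[of i] by simp
  qed
  also have "\<dots> = H * (real k * ?d)" by (simp add: H_def sum_distrib_right)
  finally show ?thesis using H by simp
qed

lemma cycle_energy_gap:
  assumes k: "k \<ge> 1" and \<alpha>: "\<alpha> \<ge> 0"
    and gap: "\<And>j. j < k \<Longrightarrow> \<alpha> * norm (rate k j *\<^sub>R v j) \<le> real k * sqrt (cycle_dissip k \<omega> v)"
  shows "\<alpha>\<^sup>2 * cycle_energy k v \<le> real k ^ 3 * cycle_dissip k \<omega> v"
proof -
  have "\<alpha>\<^sup>2 * (rate k j * (norm (v j))\<^sup>2) \<le> (real k)\<^sup>2 * cycle_dissip k \<omega> v" if j: "j < k" for j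
  proof -
    have r: "rate k j \<ge> 1" using rate_ge_1[OF k] .
    have "rate k j * (norm (v j))\<^sup>2 \<le> (rate k j)\<^sup>2 * (norm (v j))\<^sup>2"
      using r by (intro mult_right_mono) (auto simp: power2_eq_square)
    then have "\<alpha>\<^sup>2 * (rate k j * (norm (v j))\<^sup>2) \<le> \<alpha>\<^sup>2 * ((rate k j)\<^sup>2 * (norm (v j))\<^sup>2)"
      by (rule mult_left_mono) simp
    also have "\<dots> = (\<alpha> * norm (rate k j *\<^sub>R v j))\<^sup>2"
      by (simp add: power_mult_distrib)
    also have "\<dots> \<le> (real k * sqrt (cycle_dissip k \<omega> v))\<^sup>2"
      using gap[OF j] \<alpha> by (intro power_mono) auto
    finally show ?thesis using cycle_dissip_nonneg by (simp add: power_mult_distrib)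
  qed
  then have "(\<Sum>j<k. \<alpha>\<^sup>2 * (rate k j * (norm (v j))\<^sup>2)) \<le> (\<Sum>j<k. (real k)\<^sup>2 * cycle_dissip k \<omega> v)"
    by (intro sum_mono) auto
  then show ?thesis by (simp add: cycle_energy_def sum_distrib_left power3_eq_cube power2_eq_square)
qed

text \<open>Dissipation dominates energy by \<open>cycle_energy_gap\<close>, with loss k^3. The
  factor 2 / (k + 2) is a lower bound of 1 - k h for the step h = 1 / tok, because tok is at least k
  + 2. The gap constant alpha is used with |theta| / 2 and with 1.\<close>

lemma cycle_energy_contract:
  assumes k: "k \<ge> 1" and \<omega>: "norm \<omega> = 1" and \<alpha>: "\<alpha> \<ge> 0"
    and gap: "\<And>j. j < k \<Longrightarrow> \<alpha> * norm (rate k j *\<^sub>R v j) \<le> real k * sqrt (cycle_dissip k \<omega> v)"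
  shows "cycle_energy k (\<lambda>j. v j + (1 / tok k (Suc n)) *\<^sub>R cycle_flow k \<omega> v j)
    \<le> (1 - (2 / ((real k + 2) * real k ^ 3)) * \<alpha>\<^sup>2 / tok k (Suc n)) * cycle_energy k v"
proof -
  define h where "h = 1 / tok k (Suc n)"
  have h0: "h > 0" using tok_pos by (simp add: h_def)
  have "h * real k \<le> real k / (real k + 2)"
    unfolding h_def using tok_Suc_ge[of k n] by (simp add: frac_le)
  also have "\<dots> = 1 - 2 / (real k + 2)" by (simp add: field_simps)
  finally have h1: "2 / (real k + 2) \<le> 1 - h * real k" by simp
  have "\<alpha>\<^sup>2 * cycle_energy k v / real k ^ 3 \<le> cycle_dissip k \<omega> v"
    using cycle_energy_gap[OF k \<alpha> gap] k by (simp add: divide_simps mult.commute)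
  then have "(h * (2 / (real k + 2))) * (\<alpha>\<^sup>2 * cycle_energy k v / real k ^ 3)
      \<le> (h * (1 - h * real k)) * cycle_dissip k \<omega> v"
    using h1 h0 order_trans[OF _ h1, of 0]
    by (intro mult_mono mult_left_mono mult_nonneg_nonneg divide_nonneg_nonneg)
       (auto simp: cycle_energy_def intro!: sum_nonneg rate_nonneg mult_nonneg_nonneg)
  then have "cycle_energy k (\<lambda>j. v j + h *\<^sub>R cycle_flow k \<omega> v j)
     \<le> cycle_energy k v - (h * (2 / (real k + 2))) * (\<alpha>\<^sup>2 * cycle_energy k v / real k ^ 3)"
    using cycle_energy_step[OF k \<omega>, of v h] by linarith
  also have "\<dots> = (1 - (2 / ((real k + 2) * real k ^ 3)) * \<alpha>\<^sup>2 * h) * cycle_energy k v"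
    by (simp add: algebra_simps)
  finally show ?thesis by (simp add: h_def)
qed

text \<open>The part of the expectation carried by residue class j. Since the rates depend on the
  residue only, these parts satisfy a forward equation.\<close>

definition occ :: "nat \<Rightarrow> nat \<Rightarrow> (nat \<Rightarrow> complex) \<Rightarrow> nat \<Rightarrow> complex" where
  "occ k n \<phi> j = birth k n (\<lambda>r. if r mod k = j then \<phi> r else 0)"

lemma rate_mod: "rate k (r mod k) = rate k r"
  by (simp add: rate_def)

lemma Suc_mod_eq_iff:
  assumes "j < k"
  shows "Suc r mod k = j \<longleftrightarrow> r mod k = cpred k j"
  using assms mod_less_divisor[of k r] by (auto simp: mod_Suc cpred_def)

text \<open>Class j is entered from the class before it, with \<open>\<phi>\<close> evaluated after
  the jump, and left at its own rate. For general \<open>\<phi>\<close> the shifted function occurs;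
  the recursion closes when the shift acts as a constant on each class.\<close>

lemma occ_Suc:
  assumes j: "j < k"
  shows "occ k (Suc n) \<phi> j = occ k n \<phi> j + (1 / tok k (Suc n)) *\<^sub>R
     (rate k (cpred k j) *\<^sub>R occ k n (\<lambda>r. \<phi> (Suc r)) (cpred k j) - rate k j *\<^sub>R occ k n \<phi> j)"
proof -
  have *: "(rate k r / tok k (Suc n)) *\<^sub>R ((if Suc r mod k = j then \<phi> (Suc r) else 0) - (if r mod k = j then \<phi> r else 0))
    = (rate k (cpred k j) / tok k (Suc n)) *\<^sub>R (if r mod k = cpred k j then \<phi> (Suc r) else 0)
      - (rate k j / tok k (Suc n)) *\<^sub>R (if r mod k = j then \<phi> r else 0)" for r
    using rate_mod[of k r] unfolding Suc_mod_eq_iff[OF j] by (auto simp: algebra_simps)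
  show ?thesis
    unfolding occ_def birth.simps * birth_add birth_diff birth_scaleR by (simp add: algebra_simps)
qed

lemma occ_0: "occ k 0 \<phi> j = (if (k - 1) mod k = j then \<phi> (k - 1) else 0)"
  by (simp add: occ_def)

lemma sum_occ:
  assumes "k \<ge> 1"
  shows "(\<Sum>j<k. occ k n \<phi> j) = birth k n \<phi>"
proof -
  have "(\<Sum>j<k. occ k n \<phi> j) = birth k n (\<lambda>r. \<Sum>j<k. if r mod k = j then \<phi> r else 0)"
    unfolding occ_def by (rule birth_sum[symmetric]) simp
  also have "(\<lambda>r. \<Sum>j<k. if r mod k = j then \<phi> r else 0) = \<phi>"
    using assms by (auto simp: sum.delta)
  finally show ?thesis .
qed

definition level_char :: "nat \<Rightarrow> real \<Rightarrow> nat \<Rightarrow> complex" where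
  "level_char k \<theta> r = cis (\<theta> * real (r div k))"

lemma level_char_Suc:
  assumes "k \<ge> 1"
  shows "level_char k \<theta> (Suc r) = (if Suc r mod k = 0 then cis \<theta> else 1) * level_char k \<theta> r"
  using assms by (auto simp: level_char_def div_Suc cis_mult algebra_simps)

text \<open>The character depends on the level only, so a jump multiplies it by
  \<open>cis \<theta>\<close> at the wrap-around and by 1 elsewhere: the recursion closes.\<close>

lemma occ_level_char_Suc:
  assumes j: "j < k"
  shows "occ k (Suc n) (level_char k \<theta>) j = occ k n (level_char k \<theta>) j
    + (1 / tok k (Suc n)) *\<^sub>R cycle_flow k (cis \<theta>) (occ k n (level_char k \<theta>)) j"
proof -
  have k: "k \<ge> 1" using j by simp
  have "(if r mod k = cpred k j then level_char k \<theta> (Suc r) else 0)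
     = (if j = 0 then cis \<theta> else 1) * (if r mod k = cpred k j then level_char k \<theta> r else 0)" for r
    using level_char_Suc[OF k, of \<theta> r] Suc_mod_eq_iff[OF j, of r] by auto
  then have "occ k n (\<lambda>r. level_char k \<theta> (Suc r)) (cpred k j)
     = (if j = 0 then cis \<theta> else 1) * occ k n (level_char k \<theta>) (cpred k j)"
    unfolding occ_def by (simp add: birth_mult[symmetric] del: mult_eq_if)
  then show ?thesis unfolding occ_Suc[OF j] cycle_flow_def by (simp add: mult_scaleR_right)
qed

lemma norm_cis_minus_1:
  assumes "\<bar>\<theta>\<bar> \<le> 1"
  shows "norm (cis \<theta> - 1) \<ge> \<bar>\<theta>\<bar> / 2"
proof -
  have "norm (cis \<theta> - 1 - \<i> * \<theta>) \<le> \<bar>\<theta>\<bar>\<^sup>2 / 2"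
    using iexp_approx1[of \<theta> 1]
    by (simp add: cis_conv_exp fact_numeral algebra_simps flip: power2_eq_square)
  then have "\<bar>\<theta>\<bar> - norm (cis \<theta> - 1) \<le> \<bar>\<theta>\<bar>\<^sup>2 / 2"
    using norm_triangle_ineq2[of "\<i> * \<theta>" "cis \<theta> - 1"] by (simp add: norm_mult norm_minus_commute)
  moreover have "\<bar>\<theta>\<bar>\<^sup>2 \<le> \<bar>\<theta>\<bar>"
    using mult_left_mono[of "\<bar>\<theta>\<bar>" 1 "\<bar>\<theta>\<bar>"] assms by (simp add: power2_eq_square)
  ultimately show ?thesis by linarith
qed

text \<open>With gap constant |theta| / 2 the energy decays at rate theta^2 / (2 (k + 2) k^3) per
  unit of \<open>hsum\<close>; half of it remains for the norm.\<close>

definition decay :: "nat \<Rightarrow> real" where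
  "decay k = 1 / (4 * (real k + 2) * real k ^ 3)"

lemma decay_pos: "k \<ge> 1 \<Longrightarrow> decay k > 0"
  by (simp add: decay_def)

lemma occ_level_char_bound:
  assumes j: "j < k" and \<theta>: "\<bar>\<theta>\<bar> \<le> 1"
  shows "norm (occ k n (level_char k \<theta>) j) \<le> exp (- (decay k * \<theta>\<^sup>2 * hsum k n))"
proof -
  have k: "k \<ge> 1" using j by simp
  have decay2: "(2 / ((real k + 2) * real k ^ 3)) * (x / 4) = 2 * decay k * x" for x
    unfolding decay_def mult.assoc[of 4] by simp
  define E where "E n = cycle_energy k (occ k n (level_char k \<theta>))" for n
  have E_le: "E n \<le> exp (- (2 * decay k * \<theta>\<^sup>2 * hsum k n))" for n
  proof (induction n)
    case 0
    \<comment> \<open>The root clique puts all mass into class k - 1, whose rate is 1.\<close>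
    have "E 0 = (\<Sum>j<k. if j = k - 1 then rate k j * 1 else 0)"
      unfolding E_def cycle_energy_def using k
      by (intro sum.cong) (auto simp: occ_0 level_char_def)
    also have "\<dots> = 1" using k by (simp add: sum.delta rate_def)
    finally show ?case by (simp add: hsum_def)
  next
    case (Suc n)
    define x where "x = 2 * decay k * \<theta>\<^sup>2 / tok k (Suc n)"
    have "E (Suc n) = cycle_energy k (\<lambda>j. occ k n (level_char k \<theta>) j
        + (1 / tok k (Suc n)) *\<^sub>R cycle_flow k (cis \<theta>) (occ k n (level_char k \<theta>)) j)"
      unfolding E_def cycle_energy_def using occ_level_char_Suc by (intro sum.cong) auto
    also have "\<dots> \<le> (1 - (2 / ((real k + 2) * real k ^ 3)) * (\<bar>\<theta>\<bar> / 2)\<^sup>2 / tok k (Suc n)) * E n"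
      unfolding E_def
    proof (intro cycle_energy_contract k)
      fix j assume "j < k"
      then show "\<bar>\<theta>\<bar> / 2 * norm (rate k j *\<^sub>R occ k n (level_char k \<theta>) j)
          \<le> real k * sqrt (cycle_dissip k (cis \<theta>) (occ k n (level_char k \<theta>)))"
        using mult_right_mono[OF norm_cis_minus_1[OF \<theta>]] cycle_gap_phase norm_cis
        by (meson norm_ge_zero order_trans)
    qed auto
    also have "1 - (2 / ((real k + 2) * real k ^ 3)) * (\<bar>\<theta>\<bar> / 2)\<^sup>2 / tok k (Suc n) = 1 - x"
      using decay2[of "\<theta>\<^sup>2"] unfolding x_def by (simp add: power_divide)
    also have "(1 - x) * E n \<le> exp (- x) * E n"
      using exp_ge_add_one_self[of "- x"]
      by (intro mult_right_mono) (auto simp: E_def cycle_energy_def intro!: sum_nonneg mult_nonneg_nonneg rate_nonneg)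
    also have "\<dots> \<le> exp (- x) * exp (- (2 * decay k * \<theta>\<^sup>2 * hsum k n))"
      using Suc by simp
    also have "\<dots> = exp (- (2 * decay k * \<theta>\<^sup>2 * hsum k (Suc n)))"
      by (simp add: mult_exp_exp x_def hsum_def algebra_simps)
    finally show ?case .
  qed
  have "(norm (occ k n (level_char k \<theta>) j))\<^sup>2 \<le> rate k j * (norm (occ k n (level_char k \<theta>) j))\<^sup>2"
    using rate_ge_1[OF k, of j] mult_right_mono[of 1 "rate k j"] by simp
  also have "\<dots> \<le> E n" unfolding E_def cycle_energy_def
    using j by (intro member_le_sum) (auto intro!: mult_nonneg_nonneg rate_nonneg)
  also have "\<dots> \<le> (exp (- (decay k * \<theta>\<^sup>2 * hsum k n)))\<^sup>2"
    using E_le[of n] by (simp add: exp_double[symmetric] algebra_simps)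
  finally show ?thesis by (rule power2_le_imp_le) simp
qed

section \<open>A smoothing inequality\<close>

text \<open>An opaque name for \<open>sinc\<close>, so that its case distinction at 0 is unfolded
  only on request.\<close>

definition Sinc :: "real \<Rightarrow> real" where
  "Sinc x = sinc x"

lemma isCont_Sinc: "isCont Sinc x"
  using isCont_sinc[of x] by (simp add: Sinc_def[abs_def])

text \<open>The Fejer kernel (sin (x / 2) / (x / 2))^2, given as the Fourier transform of a triangle
  on [-1, 1]. Smoothing with it sees characteristic functions only at frequencies up to 1.\<close>

definition fejer :: "real \<Rightarrow> real" where
  "fejer x = integral {0..1} (\<lambda>t. 2 * (1 - t) * cos (t * x))"

text \<open>The primitive of \<open>fejer\<close> vanishing at 0, with sin (t x) / t written as x
  Sinc (t x) so that t = 0 is harmless.\<close>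

definition fejer_prim :: "real \<Rightarrow> real" where
  "fejer_prim x = integral {0..1} (\<lambda>t. 2 * (1 - t) * (x * Sinc (t * x)))"

lemma continuous_on_Sinc [continuous_intros]:
  "continuous_on A f \<Longrightarrow> continuous_on A (\<lambda>x. Sinc (f x))"
  unfolding Sinc_def by (rule continuous_on_sinc)

lemma borel_measurable_Sinc [measurable]: "Sinc \<in> borel_measurable borel"
  by (intro borel_measurable_continuous_onI continuous_at_imp_continuous_on ballI isCont_Sinc)

lemma fejer_prim_deriv: "(fejer_prim has_real_derivative fejer x) (at x)"
proof -
  have der: "((\<lambda>x. 2 * (1 - t) * (x * Sinc (t * x))) has_field_derivative 2 * (1 - t) * cos (t * x)) (at x within UNIV)"
    for x t :: real
  proof (cases "t = 0")
    case True
    then show ?thesis by (auto intro!: derivative_eq_intros simp: Sinc_def)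
  next
    case False
    then have "(\<lambda>x. 2 * (1 - t) * (x * Sinc (t * x))) = (\<lambda>x. 2 * (1 - t) * (sin (t * x) / t))"
      by (auto simp: Sinc_def)
    then show ?thesis using False by (auto intro!: derivative_eq_intros)
  qed
  have "((\<lambda>x. integral (cbox 0 1) (\<lambda>t. 2 * (1 - t) * (x * Sinc (t * x)))) has_field_derivative
      integral (cbox 0 1) (\<lambda>t. 2 * (1 - t) * cos (t * x))) (at x within UNIV)"
  proof (rule leibniz_rule_field_derivative)
    show "(\<lambda>t. 2 * (1 - t) * (x * Sinc (t * x))) integrable_on cbox 0 1" for x :: real
      by (intro integrable_continuous continuous_intros)
    show "continuous_on (UNIV \<times> cbox 0 1) (\<lambda>(x, t). 2 * (1 - t) * cos (t * x :: real))"
      unfolding case_prod_beta by (intro continuous_intros)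
  qed (use der in auto)
  then show ?thesis unfolding fejer_prim_def[abs_def] fejer_def by simp
qed

lemma fejer_eq: "x \<noteq> 0 \<Longrightarrow> fejer x = 2 * (1 - cos x) / x\<^sup>2"
proof -
  assume x: "x \<noteq> 0"
  let ?F = "\<lambda>t. 2 * ((1 - t) * sin (t * x) / x - cos (t * x) / x\<^sup>2)"
  have "((\<lambda>t. 2 * (1 - t) * cos (t * x)) has_integral (?F 1 - ?F 0)) {0..1}"
  proof (rule fundamental_theorem_of_calculus)
    fix t :: real
    have "(?F has_real_derivative 2 * (1 - t) * cos (t * x)) (at t within {0..1})"
      using x by (auto intro!: derivative_eq_intros simp: field_simps power2_eq_square)
    then show "(?F has_vector_derivative 2 * (1 - t) * cos (t * x)) (at t within {0..1})"
      by (simp add: has_real_derivative_iff_has_vector_derivative)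
  qed simp
  then have "fejer x = ?F 1 - ?F 0" unfolding fejer_def by (rule integral_unique)
  then show ?thesis using x by (simp add: field_simps)
qed

lemma fejer_0: "fejer 0 = 1"
proof -
  have "((\<lambda>t. 2 * (1 - t)) has_integral ((2 * 1 - 1\<^sup>2) - (2 * 0 - 0\<^sup>2))) {0..1::real}"
    by (rule fundamental_theorem_of_calculus)
       (auto intro!: derivative_eq_intros simp: has_real_derivative_iff_has_vector_derivative[symmetric])
  then show ?thesis unfolding fejer_def by (simp add: integral_unique)
qed

lemma fejer_nonneg: "fejer x \<ge> 0"
  by (cases "x = 0") (auto simp: fejer_eq fejer_0)

lemma isCont_fejer: "isCont fejer x"
proof -
  have "continuous_on UNIV (\<lambda>x. integral (cbox 0 1) (\<lambda>t. 2 * (1 - t) * cos (t * x :: real)))"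
    by (rule integral_continuous_on_param) (auto simp: case_prod_beta intro!: continuous_intros)
  then show ?thesis
    unfolding fejer_def[abs_def] by (simp add: continuous_on_eq_continuous_at)
qed

lemma borel_measurable_fejer [measurable]: "fejer \<in> borel_measurable borel"
  by (intro borel_measurable_continuous_onI continuous_at_imp_continuous_on ballI isCont_fejer)

lemma fejer_le: "fejer x \<le> 6 / (1 + x\<^sup>2)"
proof (cases "x = 0")
  case False
  have c: "1 - cos x \<le> 2" using cos_ge_minus_one[of x] by linarith
  have "1 - cos x = 2 * (sin (x / 2))\<^sup>2" using cos_double_sin[of "x / 2"] by simp
  moreover have "(sin (x / 2))\<^sup>2 \<le> (x / 2)\<^sup>2"
    using abs_sin_x_le_abs_x[of "x / 2"] by (simp only: abs_le_square_iff)
  ultimately have c2: "1 - cos x \<le> x\<^sup>2 / 2" by (simp add: power_divide)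
  have "2 * (1 - cos x) * (1 + x\<^sup>2) \<le> 6 * x\<^sup>2"
  proof -
    have "2 * (1 - cos x) * (1 + x\<^sup>2) = 2 * (1 - cos x) + 2 * ((1 - cos x) * x\<^sup>2)"
      by (simp add: algebra_simps)
    also have "\<dots> \<le> 2 * (x\<^sup>2 / 2) + 2 * (2 * x\<^sup>2)"
      using mult_right_mono[OF c zero_le_power2[of x]] c2 by (intro add_mono mult_left_mono) auto
    also have "\<dots> \<le> 6 * x\<^sup>2" by simp
    finally show ?thesis .
  qed
  then show ?thesis unfolding fejer_eq[OF False] using False
    by (simp add: divide_simps add_pos_nonneg)
qed (simp add: fejer_0)

lemma integrable_fejer: "integrable lborel fejer"
proof (rule Bochner_Integration.integrable_bound)
  show "integrable lborel (\<lambda>x::real. 6 * inverse (1 + x\<^sup>2))"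
    using integrable_inverse_1_plus_square by (simp add: set_integrable_def)
  show "AE x in lborel. norm (fejer x) \<le> norm (6 * inverse (1 + x\<^sup>2))"
    using fejer_le fejer_nonneg by (auto simp: field_simps)
qed simp

text \<open>Left unnormalized: the total mass of the kernel stays in the constants below as an
  integral.\<close>

definition fejer_cdf :: "real \<Rightarrow> real" where
  "fejer_cdf x = (\<integral>z. fejer z * indicator {..<x} z \<partial>lborel)"

lemma integrable_fejer_indicator:
  "A \<in> sets borel \<Longrightarrow> integrable lborel (\<lambda>z. fejer z * indicator A z)"
  by (rule Bochner_Integration.integrable_bound[OF integrable_fejer]) (auto simp: indicator_def)

lemma fejer_cdf_diff:
  assumes "a \<le> b"
  shows "fejer_cdf b - fejer_cdf a = fejer_prim b - fejer_prim a"
proof -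
  have "fejer_cdf b - fejer_cdf a = (\<integral>z. fejer z * indicator {..<b} z - fejer z * indicator {..<a} z \<partial>lborel)"
    unfolding fejer_cdf_def by (intro Bochner_Integration.integral_diff[symmetric] integrable_fejer_indicator) auto
  also have "\<dots> = (\<integral>z. fejer z * indicator {a..b} z \<partial>lborel)"
    using AE_lborel_singleton[of b] assms
    by (intro integral_cong_AE) (auto simp: indicator_def)
  also have "\<dots> = fejer_prim b - fejer_prim a"
    using assms by (intro integral_FTC_Icc_real fejer_prim_deriv isCont_fejer)
  finally show ?thesis .
qed

lemma fejer_prim_0: "fejer_prim 0 = 0"
  by (simp add: fejer_prim_def)

text \<open>The constant \<open>fejer_cdf 0\<close> cancels when two laws are compared, leaving
  \<open>fejer_prim\<close> with its explicit Fourier representation.\<close>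

lemma fejer_cdf_eq: "fejer_cdf x = fejer_cdf 0 + fejer_prim x"
  using fejer_cdf_diff[of 0 x] fejer_cdf_diff[of x 0] by (cases "0 \<le> x") (auto simp: fejer_prim_0)

lemma fejer_prim_lborel:
  "fejer_prim x = (\<integral>t. indicator {0..1} t * (2 * (1 - t) * (x * Sinc (t * x))) \<partial>lborel)"
proof -
  have "set_integrable lborel {0..1} (\<lambda>t. 2 * (1 - t) * (x * Sinc (t * x)))"
    by (intro borel_integrable_atLeastAtMost' continuous_intros)
  from set_borel_integral_eq_integral(2)[OF this] show ?thesis
    by (simp add: fejer_prim_def set_lebesgue_integral_def)
qed

lemma abs_Sinc_le: "\<bar>Sinc x\<bar> \<le> 1"
  using abs_sin_x_le_abs_x[of x] by (auto simp: Sinc_def abs_divide divide_simps)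

section \<open>Fourier representation of smoothed distribution functions\<close>

context real_distribution
begin

text \<open>Fubini applies because the integrand is at most 2 |x - y| on [0, 1]; this is where a
  finite first moment enters.\<close>

lemma expectation_fejer_prim:
  assumes "integrable M (\<lambda>x. x)"
  shows "(\<integral>x. fejer_prim (x - y) \<partial>M) =
    (\<integral>t. indicator {0..1} t * (2 * (1 - t) * (\<integral>x. (x - y) * Sinc (t * (x - y)) \<partial>M)) \<partial>lborel)"
    and "integrable M (\<lambda>x. fejer_prim (x - y))"
    and "integrable lborel (\<lambda>t. indicator {0..1} t * (2 * (1 - t) * (\<integral>x. (x - y) * Sinc (t * (x - y)) \<partial>M)))"
proof -
  interpret P: pair_sigma_finite M lborel ..
  let ?f = "\<lambda>x t. indicator {0..1} t * (2 * (1 - t) * ((x - y) * Sinc (t * (x - y))))"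
  have meas: "case_prod ?f \<in> borel_measurable (M \<Otimes>\<^sub>M lborel)"
    by (simp add: case_prod_beta)
  have "integrable (M \<Otimes>\<^sub>M lborel) (\<lambda>(x, t). (2 * \<bar>x - y\<bar>) * indicator {0..1::real} t)"
  proof (rule P.Fubini_integrable)
    have "integrable M (\<lambda>x. \<bar>x - y\<bar>)" using assms by (intro integrable_abs Bochner_Integration.integrable_diff) auto
    then show "integrable M (\<lambda>x. LINT t|lborel. norm ((\<lambda>(x, t). (2 * \<bar>x - y\<bar>) * indicator {0..1::real} t) (x, t)))"
      by (simp add: abs_mult)
  qed (auto simp: case_prod_beta)
  then have int: "integrable (M \<Otimes>\<^sub>M lborel) (case_prod ?f)"
  proof (rule Bochner_Integration.integrable_bound[OF _ meas])
    have "\<bar>?f x t\<bar> \<le> 2 * \<bar>x - y\<bar> * indicator {0..1} t" for x t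
    proof (cases "t \<in> {0..1}")
      case True
      then have "\<bar>?f x t\<bar> = (2 * (1 - t)) * (\<bar>x - y\<bar> * \<bar>Sinc (t * (x - y))\<bar>)" by (simp add: abs_mult)
      also have "\<dots> \<le> 2 * (\<bar>x - y\<bar> * 1)"
        using True abs_Sinc_le by (intro mult_mono mult_left_mono) auto
      finally show ?thesis using True by simp
    qed simp
    then show "AE p in M \<Otimes>\<^sub>M lborel. norm (case_prod ?f p) \<le> norm ((\<lambda>(x, t). 2 * \<bar>x - y\<bar> * indicator {0..1} t) p)"
      by (auto simp: abs_mult)
  qed
  show "(\<integral>x. fejer_prim (x - y) \<partial>M) =
    (\<integral>t. indicator {0..1} t * (2 * (1 - t) * (\<integral>x. (x - y) * Sinc (t * (x - y)) \<partial>M)) \<partial>lborel)"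
    using P.Fubini_integral[OF int] by (simp add: fejer_prim_lborel)
  show "integrable M (\<lambda>x. fejer_prim (x - y))"
    using P.integrable_fst[OF int] by (simp add: fejer_prim_lborel)
  show "integrable lborel (\<lambda>t. indicator {0..1} t * (2 * (1 - t) * (\<integral>x. (x - y) * Sinc (t * (x - y)) \<partial>M)))"
    using P.integrable_snd[OF int] by simp
qed

lemma expectation_sinc_char:
  assumes "t \<noteq> 0"
  shows "(\<integral>x. (x - y) * Sinc (t * (x - y)) \<partial>M) = Im (iexp (- (t * y)) * char M t) / t"
proof -
  have "integrable M (\<lambda>x. iexp (t * x))"
    by (rule integrable_const_bound[of _ 1]) auto
  then have "Im (iexp (- (t * y)) * char M t) = (\<integral>x. Im (iexp (- (t * y)) * iexp (t * x)) \<partial>M)"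
    unfolding char_def by (subst integral_mult_right_zero[symmetric], subst integral_Im[symmetric]) auto
  also have "(\<lambda>x. Im (iexp (- (t * y)) * iexp (t * x))) = (\<lambda>x. sin (t * (x - y)))"
    by (auto simp: exp_add[symmetric] Im_exp algebra_simps)
  also have "(\<integral>x. sin (t * (x - y)) \<partial>M) / t = (\<integral>x. sin (t * (x - y)) / t \<partial>M)"
    by simp
  also have "(\<lambda>x. sin (t * (x - y)) / t) = (\<lambda>x. (x - y) * Sinc (t * (x - y)))"
    using assms by (auto simp: Sinc_def)
  finally show ?thesis by (rule sym)
qed

text \<open>Fubini again: the same expectation is the tail of \<open>M\<close> smoothed by the
  kernel, which links distribution functions to the Fourier side.\<close>

lemma expectation_fejer_cdf:
  shows "(\<integral>x. fejer_cdf (x - y) \<partial>M) = (\<integral>z. fejer z * (1 - cdf M (y + z)) \<partial>lborel)"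
proof -
  interpret P: pair_sigma_finite M lborel ..
  let ?f = "\<lambda>x z. fejer z * indicator {y + z<..} x"
  have eq: "fejer z * indicator {..<x - y} z = ?f x z" for x z
    by (auto simp: indicator_def)
  have [measurable]: "(\<lambda>p. indicator {y + snd p<..} (fst p) :: real) \<in> borel_measurable (M \<Otimes>\<^sub>M lborel)"
  proof -
    have "(\<lambda>p. indicator {y + snd p<..} (fst p) :: real) = indicator {p \<in> space (M \<Otimes>\<^sub>M lborel). y + snd p < fst p}"
      by (auto simp: indicator_def space_pair_measure fun_eq_iff)
    then show ?thesis by simp
  qed
  have meas: "case_prod ?f \<in> borel_measurable (M \<Otimes>\<^sub>M lborel)"
    by (simp add: case_prod_beta)
  have "integrable (M \<Otimes>\<^sub>M lborel) (\<lambda>(x, z). fejer z)"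
    by (rule P.Fubini_integrable) (auto simp: case_prod_beta integrable_fejer)
  then have int: "integrable (M \<Otimes>\<^sub>M lborel) (case_prod ?f)"
    by (rule Bochner_Integration.integrable_bound[OF _ meas]) (auto simp: indicator_def)
  have "(\<integral>x. fejer_cdf (x - y) \<partial>M) = (\<integral>z. (\<integral>x. ?f x z \<partial>M) \<partial>lborel)"
    using P.Fubini_integral[OF int] by (simp add: fejer_cdf_def eq)
  also have "(\<lambda>z. \<integral>x. ?f x z \<partial>M) = (\<lambda>z. fejer z * (1 - cdf M (y + z)))"
  proof
    fix z
    have "prob {y + z<..} = 1 - cdf M (y + z)"
      using prob_compl[of "{..y + z}"] by (simp add: cdf_def Compl_eq_Diff_UNIV[symmetric])
    then show "(\<integral>x. ?f x z \<partial>M) = fejer z * (1 - cdf M (y + z))" by simp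
  qed
  finally show ?thesis .
qed

end

section \<open>Concentration of the kernel and the smoothing inequality\<close>

lemma fejer_integral_pos: "(\<integral>z. fejer z \<partial>lborel) > 0"
proof -
  obtain d where d: "d > 0" "\<And>h. 0 < h \<Longrightarrow> h < d \<Longrightarrow> fejer_prim 0 < fejer_prim (0 + h)"
    using DERIV_pos_inc_right[OF fejer_prim_deriv[of 0]] fejer_0 by auto
  then have "0 < fejer_prim (d / 2)" using d(2)[of "d / 2"] by (simp add: fejer_prim_0)
  also have "\<dots> \<le> fejer_cdf (d / 2)"
    using fejer_cdf_eq[of "d / 2"] fejer_nonneg
    by (simp add: fejer_cdf_def[of 0] Bochner_Integration.integral_nonneg)
  also have "\<dots> \<le> (\<integral>z. fejer z \<partial>lborel)"
    unfolding fejer_cdf_def using fejer_nonneg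
    by (intro integral_mono integrable_fejer integrable_fejer_indicator) (auto simp: indicator_def)
  finally show ?thesis .
qed

text \<open>Any fraction p above 1/2 would serve: the supremum returns with the factor (1 - p) / p,
  which is 1/3 for p = 3/4.\<close>

lemma fejer_concentration:
  obtains h where "h > 0"
    "(\<integral>z. fejer z * indicator {-h..h} z \<partial>lborel) \<ge> 3 / 4 * (\<integral>z. fejer z \<partial>lborel)"
proof -
  let ?I = "\<integral>z. fejer z \<partial>lborel"
  have "(\<lambda>n. \<integral>z. fejer z * indicator {- real n..real n} z \<partial>lborel) \<longlonglongrightarrow> ?I"
  proof (rule integral_dominated_convergence[where w = fejer])
    show "AE z in lborel. (\<lambda>n. fejer z * indicator {- real n..real n} z) \<longlonglongrightarrow> fejer z"
    proof (rule AE_I2)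
      fix z :: real
      obtain N :: nat where "\<bar>z\<bar> \<le> real N" using real_arch_simple by blast
      then have "eventually (\<lambda>n. fejer z * indicator {- real n..real n} z = fejer z) sequentially"
        by (intro eventually_sequentiallyI[of N]) (auto simp: indicator_def abs_le_iff)
      then show "(\<lambda>n. fejer z * indicator {- real n..real n} z) \<longlonglongrightarrow> fejer z"
        by (rule tendsto_eventually)
    qed
  qed (auto simp: integrable_fejer fejer_nonneg indicator_def)
  moreover have "3 / 4 * ?I < ?I" using fejer_integral_pos by simp
  ultimately have "eventually (\<lambda>n. 3 / 4 * ?I < (\<integral>z. fejer z * indicator {- real n..real n} z \<partial>lborel)) sequentially"
    by (rule order_tendstoD(1))
  then have "eventually (\<lambda>n. n > 0 \<and> 3 / 4 * ?I < (\<integral>z. fejer z * indicator {- real n..real n} z \<partial>lborel)) sequentially"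
    using eventually_gt_at_top[of "0::nat"] by eventually_elim auto
  then obtain n where "n > 0" "3 / 4 * ?I < (\<integral>z. fejer z * indicator {- real n..real n} z \<partial>lborel)"
    using eventually_happens'[OF sequentially_bot] by blast
  then show ?thesis using that[of "real n"] by auto
qed

text \<open>If D stays above s on the interval carrying three quarters of the kernel, the rest of the kernel can
  compensate this only with a third of the supremum of D.\<close>

lemma fejer_peak_bound:
  fixes D :: "real \<Rightarrow> real"
  assumes h: "(\<integral>z. fejer z * indicator {-h..h} z \<partial>lborel) \<ge> 3 / 4 * (\<integral>z. fejer z \<partial>lborel)"
    and D [measurable]: "D \<in> borel_measurable borel"
    and \<eta>: "\<And>z. \<bar>D z\<bar> \<le> \<eta>" and s: "\<And>z. \<bar>z\<bar> \<le> h \<Longrightarrow> D z \<ge> s"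
    and \<epsilon>: "(\<integral>z. fejer z * D z \<partial>lborel) \<le> \<epsilon>"
    and \<epsilon>0: "\<epsilon> \<ge> 0"
  shows "s \<le> \<eta> / 3 + 4 / 3 * \<epsilon> / (\<integral>z. fejer z \<partial>lborel)"
proof -
  let ?I = "\<integral>z. fejer z \<partial>lborel" and ?a = "\<integral>z. fejer z * indicator {-h..h} z \<partial>lborel"
  have I: "?I > 0" by (rule fejer_integral_pos)
  have \<eta>0: "\<eta> \<ge> 0" using \<eta>[of 0] by linarith
  show ?thesis
  proof (cases "s + \<eta> \<ge> 0")
    case True
    have "integrable lborel (\<lambda>z. fejer z * D z)"
    proof (rule Bochner_Integration.integrable_bound)
      show "integrable lborel (\<lambda>z. \<eta> * fejer z)" using integrable_fejer by simp
      show "AE z in lborel. norm (fejer z * D z) \<le> norm (\<eta> * fejer z)"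
        using mult_left_mono[OF \<eta> fejer_nonneg] \<eta>0 by (auto simp: abs_mult mult.commute fejer_nonneg)
    qed measurable
    then have "(\<integral>z. (s + \<eta>) * (fejer z * indicator {-h..h} z) - \<eta> * fejer z \<partial>lborel) \<le> (\<integral>z. fejer z * D z \<partial>lborel)"
    proof (rule integral_mono[rotated])
      show "integrable lborel (\<lambda>z. (s + \<eta>) * (fejer z * indicator {-h..h} z) - \<eta> * fejer z)"
        using integrable_fejer integrable_fejer_indicator[of "{-h..h}"] by simp
      fix z
      have "fejer z * ((s + \<eta>) * indicator {-h..h} z - \<eta>) \<le> fejer z * D z"
        using s[of z] \<eta>[of z] fejer_nonneg[of z] by (intro mult_left_mono) (auto simp: indicator_def abs_le_iff)
      then show "(s + \<eta>) * (fejer z * indicator {-h..h} z) - \<eta> * fejer z \<le> fejer z * D z"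
        by (simp add: algebra_simps)
    qed
    then have "(s + \<eta>) * ?a - \<eta> * ?I \<le> \<epsilon>"
      using \<epsilon> integrable_fejer integrable_fejer_indicator[of "{-h..h}"] by simp
    moreover have "(s + \<eta>) * (3 / 4 * ?I) \<le> (s + \<eta>) * ?a"
      using h True by (rule mult_left_mono)
    ultimately have "3 / 4 * (s + \<eta>) * ?I \<le> \<epsilon> + \<eta> * ?I" by linarith
    define e where "e = \<epsilon> / ?I"
    have "\<epsilon> = e * ?I" using I by (simp add: e_def)
    then have "(3 / 4 * (s + \<eta>)) * ?I \<le> (e + \<eta>) * ?I"
      using \<open>3 / 4 * (s + \<eta>) * ?I \<le> \<epsilon> + \<eta> * ?I\<close> by (simp add: distrib_right)
    then have "3 / 4 * (s + \<eta>) \<le> e + \<eta>" using I by (rule mult_right_le_imp_le)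
    then have "s \<le> \<eta> / 3 + 4 / 3 * e" by (simp add: field_simps)
    then show ?thesis by (simp add: e_def)
  next
    case False
    then have "s < 0" using \<eta>0 by linarith
    moreover have "0 \<le> \<eta> / 3 + 4 / 3 * \<epsilon> / ?I" using \<eta>0 \<epsilon>0 I by (intro add_nonneg_nonneg divide_nonneg_pos) auto
    ultimately show ?thesis by linarith
  qed
qed

text \<open>The difference of the smoothed tails is an integral over [0, 1] of 2 (1 - t) Im (exp (-
  i t y) (char N t - char M t)) / t. The phase has modulus 1, so the bound is uniform in y, and the
  factor t in the hypothesis cancels 1 / t.\<close>

lemma fejer_smoothed_difference:
  assumes M: "real_distribution M" "integrable M (\<lambda>x. x)"
    and N: "real_distribution N" "integrable N (\<lambda>x. x)"
    and b: "integrable lborel (\<lambda>t. indicator {0..1} t * b t)"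
    and char: "\<And>t. 0 < t \<Longrightarrow> t \<le> 1 \<Longrightarrow> cmod (char M t - char N t) \<le> t * b t"
  shows "\<bar>\<integral>z. fejer z * (cdf M (y + z) - cdf N (y + z)) \<partial>lborel\<bar>
    \<le> 2 * (\<integral>t. indicator {0..1} t * b t \<partial>lborel)"
proof -
  interpret M: real_distribution M by fact
  interpret N: real_distribution N by fact
  let ?SM = "\<lambda>t. \<integral>x. (x - y) * Sinc (t * (x - y)) \<partial>M" and ?SN = "\<lambda>t. \<integral>x. (x - y) * Sinc (t * (x - y)) \<partial>N"
  have cM: "(\<integral>x. fejer_cdf (x - y) \<partial>M) = fejer_cdf 0 + (\<integral>x. fejer_prim (x - y) \<partial>M)"
    unfolding fejer_cdf_eq[of "_ - y"] using M.expectation_fejer_prim(2)[OF M(2)] M.prob_space by simp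
  have cN: "(\<integral>x. fejer_cdf (x - y) \<partial>N) = fejer_cdf 0 + (\<integral>x. fejer_prim (x - y) \<partial>N)"
    unfolding fejer_cdf_eq[of "_ - y"] using N.expectation_fejer_prim(2)[OF N(2)] N.prob_space by simp
  have int: "integrable lborel (\<lambda>z. fejer z * (1 - cdf L (y + z)))" if "real_distribution L" for L
  proof -
    interpret L: real_distribution L by fact
    show ?thesis
    proof (rule Bochner_Integration.integrable_bound[OF integrable_fejer])
      have [measurable]: "cdf L \<in> borel_measurable borel"
        using L.cdf_nondecreasing by (intro borel_measurable_mono monoI)
      show "(\<lambda>z. fejer z * (1 - cdf L (y + z))) \<in> borel_measurable lborel" by measurable
      show "AE z in lborel. norm (fejer z * (1 - cdf L (y + z))) \<le> norm (fejer z)"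
        using L.cdf_nonneg L.cdf_bounded_prob fejer_nonneg
        by (auto simp: abs_mult intro!: AE_I2 mult_left_le)
    qed
  qed
  have "(\<integral>z. fejer z * (cdf M (y + z) - cdf N (y + z)) \<partial>lborel)
      = (\<integral>z. fejer z * (1 - cdf N (y + z)) - fejer z * (1 - cdf M (y + z)) \<partial>lborel)"
    by (simp add: algebra_simps)
  also have "\<dots> = (\<integral>x. fejer_prim (x - y) \<partial>N) - (\<integral>x. fejer_prim (x - y) \<partial>M)"
    using int[OF M(1)] int[OF N(1)]
    by (simp add: M.expectation_fejer_cdf[symmetric] N.expectation_fejer_cdf[symmetric] cM cN)
  also have "\<dots> = (\<integral>t. indicator {0..1} t * (2 * (1 - t) * ?SN t) - indicator {0..1} t * (2 * (1 - t) * ?SM t) \<partial>lborel)"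
    unfolding M.expectation_fejer_prim(1)[OF M(2)] N.expectation_fejer_prim(1)[OF N(2)]
    by (intro Bochner_Integration.integral_diff[symmetric] M.expectation_fejer_prim(3) N.expectation_fejer_prim(3) M N)
  finally have eq: "(\<integral>z. fejer z * (cdf M (y + z) - cdf N (y + z)) \<partial>lborel)
    = (\<integral>t. indicator {0..1} t * (2 * (1 - t) * ?SN t) - indicator {0..1} t * (2 * (1 - t) * ?SM t) \<partial>lborel)" .
  have "\<bar>\<integral>z. fejer z * (cdf M (y + z) - cdf N (y + z)) \<partial>lborel\<bar>
      \<le> (\<integral>t. 2 * (indicator {0..1} t * b t) \<partial>lborel)"
    unfolding real_norm_def[symmetric] eq
  proof (rule Bochner_Integration.integral_norm_bound[THEN order_trans], rule integral_mono_AE)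
    show "integrable lborel (\<lambda>t. norm (indicator {0..1} t * (2 * (1 - t) * ?SN t) - indicator {0..1} t * (2 * (1 - t) * ?SM t)))"
      by (intro integrable_norm Bochner_Integration.integrable_diff M.expectation_fejer_prim(3) N.expectation_fejer_prim(3) M N)
    show "integrable lborel (\<lambda>t. 2 * (indicator {0..1} t * b t))" using b by simp
    show "AE t in lborel. norm (indicator {0..1} t * (2 * (1 - t) * ?SN t) - indicator {0..1} t * (2 * (1 - t) * ?SM t))
        \<le> 2 * (indicator {0..1} t * b t)"
      using AE_lborel_singleton[of 0]
    proof eventually_elim
      fix t :: real assume t0: "t \<noteq> 0"
      show "norm (indicator {0..1} t * (2 * (1 - t) * ?SN t) - indicator {0..1} t * (2 * (1 - t) * ?SM t))
        \<le> 2 * (indicator {0..1} t * b t)"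
      proof (cases "t \<in> {0..1}")
        case True
        then have t: "0 < t" "t \<le> 1" using t0 by auto
        have SN_SM: "?SN t - ?SM t = Im (iexp (- (t * y)) * (char N t - char M t)) / t"
          unfolding M.expectation_sinc_char[OF t0] N.expectation_sinc_char[OF t0]
          by (simp only: diff_divide_distrib minus_complex.sel right_diff_distrib)
        have "\<bar>?SN t - ?SM t\<bar> \<le> cmod (iexp (- (t * y)) * (char N t - char M t)) / t"
          unfolding SN_SM abs_divide abs_of_pos[OF t(1)] by (intro divide_right_mono abs_Im_le_cmod less_imp_le t)
        also have "\<dots> = cmod (char M t - char N t) / t"
          by (simp add: norm_mult norm_minus_commute del: of_real_mult of_real_minus)
        also have "\<dots> \<le> b t" using char[OF t] t by (simp add: field_simps)
        finally have *: "\<bar>?SN t - ?SM t\<bar> \<le> b t" .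
        have "norm (indicator {0..1} t * (2 * (1 - t) * ?SN t) - indicator {0..1} t * (2 * (1 - t) * ?SM t))
            = (2 * (1 - t)) * \<bar>?SN t - ?SM t\<bar>"
          using True by (simp add: right_diff_distrib[symmetric] abs_mult del: right_diff_distrib_numeral)
        also have "\<dots> \<le> 2 * b t"
          using * t by (intro mult_mono) auto
        finally show ?thesis using True by simp
      qed simp
    qed
  qed
  then show ?thesis by simp
qed

text \<open>Esseen's inequality at cutoff 1. A large deviation of the distribution functions at x
  persists on an interval next to x, because one of them is monotone and the other Lipschitz;
  smoothing cannot hide it there.\<close>

theorem smoothing_inequality:
  obtains K where "K > 0"
    "\<And>M N b m x. real_distribution M \<Longrightarrow> integrable M (\<lambda>x. x) \<Longrightarrow>
      real_distribution N \<Longrightarrow> integrable N (\<lambda>x. x) \<Longrightarrow>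
      integrable lborel (\<lambda>t. indicator {0..1} t * b t) \<Longrightarrow>
      (\<And>t. 0 < t \<Longrightarrow> t \<le> 1 \<Longrightarrow> cmod (char M t - char N t) \<le> t * b t) \<Longrightarrow>
      0 \<le> m \<Longrightarrow> (\<And>x y. x \<le> y \<Longrightarrow> cdf N y - cdf N x \<le> m * (y - x)) \<Longrightarrow>
      \<bar>cdf M x - cdf N x\<bar> \<le> K * ((\<integral>t. indicator {0..1} t * b t \<partial>lborel) + m)"
proof -
  let ?I = "\<integral>z. fejer z \<partial>lborel"
  have I: "?I > 0" by (rule fejer_integral_pos)
  obtain h where h: "h > 0" "(\<integral>z. fejer z * indicator {-h..h} z \<partial>lborel) \<ge> 3 / 4 * ?I"
    by (rule fejer_concentration)
  \<comment> \<open>3/2 times the constant \<open>C\<close> below, regrouped by m and the integral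
    of b.\<close>
  define K where "K = 3 * h + 4 / ?I"
  have "K > 0" unfolding K_def using h(1) I by (intro add_pos_pos mult_pos_pos divide_pos_pos) auto
  moreover have "\<bar>cdf M x - cdf N x\<bar> \<le> K * ((\<integral>t. indicator {0..1} t * b t \<partial>lborel) + m)"
    if M: "real_distribution M" "integrable M (\<lambda>x. x)"
    and N: "real_distribution N" "integrable N (\<lambda>x. x)"
    and b: "integrable lborel (\<lambda>t. indicator {0..1} t * b t)"
    and char: "\<And>t. 0 < t \<Longrightarrow> t \<le> 1 \<Longrightarrow> cmod (char M t - char N t) \<le> t * b t"
    and m: "0 \<le> m" and lip: "\<And>x y. x \<le> y \<Longrightarrow> cdf N y - cdf N x \<le> m * (y - x)" for M N b m x
  proof -
    interpret M: real_distribution M by fact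
    interpret N: real_distribution N by fact
    let ?\<delta> = "\<integral>t. indicator {0..1} t * b t \<partial>lborel"
    define \<Delta> where "\<Delta> x = cdf M x - cdf N x" for x
    have [measurable]: "cdf M \<in> borel_measurable borel" "cdf N \<in> borel_measurable borel"
      using M.cdf_nondecreasing N.cdf_nondecreasing by (auto intro!: borel_measurable_mono monoI)
    have [measurable]: "\<Delta> \<in> borel_measurable borel" unfolding \<Delta>_def[abs_def] by measurable
    have sm: "\<bar>\<integral>z. fejer z * \<Delta> (y + z) \<partial>lborel\<bar> \<le> 2 * ?\<delta>" for y
      unfolding \<Delta>_def using fejer_smoothed_difference[OF M N b char] .
    have \<delta>0: "?\<delta> \<ge> 0" using order_trans[OF abs_ge_zero sm[of 0]] by simp
    define \<eta> where "\<eta> = (SUP x. \<bar>\<Delta> x\<bar>)"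
    have bdd: "bdd_above (range (\<lambda>x. \<bar>\<Delta> x\<bar>))"
    proof (rule bdd_aboveI2)
      show "\<bar>\<Delta> x\<bar> \<le> 1" for x
        using M.cdf_nonneg[of x] M.cdf_bounded_prob[of x] N.cdf_nonneg[of x] N.cdf_bounded_prob[of x]
        by (simp add: \<Delta>_def abs_le_iff)
    qed
    have \<eta>: "\<bar>\<Delta> x\<bar> \<le> \<eta>" for x unfolding \<eta>_def by (rule cSUP_upper[OF _ bdd]) simp
    define C where "C = 2 * m * h + 4 / 3 * (2 * ?\<delta>) / ?I"
    have le: "\<bar>\<Delta> x\<bar> \<le> \<eta> / 3 + C" for x
    proof -
      \<comment> \<open>A positive deviation persists to the right of x, so the kernel is centred at
        x + h; a negative one persists to the left and uses x - h. Over the length 2 h the Lipschitz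
        bound loses at most 2 m h.\<close>
      have "\<Delta> x - 2 * m * h \<le> \<eta> / 3 + 4 / 3 * (2 * ?\<delta>) / ?I"
      proof (rule fejer_peak_bound[where D = "\<lambda>z. \<Delta> ((x + h) + z)" and h = h])
        fix z assume z: "\<bar>z\<bar> \<le> h"
        have "cdf M x \<le> cdf M (x + h + z)" using z by (intro M.cdf_nondecreasing) auto
        moreover have "cdf N (x + h + z) - cdf N x \<le> m * (x + h + z - x)" using z by (intro lip) auto
        moreover have "m * (x + h + z - x) \<le> m * (2 * h)" using z m by (intro mult_left_mono) auto
        ultimately show "\<Delta> x - 2 * m * h \<le> \<Delta> ((x + h) + z)" by (simp add: \<Delta>_def)
      next
        show "(\<integral>z. fejer z * \<Delta> ((x + h) + z) \<partial>lborel) \<le> 2 * ?\<delta>"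
          using sm[of "x + h"] by (simp only: abs_le_iff)
      qed (use h(2) \<delta>0 in \<open>simp_all add: \<eta>\<close>)
      moreover have "- \<Delta> x - 2 * m * h \<le> \<eta> / 3 + 4 / 3 * (2 * ?\<delta>) / ?I"
      proof (rule fejer_peak_bound[where D = "\<lambda>z. - \<Delta> ((x - h) + z)" and h = h])
        fix z assume z: "\<bar>z\<bar> \<le> h"
        have "cdf M (x - h + z) \<le> cdf M x" using z by (intro M.cdf_nondecreasing) auto
        moreover have "cdf N x - cdf N (x - h + z) \<le> m * (x - (x - h + z))" using z by (intro lip) auto
        moreover have "m * (x - (x - h + z)) \<le> m * (2 * h)" using z m by (intro mult_left_mono) auto
        ultimately show "- \<Delta> x - 2 * m * h \<le> - \<Delta> ((x - h) + z)" by (simp add: \<Delta>_def)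
      next
        show "(\<integral>z. fejer z * - \<Delta> ((x - h) + z) \<partial>lborel) \<le> 2 * ?\<delta>"
          using sm[of "x - h"] by (simp only: abs_le_iff mult_minus_right Bochner_Integration.integral_minus)
      qed (use h(2) \<delta>0 in \<open>simp_all add: \<eta>\<close>)
      ultimately show ?thesis unfolding C_def by linarith
    qed
    \<comment> \<open>The supremum is finite, so its third can be absorbed on the left.\<close>
    have "(SUP x. \<bar>\<Delta> x\<bar>) \<le> \<eta> / 3 + C" by (rule cSUP_least) (auto intro: le)
    then have "\<eta> \<le> \<eta> / 3 + C" by (simp only: \<eta>_def)
    then have "\<eta> \<le> 3 / 2 * C" by linarith
    also have "\<dots> = 3 * h * m + 4 / ?I * ?\<delta>" unfolding C_def by (simp add: distrib_left)
    also have "\<dots> \<le> K * m + K * ?\<delta>"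
      unfolding K_def using h(1) I m \<delta>0 by (intro add_mono mult_right_mono) auto
    also have "\<dots> = K * (?\<delta> + m)" by (simp only: distrib_left add.commute)
    finally show ?thesis using \<eta>[of x] by (simp add: \<Delta>_def)
  qed
  ultimately show ?thesis by (rule that)
qed

section \<open>The characteristic function\<close>

lemma harm_ge_1: "k \<ge> 1 \<Longrightarrow> harm k \<ge> (1::real)"
  using member_le_sum[of 1 "{1..k}" "\<lambda>l. inverse (real l)"] by (simp add: harm_def)

lemma harm_le: "harm k \<le> real k"
proof -
  have "harm k \<le> (\<Sum>i=1..k. 1::real)"
    unfolding harm_def by (intro sum_mono) (auto simp: divide_simps)
  then show ?thesis by simp
qed

lemma harm2_ge_1: "k \<ge> 1 \<Longrightarrow> harm2 k \<ge> 1"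
  using member_le_sum[of 1 "{1..k}" "\<lambda>l. 1 / (real l)\<^sup>2"] by (simp add: harm2_def)

lemma divide_le_self: "0 \<le> x \<Longrightarrow> 1 \<le> (y::real) \<Longrightarrow> x / y \<le> x"
  using frac_le[of x x 1 y] by simp

lemma harm2_le_harm: "harm2 k \<le> harm k"
  unfolding harm2_def harm_def
  by (intro sum_mono) (auto simp: divide_simps power2_eq_square)

lemma hsum_Suc: "hsum k (Suc n) = hsum k n + 1 / tok k (Suc n)"
  by (simp add: hsum_def)

lemma hsum_nonneg: "hsum k n \<ge> 0"
  unfolding hsum_def by (intro sum_nonneg) (simp add: tok_pos less_imp_le)

text \<open>Taking logarithms in prod (1 + lam / i) = exp (i theta) gives H lam - harm2 lam^2 / 2 =
  i theta up to third order, hence lam = i theta / H - harm2 theta^2 / (2 H^3). Twice this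
  coefficient is the variance per unit of \<open>hsum\<close>.\<close>

definition half_var :: "nat \<Rightarrow> real" where
  "half_var k = harm2 k / (2 * harm k ^ 3)"

text \<open>The first two Taylor coefficients of the solution lam of prod (1 + lam / i) = exp (i theta).\<close>

definition lam :: "nat \<Rightarrow> real \<Rightarrow> complex" where
  "lam k \<theta> = Complex (- half_var k * \<theta>\<^sup>2) (\<theta> / harm k)"

text \<open>The lower bound lets the Gaussian factor decay at least as fast as the energy estimate,
  so both share the rate \<open>decay k\<close>.\<close>

lemma half_var_bounds:
  assumes "k \<ge> 1"
  shows "half_var k \<ge> decay k" "half_var k \<le> 1 / 2"
proof -
  have H: "harm k \<ge> (1::real)" "harm k \<le> real k" "harm k ^ 3 > (0::real)"
    using harm_ge_1[OF assms] harm_le assms by auto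
  have "decay k \<le> 1 / (2 * real k ^ 3)"
    unfolding decay_def using assms by (intro divide_left_mono mult_right_mono) auto
  also have "\<dots> \<le> 1 / (2 * harm k ^ 3)"
    using H assms power_mono[of "harm k :: real" "real k" 3] by (intro divide_left_mono) auto
  also have "\<dots> \<le> half_var k"
    unfolding half_var_def using harm2_ge_1[OF assms] H by (intro divide_right_mono) auto
  finally show "half_var k \<ge> decay k" .
  have "harm2 k \<le> harm k ^ 3"
    using harm2_le_harm[of k] self_le_power[OF H(1), of 3] by linarith
  then show "half_var k \<le> 1 / 2" unfolding half_var_def using H by (simp add: divide_simps)
qed

lemma decay_bounds: "k \<ge> 1 \<Longrightarrow> 0 < decay k" "k \<ge> 1 \<Longrightarrow> decay k \<le> 1"
  using decay_pos[of k] half_var_bounds[of k] by auto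

lemma norm_lam_le:
  assumes "k \<ge> 1" "\<bar>\<theta>\<bar> \<le> 1"
  shows "cmod (lam k \<theta>) \<le> 2 * \<bar>\<theta>\<bar>"
proof -
  have "\<bar>half_var k * \<theta>\<^sup>2\<bar> \<le> 1 * \<bar>\<theta>\<bar>"
    using half_var_bounds[OF assms(1)] decay_pos[OF assms(1)] assms(2) mult_left_mono[OF assms(2), of "\<bar>\<theta>\<bar>"]
    unfolding abs_mult by (intro mult_mono) (auto simp: power2_eq_square)
  moreover have "\<bar>\<theta> / harm k\<bar> \<le> \<bar>\<theta>\<bar>"
    using harm_ge_1[OF assms(1)] divide_le_self[of "\<bar>\<theta>\<bar>" "harm k"] by (simp add: abs_divide)
  ultimately show ?thesis
    using cmod_le[of "lam k \<theta>"] by (simp add: lam_def)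
qed

text \<open>\<open>e2\<close> is the second elementary symmetric polynomial of 1, 1/2, ..., 1/k, by
  Newton's identity. The radius 2 covers \<open>lam\<close>, and inside it each factor is at most
  3.\<close>

lemma prod_expansion:
  fixes k :: nat
  defines "e2 \<equiv> ((harm k)\<^sup>2 - harm2 k) / 2"
  shows "\<exists>C\<ge>0. \<forall>z::complex. cmod z \<le> 2 \<longrightarrow>
    cmod ((\<Prod>i=1..k. 1 + z / of_nat i) - (1 + harm k * z + of_real e2 * z\<^sup>2)) \<le> C * cmod z ^ 3"
  unfolding e2_def
proof (induction k)
  case 0
  show ?case by (auto simp: harm_def harm2_def)
next
  case (Suc k)
  define e where "e = ((harm k)\<^sup>2 - harm2 k) / 2"
  define a where "a = 1 / real (Suc k)"
  have a: "0 \<le> a" "a \<le> 1" by (auto simp: a_def)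
  obtain C where C: "C \<ge> 0" "\<And>z. cmod z \<le> 2 \<Longrightarrow>
      cmod ((\<Prod>i=1..k. 1 + z / of_nat i) - (1 + harm k * z + of_real e * z\<^sup>2)) \<le> C * cmod z ^ 3"
    using Suc unfolding e_def by blast
  have h: "harm (Suc k) = (harm k + a :: real)" "harm (Suc k) = harm k + complex_of_real a" "harm2 (Suc k) = harm2 k + a\<^sup>2"
    by (auto simp: harm_Suc harm2_def a_def power_divide inverse_eq_divide)
  have e': "((harm (Suc k))\<^sup>2 - harm2 (Suc k)) / 2 = e + a * harm k"
    unfolding h e_def by (simp add: power2_eq_square field_simps)
  show ?case unfolding e'
  proof (intro exI[of _ "3 * C + \<bar>e\<bar>"] conjI allI impI)
    show "0 \<le> 3 * C + \<bar>e\<bar>" using C by simp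
    fix z :: complex assume z: "cmod z \<le> 2"
    let ?P = "\<Prod>i=1..k. 1 + z / of_nat i" and ?Q = "1 + harm k * z + of_real e * z\<^sup>2"
    have "(\<Prod>i=1..Suc k. 1 + z / of_nat i) = ?P * (1 + of_real a * z)"
      by (simp add: a_def mult.commute)
    then have "(\<Prod>i=1..Suc k. 1 + z / of_nat i) - (1 + harm (Suc k) * z + of_real (e + a * harm k) * z\<^sup>2)
       = (?P - ?Q) * (1 + of_real a * z) + of_real (a * e) * z ^ 3"
      unfolding h by (simp add: algebra_simps power2_eq_square power3_eq_cube of_real_harm)
    also have "cmod \<dots> \<le> C * cmod z ^ 3 * 3 + \<bar>e\<bar> * cmod z ^ 3"
    proof (rule norm_triangle_mono)
      have "cmod (1 + of_real a * z) \<le> 1 + a * cmod z"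
        using norm_triangle_ineq[of 1 "of_real a * z"] a by (simp add: norm_mult)
      also have "\<dots> \<le> 3" using mult_mono[of a 1 "cmod z" 2] a z by simp
      finally show "cmod ((?P - ?Q) * (1 + of_real a * z)) \<le> C * cmod z ^ 3 * 3"
        unfolding norm_mult using C z by (intro mult_mono) auto
      have "a * \<bar>e\<bar> \<le> 1 * \<bar>e\<bar>" using a by (intro mult_right_mono) auto
      then show "cmod (of_real (a * e) * z ^ 3) \<le> \<bar>e\<bar> * cmod z ^ 3"
        using a by (simp add: norm_mult norm_power abs_mult mult_right_mono)
    qed
    finally show "cmod ((\<Prod>i=1..Suc k. 1 + z / of_nat i) - (1 + harm (Suc k) * z + of_real (e + a * harm k) * z\<^sup>2))
        \<le> (3 * C + \<bar>e\<bar>) * cmod z ^ 3"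
      by (simp add: algebra_simps)
  qed
qed

lemma norm_diff_triple:
  fixes x y a b :: "'a::real_normed_vector"
  shows "norm (x - y) \<le> norm (x - a) + norm (b - a) + norm (y - b)"
proof -
  have "norm ((x - a) - (b - a) - (y - b)) \<le> norm (x - a) + norm (b - a) + norm (y - b)"
    by (intro order_trans[OF norm_triangle_ineq4] add_right_mono norm_triangle_ineq4)
  then show ?thesis by simp
qed

lemma lam_approx_root:
  assumes k: "k \<ge> 1"
  shows "\<exists>C\<ge>0. \<forall>\<theta>. \<bar>\<theta>\<bar> \<le> 1 \<longrightarrow>
    cmod (cis \<theta> - (\<Prod>i=1..k. 1 + lam k \<theta> / of_nat i)) \<le> C * \<bar>\<theta>\<bar> ^ 3"
proof -
  define e where "e = ((harm k)\<^sup>2 - harm2 k) / 2"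
  define s where "s = half_var k"
  define H :: real where "H = harm k"
  have H: "H \<ge> 1" using harm_ge_1[OF k] by (simp add: H_def)
  obtain C where C: "C \<ge> 0" "\<And>z. cmod z \<le> 2 \<Longrightarrow>
      cmod ((\<Prod>i=1..k. 1 + z / of_nat i) - (1 + harm k * z + of_real e * z\<^sup>2)) \<le> C * cmod z ^ 3"
    using prod_expansion[of k] unfolding e_def by blast
  \<comment> \<open>The choice of \<open>half_var\<close>: the coefficients of theta^2 in the
    product and in cis theta agree.\<close>
  have key: "H * s + e / H\<^sup>2 = 1 / 2"
    using H unfolding s_def e_def half_var_def H_def[symmetric]
    by (simp add: field_simps power2_eq_square power3_eq_cube)
  show ?thesis
  \<comment> \<open>1/6 is the Taylor remainder of cis, 8 C comes from |lam| at most 2 |theta|, and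
    the last summand from the terms of e lam^2 beyond second order.\<close>
  proof (intro exI[of _ "1 / 6 + 8 * C + \<bar>e\<bar> * (2 * s + s\<^sup>2)"] conjI allI impI)
    have s0: "s \<ge> 0" using half_var_bounds[OF k] decay_pos[OF k] by (simp add: s_def)
    then show "0 \<le> 1 / 6 + 8 * C + \<bar>e\<bar> * (2 * s + s\<^sup>2)" using C by simp
    fix \<theta> :: real assume \<theta>: "\<bar>\<theta>\<bar> \<le> 1"
    let ?z = "lam k \<theta>" and ?P = "\<Prod>i=1..k. 1 + lam k \<theta> / of_nat i"
    have z: "?z = \<i> * of_real (\<theta> / H) - of_real (s * \<theta>\<^sup>2)"
      by (simp add: lam_def complex_eq_iff s_def H_def)
    have zle: "cmod ?z \<le> 2 * \<bar>\<theta>\<bar>" by (rule norm_lam_le[OF k \<theta>])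
    have 1: "cmod (cis \<theta> - (1 + \<i> * \<theta> - of_real (\<theta>\<^sup>2 / 2))) \<le> 1 / 6 * \<bar>\<theta>\<bar> ^ 3"
      using iexp_approx1[of \<theta> 2]
      by (simp add: cis_conv_exp fact_numeral eval_nat_numeral algebra_simps)
    have 2: "cmod (?P - (1 + harm k * ?z + of_real e * ?z\<^sup>2)) \<le> 8 * C * \<bar>\<theta>\<bar> ^ 3"
    proof -
      have "cmod (?P - (1 + harm k * ?z + of_real e * ?z\<^sup>2)) \<le> C * cmod ?z ^ 3"
        using C(2) zle \<theta> by force
      also have "\<dots> \<le> C * (2 * \<bar>\<theta>\<bar>) ^ 3"
        using zle C(1) by (intro mult_left_mono power_mono) auto
      finally show ?thesis by (simp add: power_mult_distrib)
    qed
    have hH: "harm k = complex_of_real H" by (simp add: H_def of_real_harm)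
    have "(1 + harm k * ?z + of_real e * ?z\<^sup>2) - (1 + \<i> * \<theta> - of_real (\<theta>\<^sup>2 / 2))
        = of_real ((1 / 2 - (H * s + e / H\<^sup>2)) * \<theta>\<^sup>2) + of_real e * (of_real (s\<^sup>2 * \<theta>\<^sup>2 * \<theta>\<^sup>2) - \<i> * of_real (2 * s / H * \<theta> ^ 3))"
      unfolding z hH using H by (simp add: complex_eq_iff field_simps power2_eq_square power3_eq_cube)
    also have "\<dots> = of_real e * (of_real (s\<^sup>2 * \<theta>\<^sup>2 * \<theta>\<^sup>2) - \<i> * of_real (2 * s / H * \<theta> ^ 3))"
      unfolding key by simp
    also have "cmod \<dots> \<le> \<bar>e\<bar> * (s\<^sup>2 * \<bar>\<theta>\<bar> ^ 3 + 2 * s * \<bar>\<theta>\<bar> ^ 3)"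
    proof -
      have "\<theta>\<^sup>2 * \<theta>\<^sup>2 = \<bar>\<theta>\<bar> ^ 3 * \<bar>\<theta>\<bar>" by (simp add: power2_eq_square power3_eq_cube abs_mult_self_eq flip: mult.assoc)
      also have "\<dots> \<le> \<bar>\<theta>\<bar> ^ 3" using \<theta> by (intro mult_left_le) auto
      finally have "s\<^sup>2 * (\<theta>\<^sup>2 * \<theta>\<^sup>2) \<le> s\<^sup>2 * \<bar>\<theta>\<bar> ^ 3" by (intro mult_left_mono) auto
      then have a: "cmod (of_real (s\<^sup>2 * \<theta>\<^sup>2 * \<theta>\<^sup>2)) \<le> s\<^sup>2 * \<bar>\<theta>\<bar> ^ 3"
        unfolding norm_of_real by (simp add: mult.assoc)
      have "2 * s / H \<le> 2 * s" using H s0 by (intro divide_le_self) auto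
      moreover have "cmod (\<i> * of_real (2 * s / H * \<theta> ^ 3)) = 2 * s / H * \<bar>\<theta>\<bar> ^ 3"
        using H s0 unfolding norm_mult norm_of_real abs_mult[of "2 * s / H"] power_abs by simp
      ultimately have b: "cmod (\<i> * of_real (2 * s / H * \<theta> ^ 3)) \<le> 2 * s * \<bar>\<theta>\<bar> ^ 3"
        by (metis mult_right_mono abs_ge_zero zero_le_power)
      have "cmod (of_real (s\<^sup>2 * \<theta>\<^sup>2 * \<theta>\<^sup>2) - \<i> * of_real (2 * s / H * \<theta> ^ 3)) \<le> s\<^sup>2 * \<bar>\<theta>\<bar> ^ 3 + 2 * s * \<bar>\<theta>\<bar> ^ 3"
        using norm_triangle_ineq4 a b by (meson add_mono order_trans)
      then show ?thesis by (simp add: norm_mult mult_left_mono del: of_real_mult of_real_divide)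
    qed
    finally have 3: "cmod ((1 + harm k * ?z + of_real e * ?z\<^sup>2) - (1 + \<i> * \<theta> - of_real (\<theta>\<^sup>2 / 2)))
        \<le> \<bar>e\<bar> * (s\<^sup>2 * \<bar>\<theta>\<bar> ^ 3 + 2 * s * \<bar>\<theta>\<bar> ^ 3)" .
    let ?a = "1 + \<i> * \<theta> - of_real (\<theta>\<^sup>2 / 2)" and ?b = "1 + harm k * ?z + of_real e * ?z\<^sup>2"
    have "cmod (cis \<theta> - ?P) \<le> cmod (cis \<theta> - ?a) + cmod (?b - ?a) + cmod (?P - ?b)"
      by (rule norm_diff_triple)
    also have "\<dots> \<le> 1 / 6 * \<bar>\<theta>\<bar> ^ 3 + \<bar>e\<bar> * (s\<^sup>2 * \<bar>\<theta>\<bar> ^ 3 + 2 * s * \<bar>\<theta>\<bar> ^ 3) + 8 * C * \<bar>\<theta>\<bar> ^ 3"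
      by (intro add_mono 1 2 3)
    also have "\<dots> = (1 / 6 + 8 * C + \<bar>e\<bar> * (2 * s + s\<^sup>2)) * \<bar>\<theta>\<bar> ^ 3"
      by (simp add: algebra_simps)
    finally show "cmod (cis \<theta> - ?P) \<le> (1 / 6 + 8 * C + \<bar>e\<bar> * (2 * s + s\<^sup>2)) * \<bar>\<theta>\<bar> ^ 3" .
  qed
qed

text \<open>Equating drift and eigenvalue along one period determines the weights; only the closing condition
  eig_weight k theta k = cis theta is violated, by a term of third order.\<close>

definition eig_weight :: "nat \<Rightarrow> real \<Rightarrow> nat \<Rightarrow> complex" where
  "eig_weight k \<theta> j = (\<Prod>i<j. 1 + lam k \<theta> / of_real (rate k i))"

definition eig_fun :: "nat \<Rightarrow> real \<Rightarrow> nat \<Rightarrow> complex" where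
  "eig_fun k \<theta> r = level_char k \<theta> r * eig_weight k \<theta> (r mod k)"

lemma eig_weight_full:
  "eig_weight k \<theta> k = (\<Prod>i=1..k. 1 + lam k \<theta> / of_nat i)"
  unfolding eig_weight_def
  by (rule prod.reindex_bij_witness[where j = "\<lambda>i. k - i" and i = "\<lambda>i. k - i"])
     (auto simp: rate_def)

lemma eig_weight_Suc: "eig_weight k \<theta> (Suc j) = eig_weight k \<theta> j * (1 + lam k \<theta> / of_real (rate k j))"
  by (simp add: eig_weight_def)

text \<open>Inside a period the weight grows by the factor 1 + lam / rate, so the rate cancels and
  lam remains. At the wrap-around the weight returns to 1 and the phase advances; the rate there is
  1, and the defect is the failure of the closing condition.\<close>

lemma eig_fun_drift:
  assumes k: "k \<ge> 1"
  shows "rate k r *\<^sub>R (eig_fun k \<theta> (Suc r) - eig_fun k \<theta> r) = lam k \<theta> * eig_fun k \<theta> r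
    + (if r mod k = k - 1 then (cis \<theta> - eig_weight k \<theta> k) * level_char k \<theta> r else 0)"
proof -
  have r0: "rate k r \<noteq> 0" using rate_ge_1[OF k, of r] by simp
  have rm: "rate k r = rate k (r mod k)" by (simp add: rate_mod)
  show ?thesis
  proof (cases "Suc (r mod k) = k")
    case True
    then have m: "r mod k = k - 1" by simp
    have one: "rate k r = 1" using k by (simp add: rate_def m)
    have "Suc r mod k = 0" using True by (simp add: mod_Suc)
    then have s: "eig_fun k \<theta> (Suc r) = cis \<theta> * level_char k \<theta> r"
      using level_char_Suc[OF k, of \<theta> r] by (simp add: eig_fun_def eig_weight_def)
    have "eig_weight k \<theta> k = eig_weight k \<theta> (k - 1) * (1 + lam k \<theta>)"
      using eig_weight_Suc[of k \<theta> "k - 1"] one k rm unfolding m by simp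
    then show ?thesis unfolding s one using m by (simp add: eig_fun_def algebra_simps)
  next
    case False
    then have sm: "Suc r mod k = Suc (r mod k)" by (simp add: mod_Suc)
    then have "eig_fun k \<theta> (Suc r) = level_char k \<theta> r * (eig_weight k \<theta> (r mod k) * (1 + lam k \<theta> / of_real (rate k r)))"
      using level_char_Suc[OF k, of \<theta> r] by (simp add: eig_fun_def eig_weight_Suc rate_mod)
    then have "eig_fun k \<theta> (Suc r) - eig_fun k \<theta> r = eig_fun k \<theta> r * (lam k \<theta> / of_real (rate k r))"
      by (simp add: eig_fun_def algebra_simps)
    then show ?thesis using False r0 k by (auto simp: scaleR_conv_of_real)
  qed
qed

lemma birth_eig_fun_Suc:
  assumes k: "k \<ge> 1"
  shows "birth k (Suc n) (eig_fun k \<theta>) = (1 + lam k \<theta> / of_real (tok k (Suc n))) * birth k n (eig_fun k \<theta>)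
    + (cis \<theta> - eig_weight k \<theta> k) * occ k n (level_char k \<theta>) (k - 1) / of_real (tok k (Suc n))"
proof -
  let ?T = "tok k (Suc n)"
  have "eig_fun k \<theta> r + (rate k r / ?T) *\<^sub>R (eig_fun k \<theta> (Suc r) - eig_fun k \<theta> r)
     = (1 + lam k \<theta> / of_real ?T) * eig_fun k \<theta> r
      + ((cis \<theta> - eig_weight k \<theta> k) / of_real ?T) * (if r mod k = k - 1 then level_char k \<theta> r else 0)" for r
  proof -
    have "(rate k r / ?T) *\<^sub>R (eig_fun k \<theta> (Suc r) - eig_fun k \<theta> r)
      = (1 / ?T) *\<^sub>R (rate k r *\<^sub>R (eig_fun k \<theta> (Suc r) - eig_fun k \<theta> r))" by simp
    then show ?thesis unfolding eig_fun_drift[OF k]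
      by (simp add: scaleR_conv_of_real algebra_simps)
  qed
  then show ?thesis unfolding birth.simps by (simp only: birth_add birth_mult occ_def) simp
qed

lemma eig_weight_bounds:
  assumes k: "k \<ge> 1" and \<theta>: "\<bar>\<theta>\<bar> \<le> 1"
  shows "cmod (eig_weight k \<theta> j) \<le> 3 ^ j" "cmod (eig_weight k \<theta> j - 1) \<le> 3 ^ j * \<bar>\<theta>\<bar>"
proof -
  have q: "cmod (lam k \<theta> / of_real (rate k i)) \<le> 2 * \<bar>\<theta>\<bar>" for i
  proof -
    have "cmod (lam k \<theta> / of_real (rate k i)) \<le> cmod (lam k \<theta>)"
      using rate_ge_1[OF k, of i] by (simp add: norm_divide divide_le_eq mult_left_le abs_if mult_le_cancel_left1)
    then show ?thesis using norm_lam_le[OF k \<theta>] by linarith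
  qed
  have q3: "cmod (1 + lam k \<theta> / of_real (rate k i)) \<le> 3" for i
    using norm_triangle_ineq[of 1 "lam k \<theta> / of_real (rate k i)"] q[of i] \<theta> by simp
  show 1: "cmod (eig_weight k \<theta> j) \<le> 3 ^ j"
  proof (induction j)
    case (Suc j)
    show ?case unfolding eig_weight_Suc norm_mult power_Suc2
      by (intro mult_mono Suc q3) auto
  qed (simp add: eig_weight_def)
  \<comment> \<open>The sharper 3^j - 1 makes the induction close: it solves x -> 3 x + 2 from
    0.\<close>
  have "cmod (eig_weight k \<theta> j - 1) \<le> (3 ^ j - 1) * \<bar>\<theta>\<bar>"
  proof (induction j)
    case (Suc j)
    let ?q = "lam k \<theta> / of_real (rate k j)"
    have "eig_weight k \<theta> (Suc j) - 1 = (eig_weight k \<theta> j - 1) * (1 + ?q) + ?q"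
      unfolding eig_weight_Suc by (simp only: left_diff_distrib right_diff_distrib distrib_left) simp
    also have "cmod \<dots> \<le> (3 ^ j - 1) * \<bar>\<theta>\<bar> * 3 + 2 * \<bar>\<theta>\<bar>"
      unfolding norm_mult[symmetric]
      by (rule norm_triangle_mono[OF _ q], unfold norm_mult, intro mult_mono Suc q3) auto
    finally show ?case by (simp add: algebra_simps)
  qed (simp add: eig_weight_def)
  then show "cmod (eig_weight k \<theta> j - 1) \<le> 3 ^ j * \<bar>\<theta>\<bar>"
    by (simp add: algebra_simps)
qed

lemma birth_eig_fun:
  assumes "k \<ge> 1"
  shows "birth k n (eig_fun k \<theta>) = (\<Sum>j<k. eig_weight k \<theta> j * occ k n (level_char k \<theta>) j)"
proof -
  have "occ k n (eig_fun k \<theta>) j = eig_weight k \<theta> j * occ k n (level_char k \<theta>) j" for j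
  proof -
    have "(if r mod k = j then eig_fun k \<theta> r else 0) = eig_weight k \<theta> j * (if r mod k = j then level_char k \<theta> r else 0)" for r
      by (simp add: eig_fun_def)
    then show ?thesis unfolding occ_def by (simp only: birth_mult)
  qed
  then have "(\<Sum>j<k. occ k n (eig_fun k \<theta>) j) = (\<Sum>j<k. eig_weight k \<theta> j * occ k n (level_char k \<theta>) j)"
    by (intro sum.cong refl)
  then show ?thesis unfolding sum_occ[OF assms] .
qed

lemma norm_birth_eig_fun_le:
  assumes k: "k \<ge> 1" and \<theta>: "\<bar>\<theta>\<bar> \<le> 1"
  shows "cmod (birth k n (eig_fun k \<theta>)) \<le> real k * 3 ^ k * exp (- (decay k * \<theta>\<^sup>2 * hsum k n))"
    and "cmod (birth k n (level_char k \<theta>) - birth k n (eig_fun k \<theta>))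
      \<le> real k * 3 ^ k * \<bar>\<theta>\<bar> * exp (- (decay k * \<theta>\<^sup>2 * hsum k n))"
proof -
  let ?E = "exp (- (decay k * \<theta>\<^sup>2 * hsum k n))" and ?o = "occ k n (level_char k \<theta>)"
  have pw: "(3::real) ^ j \<le> 3 ^ k" if "j < k" for j using that by (intro power_increasing) auto
  have "cmod (birth k n (eig_fun k \<theta>)) \<le> (\<Sum>j<k. 3 ^ k * ?E)"
    unfolding birth_eig_fun[OF k]
  proof (intro sum_norm_le)
    fix j assume "j \<in> {..<k}"
    then have j: "j < k" by simp
    show "cmod (eig_weight k \<theta> j * ?o j) \<le> 3 ^ k * ?E"
      unfolding norm_mult using order_trans[OF eig_weight_bounds(1)[OF k \<theta>] pw[OF j]]
      by (intro mult_mono occ_level_char_bound j \<theta>) auto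
  qed
  then show "cmod (birth k n (eig_fun k \<theta>)) \<le> real k * 3 ^ k * ?E" by simp
  have "birth k n (level_char k \<theta>) - birth k n (eig_fun k \<theta>) = (\<Sum>j<k. (1 - eig_weight k \<theta> j) * ?o j)"
    unfolding birth_eig_fun[OF k] sum_occ[OF k, of n "level_char k \<theta>", symmetric] by (simp add: sum_subtractf algebra_simps)
  also have "cmod \<dots> \<le> (\<Sum>j<k. 3 ^ k * \<bar>\<theta>\<bar> * ?E)"
  proof (intro sum_norm_le)
    fix j assume "j \<in> {..<k}"
    then have j: "j < k" by simp
    have "cmod (1 - eig_weight k \<theta> j) \<le> 3 ^ k * \<bar>\<theta>\<bar>"
      using order_trans[OF eig_weight_bounds(2)[OF k \<theta>] mult_right_mono[OF pw[OF j]]]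
      by (simp add: norm_minus_commute)
    then show "cmod ((1 - eig_weight k \<theta> j) * ?o j) \<le> 3 ^ k * \<bar>\<theta>\<bar> * ?E"
      unfolding norm_mult by (intro mult_mono occ_level_char_bound j \<theta>) auto
  qed
  finally show "cmod (birth k n (level_char k \<theta>) - birth k n (eig_fun k \<theta>)) \<le> real k * 3 ^ k * \<bar>\<theta>\<bar> * ?E"
    by (simp add: mult.assoc)
qed

lemma norm_exp_lam: "cmod (exp (lam k \<theta> * of_real x)) = exp (- (half_var k * \<theta>\<^sup>2 * x))"
  by (simp add: lam_def norm_exp_eq_Re)

text \<open>Two errors arise in each step of length h = 1 / tok: replacing 1 + lam h by its
  exponential costs theta^2 h^2, which is summable (2 - 2 / (n + 1) majorizes its sum), and the
  eigenvector defect costs |theta|^3 h, which sums to |theta|^3 hsum. Both multiply quantities that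
  already decay by the energy estimate, and the exponential propagates them with at least that
  decay.\<close>

lemma birth_eig_fun_asymp:
  assumes k: "k \<ge> 1"
  shows "\<exists>C\<ge>0. \<forall>\<theta> n. \<bar>\<theta>\<bar> \<le> 1 \<longrightarrow>
    cmod (birth k n (eig_fun k \<theta>) - exp (lam k \<theta> * of_real (hsum k n)) * eig_weight k \<theta> (k - 1))
    \<le> C * (\<theta>\<^sup>2 * (2 - 2 / (real n + 1)) + \<bar>\<theta>\<bar> ^ 3 * hsum k n) * exp (- (decay k * \<theta>\<^sup>2 * hsum k n))"
proof -
  obtain C1 where C1: "C1 \<ge> 0" "\<And>\<theta>. \<bar>\<theta>\<bar> \<le> 1 \<Longrightarrow> cmod (cis \<theta> - eig_weight k \<theta> k) \<le> C1 * \<bar>\<theta>\<bar> ^ 3"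
    using lam_approx_root[OF k] unfolding eig_weight_full by blast
  define C2 where "C2 = exp 2 * 4 * (real k * 3 ^ k)"
  define C where "C = exp 1 * (C1 + C2)"
  have C20: "C2 \<ge> 0" by (simp add: C2_def)
  have C0: "C \<ge> 0" using C1(1) C20 by (simp add: C_def)
  have "cmod (birth k n (eig_fun k \<theta>) - exp (lam k \<theta> * of_real (hsum k n)) * eig_weight k \<theta> (k - 1))
      \<le> C * (\<theta>\<^sup>2 * (2 - 2 / (real n + 1)) + \<bar>\<theta>\<bar> ^ 3 * hsum k n) * exp (- (decay k * \<theta>\<^sup>2 * hsum k n))"
    if \<theta>: "\<bar>\<theta>\<bar> \<le> 1" for \<theta> n
  proof (induction n)
    case 0
    \<comment> \<open>Initially both sides agree exactly, as 2 - 2 / (0 + 1) = 0 demands.\<close>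
    have "eig_fun k \<theta> (k - 1) = eig_weight k \<theta> (k - 1)"
      using k by (simp add: eig_fun_def level_char_def)
    then show ?case by (simp add: hsum_def)
  next
    case (Suc n)
    let ?G = "\<lambda>n. birth k n (eig_fun k \<theta>)" and ?l = "lam k \<theta>" and ?w = "eig_weight k \<theta> (k - 1)"
    let ?X = "\<lambda>n. exp (?l * of_real (hsum k n))" and ?e = "\<lambda>n. exp (- (decay k * \<theta>\<^sup>2 * hsum k n))"
    define h where "h = 1 / tok k (Suc n)"
    define \<beta> where "\<beta> = C * (\<theta>\<^sup>2 * (2 - 2 / (real n + 1)) + \<bar>\<theta>\<bar> ^ 3 * hsum k n)"
    have h: "0 < h" "h \<le> 1" using tok_Suc_ge[of k n] tok_pos[of k "Suc n"] by (auto simp: h_def divide_simps)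
    have \<theta>2: "0 \<le> \<theta>\<^sup>2" "\<theta>\<^sup>2 \<le> 1" using \<theta> by (auto simp: abs_square_le_1)
    have \<beta>0: "\<beta> \<ge> 0"
      unfolding \<beta>_def using C0 hsum_nonneg[of k n] by (intro mult_nonneg_nonneg add_nonneg_nonneg) (auto simp: divide_simps)
    have hs: "hsum k (Suc n) = hsum k n + h" by (simp add: hsum_Suc h_def)
    have d: "0 < decay k" "decay k \<le> 1" "decay k \<le> half_var k"
      using decay_bounds[OF k] half_var_bounds[OF k] by auto
    have lh: "cmod (?l * of_real h) \<le> 2 * \<bar>\<theta>\<bar> * h" "cmod (?l * of_real h) \<le> 2"
      using norm_lam_le[OF k \<theta>] h mult_mono[of "cmod ?l" "2" h 1] \<theta>
      by (auto simp: norm_mult mult_right_mono)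
    have XS: "?X (Suc n) = exp (?l * of_real h) * ?X n"
      by (simp add: hs distrib_left mult_exp_exp add.commute)
    have "?G (Suc n) = (1 + ?l * of_real h) * ?G n + of_real h * ((cis \<theta> - eig_weight k \<theta> k) * occ k n (level_char k \<theta>) (k - 1))"
      unfolding birth_eig_fun_Suc[OF k] by (simp add: h_def divide_simps)
    then have eq: "?G (Suc n) - ?X (Suc n) * ?w = exp (?l * of_real h) * (?G n - ?X n * ?w)
       - (exp (?l * of_real h) - 1 - ?l * of_real h) * ?G n
       + of_real h * ((cis \<theta> - eig_weight k \<theta> k) * occ k n (level_char k \<theta>) (k - 1))"
      unfolding XS by (simp add: algebra_simps)
    \<comment> \<open>Moving the decay factor from n to n + 1 costs at most exp 1.\<close>
    have edec: "?e n \<le> exp 1 * ?e (Suc n)"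
    proof -
      have "decay k * (\<theta>\<^sup>2 * h) \<le> 1 * (1 * 1)"
        using d h \<theta>2 by (intro mult_mono) auto
      then show ?thesis unfolding mult_exp_exp hs by (simp add: algebra_simps)
    qed
    have t1: "cmod (exp (?l * of_real h) * (?G n - ?X n * ?w)) \<le> \<beta> * ?e (Suc n)"
    proof -
      have "half_var k * \<theta>\<^sup>2 * h \<ge> decay k * \<theta>\<^sup>2 * h" using d h \<theta>2 by (intro mult_right_mono) auto
      then have "cmod (exp (?l * of_real h)) \<le> exp (- (decay k * \<theta>\<^sup>2 * h))"
        unfolding norm_exp_lam by simp
      moreover have "cmod (?G n - ?X n * ?w) \<le> \<beta> * ?e n" using Suc unfolding \<beta>_def .
      ultimately have "cmod (exp (?l * of_real h) * (?G n - ?X n * ?w)) \<le> exp (- (decay k * \<theta>\<^sup>2 * h)) * (\<beta> * ?e n)"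
        unfolding norm_mult by (intro mult_mono) auto
      also have "\<dots> = \<beta> * ?e (Suc n)" by (simp add: hs algebra_simps mult_exp_exp)
      finally show ?thesis .
    qed
    have t2: "cmod ((exp (?l * of_real h) - 1 - ?l * of_real h) * ?G n) \<le> C2 * \<theta>\<^sup>2 * h\<^sup>2 * ?e n"
    proof -
      let ?z = "?l * of_real h"
      have "cmod (exp ?z - 1 - ?z) \<le> exp \<bar>Re ?z\<bar> * cmod ?z ^ 2"
        using Taylor_exp[of ?z 1] by (simp add: algebra_simps numeral_2_eq_2)
      also have "\<dots> \<le> exp 2 * (2 * \<bar>\<theta>\<bar> * h) ^ 2"
        using lh abs_Re_le_cmod[of ?z] h by (intro mult_mono power_mono) auto
      finally have "cmod (exp ?z - 1 - ?z) \<le> exp 2 * 4 * \<theta>\<^sup>2 * h\<^sup>2" by (simp add: power_mult_distrib)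
      then have "cmod ((exp ?z - 1 - ?z) * ?G n) \<le> (exp 2 * 4 * \<theta>\<^sup>2 * h\<^sup>2) * (real k * 3 ^ k * ?e n)"
        unfolding norm_mult by (intro mult_mono norm_birth_eig_fun_le(1) k \<theta>) auto
      then show ?thesis by (simp add: C2_def mult_ac)
    qed
    have k1: "k - 1 < k" using k by simp
    have t3: "cmod (of_real h * ((cis \<theta> - eig_weight k \<theta> k) * occ k n (level_char k \<theta>) (k - 1)))
        \<le> h * (C1 * \<bar>\<theta>\<bar> ^ 3 * ?e n)"
      unfolding norm_mult norm_of_real abs_of_pos[OF h(1)] using h C1(1)
      by (intro mult_left_mono mult_mono C1(2) occ_level_char_bound \<theta> k1) auto
    \<comment> \<open>A telescoping majorant for the sum of squared steps.\<close>
    have h2: "h\<^sup>2 \<le> 2 / (real n + 1) - 2 / (real n + 2)"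
    proof -
      have "h \<le> 1 / (real n + 1)"
        unfolding h_def by (intro frac_le) (auto simp: tok_def algebra_simps)
      then have "h\<^sup>2 \<le> (1 / (real n + 1))\<^sup>2" using h by (intro power_mono) auto
      also have "\<dots> \<le> 2 / (real n + 1) - 2 / (real n + 2)"
        by (simp add: divide_simps power2_eq_square)
      finally show ?thesis .
    qed
    have "cmod (?G (Suc n) - ?X (Suc n) * ?w) \<le> \<beta> * ?e (Suc n) + C2 * \<theta>\<^sup>2 * h\<^sup>2 * ?e n + h * (C1 * \<bar>\<theta>\<bar> ^ 3 * ?e n)"
      unfolding eq by (intro norm_triangle_mono order_trans[OF norm_triangle_ineq4] add_mono t1 t2 t3)
    also have "\<dots> = \<beta> * ?e (Suc n) + (C2 * \<theta>\<^sup>2 * h\<^sup>2 + C1 * \<bar>\<theta>\<bar> ^ 3 * h) * ?e n"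
      by (simp add: algebra_simps)
    also have "\<dots> \<le> \<beta> * ?e (Suc n) + (C2 * \<theta>\<^sup>2 * h\<^sup>2 + C1 * \<bar>\<theta>\<bar> ^ 3 * h) * (exp 1 * ?e (Suc n))"
      using C1(1) C20 h edec by (intro add_left_mono mult_left_mono) auto
    also have "\<dots> \<le> \<beta> * ?e (Suc n) + ((C1 + C2) * (\<theta>\<^sup>2 * (2 / (real n + 1) - 2 / (real n + 2)) + \<bar>\<theta>\<bar> ^ 3 * h)) * (exp 1 * ?e (Suc n))"
    proof (intro add_left_mono mult_right_mono)
      have "C2 * \<theta>\<^sup>2 * h\<^sup>2 \<le> C2 * \<theta>\<^sup>2 * (2 / (real n + 1) - 2 / (real n + 2))"
        using h2 C20 by (intro mult_left_mono) auto
      moreover have "0 \<le> C1 * \<theta>\<^sup>2 * (2 / (real n + 1) - 2 / (real n + 2))"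
        using C1(1) order_trans[OF _ h2, of 0] by (intro mult_nonneg_nonneg) auto
      moreover have "0 \<le> C2 * \<bar>\<theta>\<bar> ^ 3 * h" using C20 h by auto
      ultimately show "C2 * \<theta>\<^sup>2 * h\<^sup>2 + C1 * \<bar>\<theta>\<bar> ^ 3 * h
          \<le> (C1 + C2) * (\<theta>\<^sup>2 * (2 / (real n + 1) - 2 / (real n + 2)) + \<bar>\<theta>\<bar> ^ 3 * h)"
        unfolding distrib_left distrib_right mult.assoc by linarith
    qed auto
    also have "\<dots> = C * (\<theta>\<^sup>2 * (2 - 2 / (real (Suc n) + 1)) + \<bar>\<theta>\<bar> ^ 3 * hsum k (Suc n)) * ?e (Suc n)"
    proof -
      have s: "real (Suc n) + 1 = real n + 2" by simp
      define p where "p = 2 / (real n + 1)"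
      define q where "q = 2 / (real n + 2)"
      show ?thesis unfolding \<beta>_def C_def hs s p_def[symmetric] q_def[symmetric] by (simp only: algebra_simps)
    qed
    finally show ?case .
  qed
  then show ?thesis using C0 by blast
qed

text \<open>Three replacements cost a factor |theta| each: the character by the eigenfunction, the
  eigenfunction by its exponential asymptotics, and the initial weight by 1. The exponential decay
  is then weakened to 1 / (1 + theta^2 hsum), whose integral is explicit.\<close>

theorem birth_char_asymp:
  assumes k: "k \<ge> 1"
  shows "\<exists>C\<ge>0. \<forall>\<theta> n. \<bar>\<theta>\<bar> \<le> 1 \<longrightarrow>
    cmod (birth k n (level_char k \<theta>) - exp (lam k \<theta> * of_real (hsum k n)))
    \<le> C * \<bar>\<theta>\<bar> / (1 + \<theta>\<^sup>2 * hsum k n)"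
proof -
  obtain C where C: "C \<ge> 0" "\<And>\<theta> n. \<bar>\<theta>\<bar> \<le> 1 \<Longrightarrow>
    cmod (birth k n (eig_fun k \<theta>) - exp (lam k \<theta> * of_real (hsum k n)) * eig_weight k \<theta> (k - 1))
    \<le> C * (\<theta>\<^sup>2 * (2 - 2 / (real n + 1)) + \<bar>\<theta>\<bar> ^ 3 * hsum k n) * exp (- (decay k * \<theta>\<^sup>2 * hsum k n))"
    using birth_eig_fun_asymp[OF k] by blast
  define C1 where "C1 = real k * 3 ^ k + 3 ^ k + 2 * C"
  have C1: "C1 \<ge> 0" using C by (simp add: C1_def)
  define d where "d = decay k"
  have d: "0 < d" "d \<le> 1" using decay_bounds[OF k] by (auto simp: d_def)
  have "cmod (birth k n (level_char k \<theta>) - exp (lam k \<theta> * of_real (hsum k n)))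
    \<le> C1 * 4 / d\<^sup>2 * \<bar>\<theta>\<bar> / (1 + \<theta>\<^sup>2 * hsum k n)" if \<theta>: "\<bar>\<theta>\<bar> \<le> 1" for \<theta> n
  proof -
    let ?w = "eig_weight k \<theta> (k - 1)" and ?X = "exp (lam k \<theta> * of_real (hsum k n))"
    let ?G = "birth k n (eig_fun k \<theta>)" and ?F = "birth k n (level_char k \<theta>)"
    define x where "x = \<theta>\<^sup>2 * hsum k n"
    let ?e = "exp (- (d * x))"
    have x: "x \<ge> 0" by (simp add: x_def hsum_nonneg)
    have e: "exp (- (decay k * \<theta>\<^sup>2 * hsum k n)) = ?e" by (simp add: x_def d_def mult.assoc)
    have t1: "cmod (?F - ?G) \<le> real k * 3 ^ k * \<bar>\<theta>\<bar> * ?e"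
      using norm_birth_eig_fun_le(2)[OF k \<theta>, of n] unfolding e .
    have t2: "cmod (?G - ?X * ?w) \<le> 2 * C * \<bar>\<theta>\<bar> * (1 + x) * ?e"
    proof -
      have "\<theta>\<^sup>2 \<le> \<bar>\<theta>\<bar>" using mult_left_mono[OF \<theta>, of "\<bar>\<theta>\<bar>"] by (simp add: power2_eq_square)
      then have "\<theta>\<^sup>2 * (2 - 2 / (real n + 1)) \<le> \<bar>\<theta>\<bar> * 2" by (intro mult_mono) (auto simp: divide_simps)
      moreover have "\<bar>\<theta>\<bar> ^ 3 * hsum k n = \<bar>\<theta>\<bar> * x" by (simp add: x_def power3_eq_cube power2_eq_square)
      moreover have "0 \<le> \<bar>\<theta>\<bar> * x" using x by simp
      ultimately have "\<theta>\<^sup>2 * (2 - 2 / (real n + 1)) + \<bar>\<theta>\<bar> ^ 3 * hsum k n \<le> 2 * (\<bar>\<theta>\<bar> * (1 + x))"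
        by (simp add: algebra_simps)
      then have "C * (\<theta>\<^sup>2 * (2 - 2 / (real n + 1)) + \<bar>\<theta>\<bar> ^ 3 * hsum k n) * ?e \<le> C * (2 * (\<bar>\<theta>\<bar> * (1 + x))) * ?e"
        using C(1) by (intro mult_right_mono mult_left_mono) auto
      then show ?thesis using C(2)[OF \<theta>, of n] unfolding e by (simp add: mult_ac)
    qed
    have t3: "cmod (?X * (?w - 1)) \<le> ?e * (3 ^ k * \<bar>\<theta>\<bar>)"
    proof -
      have "d * x \<le> half_var k * x" using half_var_bounds(1)[OF k] x by (intro mult_right_mono) (auto simp: d_def)
      then have "cmod ?X \<le> ?e" unfolding norm_exp_lam by (simp add: x_def mult.assoc)
      moreover have "cmod (?w - 1) \<le> 3 ^ k * \<bar>\<theta>\<bar>"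
        using eig_weight_bounds(2)[OF k \<theta>, of "k - 1"] mult_right_mono[of "3 ^ (k - 1)" "(3::real) ^ k" "\<bar>\<theta>\<bar>"]
          power_increasing[of "k - 1" k "3::real"] by simp
      ultimately show ?thesis unfolding norm_mult by (intro mult_mono) auto
    qed
    have "?F - ?X = (?F - ?G) + (?G - ?X * ?w) + ?X * (?w - 1)" by (simp add: algebra_simps)
    then have "cmod (?F - ?X) \<le> real k * 3 ^ k * \<bar>\<theta>\<bar> * ?e + 2 * C * \<bar>\<theta>\<bar> * (1 + x) * ?e + ?e * (3 ^ k * \<bar>\<theta>\<bar>)"
      by (simp only:)
     (rule norm_triangle_mono[OF norm_triangle_mono[OF t1 t2] t3])
    also have "\<dots> = (real k * 3 ^ k + 3 ^ k) * (\<bar>\<theta>\<bar> * ?e) + 2 * C * (\<bar>\<theta>\<bar> * (1 + x) * ?e)"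
      by (simp add: algebra_simps)
    also have "\<dots> \<le> (real k * 3 ^ k + 3 ^ k) * (\<bar>\<theta>\<bar> * (1 + x) * ?e) + 2 * C * (\<bar>\<theta>\<bar> * (1 + x) * ?e)"
      using x by (intro add_right_mono mult_left_mono mult_right_mono) (auto simp: mult_le_cancel_left1)
    also have "\<dots> = C1 * \<bar>\<theta>\<bar> * ((1 + x) * ?e)" by (simp add: C1_def algebra_simps)
    also have "\<dots> \<le> C1 * \<bar>\<theta>\<bar> * (4 / d\<^sup>2 / (1 + x))"
    proof (rule mult_left_mono)
      \<comment> \<open>Squaring this consequence of 1 + y <= exp y at y = d x / 2 yields (1 + x)
        exp (- d x) <= 4 / d^2 / (1 + x).\<close>
      have "d / 2 * (1 + x) \<le> 1 + d * x / 2" using d by (simp add: algebra_simps)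
      also have "\<dots> \<le> exp (d * x / 2)" by (rule exp_ge_add_one_self)
      finally have "(d / 2 * (1 + x))\<^sup>2 \<le> (exp (d * x / 2))\<^sup>2" using d x by (intro power_mono) auto
      then have "d\<^sup>2 * (1 + x)\<^sup>2 / 4 \<le> exp (d * x)"
        by (simp add: exp_double[symmetric] power_mult_distrib power_divide)
      then have "(1 + x) * (d\<^sup>2 * (1 + x)) * ?e \<le> 4 * exp (d * x) * ?e"
        by (intro mult_right_mono) (auto simp: power2_eq_square algebra_simps)
      also have "\<dots> = 4" by (simp add: exp_minus)
      finally have "(1 + x) * ?e * (d\<^sup>2 * (1 + x)) \<le> 4" by (simp add: mult_ac)
      then show "(1 + x) * ?e \<le> 4 / d\<^sup>2 / (1 + x)"
        using d x by (simp add: pos_le_divide_eq mult_ac add_pos_nonneg)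
    qed (use C1 in simp)
    finally show ?thesis by (simp add: x_def mult_ac)
  qed
  moreover have "C1 * 4 / d\<^sup>2 \<ge> 0" using C1 by simp
  ultimately show ?thesis by (intro exI[of _ "C1 * 4 / d\<^sup>2"]) auto
qed

section \<open>Mean and variance\<close>

text \<open>An interpolation of the level r div k: the increments are inverse to the rates, and
  \<open>harm k\<close> normalizes the growth over one period to 1.\<close>

definition pot :: "nat \<Rightarrow> nat \<Rightarrow> real" where
  "pot k r = (\<Sum>s<r. 1 / (harm k * rate k s))"

text \<open>The potential has constant drift. The variance grows at the rate of the expectation of 1 / rate,
  which the periodic corrector replaces by its average harm2 k / harm k.\<close>

definition corrector :: "nat \<Rightarrow> nat \<Rightarrow> real" where
  "corrector k r = (\<Sum>s<r. 1 / rate k s * (1 / rate k s - harm2 k / harm k))"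

lemma sum_rate: "(\<Sum>i<k. F (rate k i)) = (\<Sum>i=1..k. F (real i))"
  by (rule sum.reindex_bij_witness[where j = "\<lambda>i. k - i" and i = "\<lambda>i. k - i"])
     (auto simp: rate_def)

lemma sum_periodic_div_mod:
  fixes F :: "nat \<Rightarrow> real"
  assumes "k \<ge> 1" "\<And>r. F (r mod k) = F r"
  shows "(\<Sum>s<r. F s) = real (r div k) * (\<Sum>s<k. F s) + (\<Sum>s<r mod k. F s)"
proof (induction r)
  case (Suc r)
  have F: "(\<Sum>s<r mod k. F s) + F r = (\<Sum>s<Suc (r mod k). F s)"
    using assms(2)[of r] by simp
  show ?case
  proof (cases "Suc (r mod k) = k")
    case True
    then have "Suc r mod k = 0" "Suc r div k = Suc (r div k)" using assms(1) by (auto simp: mod_Suc div_Suc)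
    then show ?thesis using Suc F True by (simp add: algebra_simps)
  next
    case False
    then have "Suc r mod k = Suc (r mod k)" "Suc r div k = r div k" using assms(1) by (auto simp: mod_Suc div_Suc)
    then show ?thesis using Suc F by simp
  qed
qed simp

lemma pot_period:
  assumes "k \<ge> 1"
  shows "pot k k = 1"
proof -
  have "pot k k = (\<Sum>i=1..k. 1 / (harm k * real i))"
    unfolding pot_def by (rule sum_rate)
  also have "\<dots> = (1 / harm k) * harm k"
    unfolding harm_def sum_distrib_left by (simp add: divide_simps)
  finally show ?thesis using harm_ge_1[OF assms] by simp
qed

lemma pot_div_mod:
  assumes "k \<ge> 1"
  shows "pot k r = real (r div k) + pot k (r mod k)"
  using sum_periodic_div_mod[OF assms, of "\<lambda>s. 1 / (harm k * rate k s)" r] pot_period[OF assms]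
  by (simp add: pot_def rate_mod)

lemma pot_bounds:
  assumes "k \<ge> 1" "j \<le> k"
  shows "0 \<le> pot k j" "pot k j \<le> 1"
proof -
  have nn: "0 \<le> 1 / (harm k * rate k s)" for s
    using harm_ge_1[OF assms(1)] rate_nonneg[of k s] by simp
  show "0 \<le> pot k j" unfolding pot_def by (intro sum_nonneg nn)
  have "pot k j \<le> pot k k" unfolding pot_def using assms by (intro sum_mono2 nn) auto
  then show "pot k j \<le> 1" using pot_period[OF assms(1)] by simp
qed

lemma pot_drift:
  assumes "k \<ge> 1"
  shows "rate k r * (pot k (Suc r) - pot k r) = 1 / harm k"
  using rate_ge_1[OF assms, of r] by (simp add: pot_def)

lemma corrector_drift:
  assumes "k \<ge> 1"
  shows "rate k r * (corrector k (Suc r) - corrector k r) = 1 / rate k r - harm2 k / harm k"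
  using rate_ge_1[OF assms, of r] by (simp add: corrector_def)

text \<open>Over one period the increments sum to harm2 - harm (harm2 / harm) = 0, so the corrector
  is periodic.\<close>

lemma corrector_bound:
  assumes "k \<ge> 1"
  shows "\<exists>B. \<forall>r. \<bar>corrector k r\<bar> \<le> B"
proof -
  have "corrector k k = (\<Sum>i=1..k. 1 / real i * (1 / real i - harm2 k / harm k))"
    unfolding corrector_def by (rule sum_rate)
  also have "\<dots> = harm2 k - harm k * (harm2 k / harm k)"
    unfolding harm2_def[of k] unfolding harm_def[of k] sum_distrib_right
    by (simp add: algebra_simps sum_subtractf power2_eq_square divide_inverse)
  finally have "corrector k k = 0" using harm_ge_1[OF assms] by simp
  then have *: "corrector k r = corrector k (r mod k)" for r
    using sum_periodic_div_mod[OF assms, of "\<lambda>s. 1 / rate k s * (1 / rate k s - harm2 k / harm k)" r]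
    by (simp add: corrector_def rate_mod)
  have "\<bar>corrector k r\<bar> \<le> Max ((\<lambda>j. \<bar>corrector k j\<bar>) ` {..<k})" for r
    unfolding *[of r] using assms by (intro Max_ge) auto
  then show ?thesis by blast
qed

lemma birth_Suc_real:
  "birth k (Suc n) (\<phi> :: nat \<Rightarrow> real) = birth k n \<phi> + 1 / tok k (Suc n) * birth k n (\<lambda>r. rate k r * (\<phi> (Suc r) - \<phi> r))"
  by (simp add: birth_add birth_mult[symmetric])

lemma birth_pot:
  assumes "k \<ge> 1"
  shows "birth k n (pot k) = pot k (k - 1) + hsum k n / harm k"
proof (induction n)
  case (Suc n)
  show ?case unfolding birth_Suc_real pot_drift[OF assms] birth_const Suc hsum_Suc
    by (simp add: add_divide_distrib)
qed (simp add: hsum_def)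

lemma level_eq:
  assumes "k \<ge> 1"
  shows "real (r div k) = pot k r - pot k (r mod k)"
  using pot_div_mod[OF assms, of r] by simp

lemma birth_pot_mod_bounds:
  assumes "k \<ge> 1"
  shows "0 \<le> birth k n (\<lambda>r. pot k (r mod k))" "birth k n (\<lambda>r. pot k (r mod k)) \<le> 1"
  using birth_mono[of "\<lambda>_. 0" "\<lambda>r. pot k (r mod k)" k n] birth_mono[of "\<lambda>r. pot k (r mod k)" "\<lambda>_. 1" k n]
    pot_bounds[OF assms mod_le_divisor] assms by (auto simp: birth_const)

text \<open>Level and potential differ by a term in [0, 1], and the mean of the potential is
  exact.\<close>

theorem level_mean:
  assumes k: "k \<ge> 1"
  shows "\<bar>birth k n (\<lambda>r. real (r div k)) - hsum k n / harm k\<bar> \<le> 1"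
proof -
  have "birth k n (\<lambda>r. real (r div k)) = birth k n (pot k) - birth k n (\<lambda>r. pot k (r mod k))"
    unfolding level_eq[OF k] birth_diff ..
  then show ?thesis
    using birth_pot[OF k, of n] birth_pot_mod_bounds[OF k, of n] pot_bounds[OF k, of "k - 1"] by auto
qed

section \<open>Variance of the potential\<close>

definition sqsum :: "nat \<Rightarrow> nat \<Rightarrow> real" where
  "sqsum k n = (\<Sum>i=1..n. (1 / tok k i)\<^sup>2)"

lemma sqsum_bounds: "0 \<le> sqsum k n" "sqsum k n \<le> 2 - 2 / (real n + 1)"
proof -
  show "0 \<le> sqsum k n" by (simp add: sqsum_def sum_nonneg)
  show "sqsum k n \<le> 2 - 2 / (real n + 1)"
  proof (induction n)
    case (Suc n)
    have "1 / tok k (Suc n) \<le> 1 / (real n + 1)"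
      by (intro frac_le) (auto simp: tok_def algebra_simps)
    then have "(1 / tok k (Suc n))\<^sup>2 \<le> (1 / (real n + 1))\<^sup>2"
      using tok_pos[of k "Suc n"] by (intro power_mono) auto
    also have "\<dots> \<le> 2 / (real n + 1) - 2 / (real n + 2)"
      by (simp add: divide_simps power2_eq_square)
    finally have "sqsum k (Suc n) \<le> 2 - 2 / (real n + 2)" using Suc by (simp add: sqsum_def)
    then show ?case by (simp add: add.commute)
  qed (simp add: sqsum_def)
qed

definition centered_pot :: "nat \<Rightarrow> nat \<Rightarrow> nat \<Rightarrow> real" where
  "centered_pot k n r = pot k r - birth k n (pot k)"

lemma centered_pot_Suc:
  assumes "k \<ge> 1"
  shows "centered_pot k (Suc n) r = centered_pot k n r - 1 / tok k (Suc n) / harm k"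
  unfolding centered_pot_def birth_pot[OF assms] hsum_Suc by (simp add: add_divide_distrib)

lemma birth_centered_pot: "birth k n (centered_pot k n) = 0"
  unfolding centered_pot_def[abs_def] birth_diff birth_const by simp

text \<open>In one step the potential jumps by 1 / (H rate) with probability h rate, adding variance
  (h E(1 / rate) - h^2) / H^2. The drift of the corrector trades E(1 / rate) for harm2 / H plus a
  telescoping term.\<close>

lemma variance_pot:
  assumes k: "k \<ge> 1"
  shows "birth k n (\<lambda>r. (centered_pot k n r)\<^sup>2) =
    harm2 k / harm k ^ 3 * hsum k n + (birth k n (corrector k) - corrector k (k - 1) - sqsum k n) / (harm k)\<^sup>2"
proof (induction n)
  case 0
  show ?case by (simp add: centered_pot_def hsum_def sqsum_def)
next
  case (Suc n)
  define h where "h = 1 / tok k (Suc n)"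
  define H :: real where "H = harm k"
  have H: "H > 0" unfolding H_def using harm_ge_1[OF k] by linarith
  have step: "(centered_pot k (Suc n) r)\<^sup>2 + h * (rate k r * ((centered_pot k (Suc n) (Suc r))\<^sup>2 - (centered_pot k (Suc n) r)\<^sup>2))
     = (centered_pot k n r)\<^sup>2 + (h / H\<^sup>2 * (1 / rate k r) - h\<^sup>2 / H\<^sup>2)" for r
  proof -
    define u where "u = centered_pot k n r"
    define \<rho> where "\<rho> = rate k r"
    have \<rho>: "\<rho> > 0" using rate_ge_1[OF k, of r] by (simp add: \<rho>_def)
    have 1: "centered_pot k (Suc n) r = u - h / H"
      using centered_pot_Suc[OF k] by (simp add: u_def h_def H_def)
    have 2: "centered_pot k (Suc n) (Suc r) = u - h / H + 1 / (H * \<rho>)"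
      using 1 by (simp add: centered_pot_def pot_def H_def \<rho>_def)
    show ?thesis unfolding 1 2 u_def[symmetric] \<rho>_def[symmetric] using H \<rho>
      by (simp add: field_simps power2_eq_square)
  qed
  have "birth k (Suc n) (\<lambda>r. (centered_pot k (Suc n) r)\<^sup>2)
     = birth k n (\<lambda>r. (centered_pot k (Suc n) r)\<^sup>2 + h * (rate k r * ((centered_pot k (Suc n) (Suc r))\<^sup>2 - (centered_pot k (Suc n) r)\<^sup>2)))"
    unfolding birth_Suc_real h_def[symmetric] birth_add birth_mult ..
  also have "\<dots> = birth k n (\<lambda>r. (centered_pot k n r)\<^sup>2) + (h / H\<^sup>2 * birth k n (\<lambda>r. 1 / rate k r) - h\<^sup>2 / H\<^sup>2)"
    unfolding step birth_add birth_diff birth_mult birth_const ..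
  finally have V: "birth k (Suc n) (\<lambda>r. (centered_pot k (Suc n) r)\<^sup>2) = \<dots>" .
  have "birth k (Suc n) (corrector k) = birth k n (corrector k) + h * (birth k n (\<lambda>r. 1 / rate k r) - harm2 k / H)"
    unfolding birth_Suc_real corrector_drift[OF k] birth_diff birth_const h_def H_def ..
  then have "h * birth k n (\<lambda>r. 1 / rate k r) = birth k (Suc n) (corrector k) - birth k n (corrector k) + h * (harm2 k / H)"
    by (simp add: algebra_simps)
  moreover have "h2 / H ^ 3 * a + (B0 - q - s) / H\<^sup>2 + (h / H\<^sup>2 * R - h\<^sup>2 / H\<^sup>2)
      = h2 / H ^ 3 * (a + h) + (B1 - q - (s + h\<^sup>2)) / H\<^sup>2"
    if "h * R = B1 - B0 + h * (h2 / H)" for h2 a B0 B1 q s R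
  proof -
    have "h / H\<^sup>2 * R = (B1 - B0 + h * (h2 / H)) / H\<^sup>2" using that by simp
    also have "\<dots> = B1 / H\<^sup>2 - B0 / H\<^sup>2 + h2 / H ^ 3 * h"
      by (simp add: diff_divide_distrib add_divide_distrib power2_eq_square power3_eq_cube mult_ac)
    finally show ?thesis by (simp add: diff_divide_distrib add_divide_distrib distrib_left)
  qed
  moreover have "sqsum k (Suc n) = sqsum k n + h\<^sup>2" by (simp add: sqsum_def h_def)
  moreover have "hsum k (Suc n) = hsum k n + h" by (simp add: hsum_Suc h_def)
  ultimately show ?case unfolding V Suc H_def[symmetric] by (simp only:)
qed

section \<open>Covariance of the potential with the residue\<close>

definition occ_pot :: "nat \<Rightarrow> nat \<Rightarrow> nat \<Rightarrow> complex" where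
  "occ_pot k n = occ k n (\<lambda>r. of_real (centered_pot k n r))"

lemma occ_add: "occ k n (\<lambda>r. \<phi> r + \<psi> r) j = occ k n \<phi> j + occ k n \<psi> j"
proof -
  have "(if r mod k = j then \<phi> r + \<psi> r else 0) = (if r mod k = j then \<phi> r else 0) + (if r mod k = j then \<psi> r else 0)" for r
    by simp
  then show ?thesis unfolding occ_def by (simp only: birth_add)
qed

lemma occ_mult: "occ k n (\<lambda>r. c * \<phi> r) j = c * occ k n \<phi> j"
proof -
  have "(if r mod k = j then c * \<phi> r else 0) = c * (if r mod k = j then \<phi> r else 0)" for r
    by simp
  then show ?thesis unfolding occ_def by (simp only: birth_mult)
qed

lemma norm_occ_one: "cmod (occ k n (\<lambda>_. 1) j) \<le> 1"
  unfolding occ_def by (rule norm_birth_bound) simp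

lemma occ_cong_mod:
  assumes "\<And>r. r mod k = j \<Longrightarrow> \<phi> r = \<psi> r"
  shows "occ k n \<phi> j = occ k n \<psi> j"
  unfolding occ_def using assms by (metis (mono_tags))

text \<open>The flow with phase 1, plus a bounded source \<open>b\<close> that collects the jumps of
  the potential and the recentring.\<close>

lemma occ_pot_Suc:
  assumes k: "k \<ge> 1"
  shows "\<exists>b. (\<forall>j<k. occ_pot k (Suc n) j = (occ_pot k n j + (1 / tok k (Suc n)) *\<^sub>R cycle_flow k 1 (occ_pot k n) j)
     + (1 / tok k (Suc n)) *\<^sub>R b j) \<and> (\<forall>j<k. cmod (b j) \<le> 4)"
proof -
  define h where "h = 1 / tok k (Suc n)"
  define H :: real where "H = harm k"
  have H: "H \<ge> 1" using harm_ge_1[OF k] by (simp add: H_def)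
  define \<pi> where "\<pi> j = occ k n (\<lambda>_. 1) j" for j
  define b where "b j = of_real (1 / H) * ((of_real (1 - h * rate k (cpred k j)) * \<pi> (cpred k j)) - of_real (1 - h * rate k j) * \<pi> j)" for j
  have hr: "0 \<le> h * rate k j" "h * rate k j \<le> 1" for j
    using rate_div_tok[of k j n] by (auto simp: h_def)
  have "occ_pot k (Suc n) j = (occ_pot k n j + h *\<^sub>R cycle_flow k 1 (occ_pot k n) j) + h *\<^sub>R b j" if j: "j < k" for j
  proof -
    let ?p = "cpred k j"
    have 1: "occ k n (\<lambda>r. of_real (centered_pot k (Suc n) r)) i = occ_pot k n i + of_real (- h / H) * \<pi> i" for i
    proof -
      have "(\<lambda>r. complex_of_real (centered_pot k (Suc n) r)) = (\<lambda>r. of_real (centered_pot k n r) + of_real (- h / H) * 1)"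
        unfolding centered_pot_Suc[OF k] h_def H_def by (simp add: fun_eq_iff)
      then show ?thesis unfolding \<pi>_def occ_pot_def by (simp only: occ_add occ_mult)
    qed
    have "occ k n (\<lambda>r. of_real (centered_pot k (Suc n) (Suc r))) ?p
      = occ k n (\<lambda>r. of_real (centered_pot k (Suc n) r) + of_real (1 / (H * rate k ?p)) * 1) ?p"
    proof (rule occ_cong_mod)
      fix r assume "r mod k = ?p"
      then have "rate k r = rate k ?p" using rate_mod[of k r] by simp
      then show "complex_of_real (centered_pot k (Suc n) (Suc r))
          = of_real (centered_pot k (Suc n) r) + of_real (1 / (H * rate k ?p)) * 1"
        by (simp add: centered_pot_def pot_def H_def)
    qed
    also have "\<dots> = occ_pot k n ?p + of_real (- h / H) * \<pi> ?p + of_real (1 / (H * rate k ?p)) * \<pi> ?p"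
      unfolding occ_add occ_mult 1 \<pi>_def ..
    finally have 2: "occ k n (\<lambda>r. of_real (centered_pot k (Suc n) (Suc r))) ?p = \<dots>" .
    have rp: "rate k ?p \<noteq> 0" using rate_ge_1[OF k, of ?p] by simp
    have inv: "of_real (rate k ?p) * complex_of_real (1 / (H * rate k ?p)) = of_real (1 / H)"
      unfolding of_real_mult[symmetric] using rp by simp
    have "occ_pot k (Suc n) j = occ_pot k n j + of_real (- h / H) * \<pi> j
      + of_real h * (of_real (rate k ?p) * (occ_pot k n ?p + of_real (- h / H) * \<pi> ?p) + (of_real (rate k ?p) * of_real (1 / (H * rate k ?p))) * \<pi> ?p
         - of_real (rate k j) * (occ_pot k n j + of_real (- h / H) * \<pi> j))"
      unfolding occ_pot_def[of k "Suc n"] occ_Suc[OF j] 1 2 h_def[symmetric] scaleR_conv_of_real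
      by (simp add: algebra_simps)
    also have "\<dots> = (occ_pot k n j + h *\<^sub>R cycle_flow k 1 (occ_pot k n) j) + h *\<^sub>R b j"
      unfolding inv using H by (simp add: b_def cycle_flow_def scaleR_conv_of_real field_simps)
    finally show ?thesis .
  qed
  moreover have "cmod (b j) \<le> 4" for j
  proof -
    have *: "cmod (of_real (1 - h * rate k i) * \<pi> i) \<le> 1 * 1" for i
      unfolding norm_mult norm_of_real using hr[of i] norm_occ_one[of k n i]
      by (intro mult_mono) (auto simp: \<pi>_def)
    have "cmod (of_real (1 - h * rate k (cpred k j)) * \<pi> (cpred k j) - of_real (1 - h * rate k j) * \<pi> j) \<le> 1 * 1 + 1 * 1"
      by (rule order_trans[OF norm_triangle_ineq4 add_mono[OF * *]])
    moreover have "cmod (of_real (1 / H)) \<le> 1" using H unfolding norm_of_real by simp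
    ultimately have "cmod (b j) \<le> 1 * 2" unfolding b_def norm_mult[of "of_real (1 / H)"] by (intro mult_mono) auto
    then show ?thesis by simp
  qed
  ultimately show ?thesis unfolding h_def by blast
qed

text \<open>As a Euclidean norm the root of the energy obeys the triangle inequality, which
  separates flow and source.\<close>

lemma sqrt_cycle_energy: "sqrt (cycle_energy k v) = L2_set (\<lambda>j. sqrt (rate k j) * cmod (v j)) {..<k}"
  unfolding cycle_energy_def L2_set_def by (simp add: power_mult_distrib rate_nonneg)

lemma sqrt_cycle_energy_add:
  "sqrt (cycle_energy k (\<lambda>j. u j + v j)) \<le> sqrt (cycle_energy k u) + sqrt (cycle_energy k v)"
proof -
  have "L2_set (\<lambda>j. sqrt (rate k j) * cmod (u j + v j)) {..<k}
      \<le> L2_set (\<lambda>j. sqrt (rate k j) * cmod (u j) + sqrt (rate k j) * cmod (v j)) {..<k}"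
    by (intro L2_set_mono) (auto simp: rate_nonneg distrib_left[symmetric] intro!: mult_left_mono norm_triangle_ineq)
  also have "\<dots> \<le> L2_set (\<lambda>j. sqrt (rate k j) * cmod (u j)) {..<k} + L2_set (\<lambda>j. sqrt (rate k j) * cmod (v j)) {..<k}"
    by (rule L2_set_triangle_ineq)
  finally show ?thesis unfolding sqrt_cycle_energy .
qed

lemma sqrt_cycle_energy_scaled_le:
  assumes "\<And>j. j < k \<Longrightarrow> cmod (b j) \<le> 4" "h \<ge> 0"
  shows "sqrt (cycle_energy k (\<lambda>j. h *\<^sub>R b j)) \<le> 4 * real k * h"
proof (rule real_le_lsqrt)
  have "cycle_energy k (\<lambda>j. h *\<^sub>R b j) \<le> (\<Sum>j<k. real k * (4 * h)\<^sup>2)"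
    unfolding cycle_energy_def
    using assms by (intro sum_mono mult_mono rate_le power_mono) (auto simp: mult.commute[of h] mult_right_mono)
  also have "\<dots> = (4 * real k * h)\<^sup>2" by (simp add: power_mult_distrib power2_eq_square)
  finally show "cycle_energy k (\<lambda>j. h *\<^sub>R b j) \<le> (4 * real k * h)\<^sup>2" .
qed (use assms in auto)

lemma cycle_energy_nonneg: "cycle_energy k v \<ge> 0"
  unfolding cycle_energy_def by (intro sum_nonneg mult_nonneg_nonneg rate_nonneg) auto

text \<open>Centring makes the vector sum to zero, so the zero-sum gap contracts the root of the
  energy by 1 - 4 decay h, while the source adds at most 4 k h. The bound k / decay is the fixed
  point of this recursion, and the start is 0.\<close>

lemma occ_pot_bound:
  assumes k: "k \<ge> 1" and j: "j < k"
  shows "cmod (occ_pot k n j) \<le> real k / decay k"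
proof -
  have d: "0 < decay k" "decay k \<le> 1 / 2"
    using decay_bounds[OF k] half_var_bounds[OF k] by auto
  have w: "sqrt (cycle_energy k (occ_pot k n)) \<le> real k / decay k" for n
  proof (induction n)
    case 0
    have "occ_pot k 0 j = 0" for j
      by (simp add: occ_pot_def occ_def centered_pot_def)
    then have "cycle_energy k (occ_pot k 0) = 0" by (simp add: cycle_energy_def)
    then show ?case using d by simp
  next
    case (Suc n)
    define h where "h = 1 / tok k (Suc n)"
    have h: "0 < h" "h \<le> 1 / 3"
    proof -
      show "0 < h" using tok_pos by (simp add: h_def)
      have "1 / tok k (Suc n) \<le> 1 / 3" using tok_Suc_ge[of k n] k by (intro frac_le) auto
      then show "h \<le> 1 / 3" by (simp add: h_def)
    qed
    obtain b where b: "\<And>j. j < k \<Longrightarrow> occ_pot k (Suc n) j = (occ_pot k n j + h *\<^sub>R cycle_flow k 1 (occ_pot k n) j) + h *\<^sub>R b j"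
      "\<And>j. j < k \<Longrightarrow> cmod (b j) \<le> 4"
      using occ_pot_Suc[OF k, of n] unfolding h_def by blast
    have sum0: "(\<Sum>j<k. occ_pot k n j) = 0"
    proof -
      have "(\<Sum>j<k. occ_pot k n j) = birth k n (\<lambda>r. of_real (centered_pot k n r))"
        unfolding occ_pot_def by (rule sum_occ[OF k])
      also have "\<dots> = complex_of_real (birth k n (centered_pot k n))"
        by (rule birth_linear[symmetric]) (simp add: linear_iff scaleR_conv_of_real)
      finally show ?thesis by (simp add: birth_centered_pot)
    qed
    have x: "0 \<le> 1 - 4 * decay k * h"
      using mult_mono[of "decay k" "1 / 2" h "1 / 3"] d h by simp
    have "cycle_energy k (\<lambda>j. occ_pot k n j + h *\<^sub>R cycle_flow k 1 (occ_pot k n) j)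
        \<le> (1 - (2 / ((real k + 2) * real k ^ 3)) * 1\<^sup>2 / tok k (Suc n)) * cycle_energy k (occ_pot k n)"
      unfolding h_def using cycle_gap_zero_sum[OF _ sum0]
      by (intro cycle_energy_contract k) auto
    also have "1 - (2 / ((real k + 2) * real k ^ 3)) * 1\<^sup>2 / tok k (Suc n) = 1 - 8 * decay k * h"
      unfolding decay_def h_def mult.assoc[of 4] by simp
    also have "\<dots> * cycle_energy k (occ_pot k n) \<le> (1 - 4 * decay k * h)\<^sup>2 * cycle_energy k (occ_pot k n)"
      using zero_le_power2[of "4 * decay k * h"]
      by (intro mult_right_mono cycle_energy_nonneg) (simp add: power2_diff)
    finally have "sqrt (cycle_energy k (\<lambda>j. occ_pot k n j + h *\<^sub>R cycle_flow k 1 (occ_pot k n) j))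
        \<le> sqrt ((1 - 4 * decay k * h)\<^sup>2 * cycle_energy k (occ_pot k n))"
      by (rule real_sqrt_le_mono)
    also have "\<dots> = (1 - 4 * decay k * h) * sqrt (cycle_energy k (occ_pot k n))"
      using x by (simp add: real_sqrt_mult)
    also have "\<dots> \<le> (1 - 4 * decay k * h) * (real k / decay k)"
      using Suc x by (rule mult_left_mono)
    finally have 1: "sqrt (cycle_energy k (\<lambda>j. occ_pot k n j + h *\<^sub>R cycle_flow k 1 (occ_pot k n) j)) \<le> \<dots>" .
    have "cycle_energy k (occ_pot k (Suc n))
        = cycle_energy k (\<lambda>j. (occ_pot k n j + h *\<^sub>R cycle_flow k 1 (occ_pot k n) j) + h *\<^sub>R b j)"
      unfolding cycle_energy_def using b(1) by (intro sum.cong) auto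
    then have "sqrt (cycle_energy k (occ_pot k (Suc n))) \<le> (1 - 4 * decay k * h) * (real k / decay k) + 4 * real k * h"
      using order_trans[OF sqrt_cycle_energy_add add_mono[OF 1 sqrt_cycle_energy_scaled_le[OF b(2)]]] h by simp
    also have "\<dots> = real k / decay k" using d by (simp add: field_simps)
    finally show ?case .
  qed
  have "(cmod (occ_pot k n j))\<^sup>2 \<le> rate k j * (cmod (occ_pot k n j))\<^sup>2"
    using rate_ge_1[OF k, of j] mult_right_mono[of 1 "rate k j"] by simp
  also have "\<dots> \<le> cycle_energy k (occ_pot k n)" unfolding cycle_energy_def
    using j by (intro member_le_sum) (auto intro!: mult_nonneg_nonneg rate_nonneg)
  finally have "cmod (occ_pot k n j) \<le> sqrt (cycle_energy k (occ_pot k n))"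
    by (rule real_le_rsqrt)
  then show ?thesis using w[of n] by linarith
qed

lemma covariance_pot_bound:
  assumes k: "k \<ge> 1"
  shows "\<bar>birth k n (\<lambda>r. centered_pot k n r * pot k (r mod k))\<bar> \<le> real k * (real k / decay k)"
proof -
  have "complex_of_real (birth k n (\<lambda>r. centered_pot k n r * pot k (r mod k)))
      = birth k n (\<lambda>r. of_real (centered_pot k n r * pot k (r mod k)))"
    by (rule birth_linear) (simp add: linear_iff scaleR_conv_of_real)
  also have "\<dots> = (\<Sum>j<k. occ k n (\<lambda>r. of_real (centered_pot k n r * pot k (r mod k))) j)"
    by (rule sum_occ[OF k, symmetric])
  also have "\<dots> = (\<Sum>j<k. of_real (pot k j) * occ_pot k n j)"
  proof (rule sum.cong)
    fix j
    have "occ k n (\<lambda>r. of_real (centered_pot k n r * pot k (r mod k))) j = occ k n (\<lambda>r. of_real (pot k j) * of_real (centered_pot k n r)) j"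
      by (rule occ_cong_mod) simp
    then show "occ k n (\<lambda>r. of_real (centered_pot k n r * pot k (r mod k))) j = of_real (pot k j) * occ_pot k n j"
      unfolding occ_mult occ_pot_def .
  qed simp
  finally have "\<bar>birth k n (\<lambda>r. centered_pot k n r * pot k (r mod k))\<bar> = cmod (\<Sum>j<k. of_real (pot k j) * occ_pot k n j)"
    by (metis norm_of_real)
  also have "\<dots> \<le> (\<Sum>j<k. 1 * (real k / decay k))"
  proof (rule sum_norm_le)
    fix j assume "j \<in> {..<k}"
    then show "cmod (of_real (pot k j) * occ_pot k n j) \<le> 1 * (real k / decay k)"
      unfolding norm_mult norm_of_real using pot_bounds[OF k, of j] occ_pot_bound[OF k, of j n]
      by (intro mult_mono) auto
  qed
  finally show ?thesis by simp
qed

text \<open>The centred level is the centred potential minus the centred residue correction g - g0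
  with values in [-1, 1]. Expanding the square leaves the variance of the potential, a bounded
  covariance and a term of at most 1.\<close>

theorem level_variance:
  assumes k: "k \<ge> 1"
  shows "\<exists>B. \<forall>n. \<bar>birth k n (\<lambda>r. (real (r div k) - birth k n (\<lambda>r. real (r div k)))\<^sup>2)
     - harm2 k / harm k ^ 3 * hsum k n\<bar> \<le> B"
proof -
  obtain Bq where Bq: "\<And>r. \<bar>corrector k r\<bar> \<le> Bq" using corrector_bound[OF k] by blast
  let ?C = "real k * (real k / decay k)"
  have "\<bar>birth k n (\<lambda>r. (real (r div k) - birth k n (\<lambda>r. real (r div k)))\<^sup>2) - harm2 k / harm k ^ 3 * hsum k n\<bar>
    \<le> (2 * Bq + 2) + 2 * ?C + 1" for n
  proof -
    let ?g = "\<lambda>r. pot k (r mod k)"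
    define g0 where "g0 = birth k n ?g"
    define Q where "Q = birth k n (corrector k) - corrector k (k - 1) - sqsum k n"
    have m: "birth k n (\<lambda>r. real (r div k)) = birth k n (pot k) - g0"
      unfolding level_eq[OF k] birth_diff g0_def ..
    have "(real (r div k) - birth k n (\<lambda>r. real (r div k)))\<^sup>2
      = (centered_pot k n r)\<^sup>2 - 2 * (centered_pot k n r * ?g r) + 2 * g0 * centered_pot k n r + (?g r - g0)\<^sup>2" for r
      unfolding m level_eq[OF k, of r] centered_pot_def by (simp add: power2_eq_square algebra_simps)
    then have "birth k n (\<lambda>r. (real (r div k) - birth k n (\<lambda>r. real (r div k)))\<^sup>2)
      = birth k n (\<lambda>r. (centered_pot k n r)\<^sup>2) - 2 * birth k n (\<lambda>r. centered_pot k n r * ?g r)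
        + 2 * g0 * birth k n (centered_pot k n) + birth k n (\<lambda>r. (?g r - g0)\<^sup>2)"
      by (simp only: birth_add birth_diff birth_mult)
    also have "\<dots> = harm2 k / harm k ^ 3 * hsum k n + Q / (harm k)\<^sup>2 - 2 * birth k n (\<lambda>r. centered_pot k n r * ?g r)
        + birth k n (\<lambda>r. (?g r - g0)\<^sup>2)"
      unfolding variance_pot[OF k] birth_centered_pot Q_def by simp
    finally have "birth k n (\<lambda>r. (real (r div k) - birth k n (\<lambda>r. real (r div k)))\<^sup>2) - harm2 k / harm k ^ 3 * hsum k n
      = Q / (harm k)\<^sup>2 - 2 * birth k n (\<lambda>r. centered_pot k n r * ?g r) + birth k n (\<lambda>r. (?g r - g0)\<^sup>2)"
      by simp
    moreover have "\<bar>Q / (harm k)\<^sup>2\<bar> \<le> 2 * Bq + 2"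
    proof -
      have "\<bar>birth k n (corrector k)\<bar> \<le> Bq"
        using norm_birth_bound[of "corrector k" Bq k n] Bq by simp
      moreover have "\<bar>sqsum k n\<bar> \<le> 2" using sqsum_bounds[of k n] by (auto simp: abs_le_iff intro: order_trans)
      ultimately have "\<bar>Q\<bar> \<le> 2 * Bq + 2" using Bq[of "k - 1"] unfolding Q_def by linarith
      moreover have "\<bar>Q\<bar> / (harm k)\<^sup>2 \<le> \<bar>Q\<bar>"
        using harm_ge_1[OF k] by (intro divide_le_self) auto
      ultimately show ?thesis by (simp add: abs_divide)
    qed
    moreover have "0 \<le> birth k n (\<lambda>r. (?g r - g0)\<^sup>2)" "birth k n (\<lambda>r. (?g r - g0)\<^sup>2) \<le> 1"
    proof -
      have "0 \<le> ?g r" "?g r \<le> 1" for r using pot_bounds[OF k, of "r mod k"] k mod_le_divisor[of k r] by auto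
      moreover have "0 \<le> g0" "g0 \<le> 1" using birth_pot_mod_bounds[OF k] by (auto simp: g0_def)
      ultimately have "\<bar>?g r - g0\<bar> \<le> 1" for r by (smt (verit))
      then have "(?g r - g0)\<^sup>2 \<le> 1" for r by (simp add: abs_square_le_1)
      then show "birth k n (\<lambda>r. (?g r - g0)\<^sup>2) \<le> 1"
        using birth_mono[of "\<lambda>r. (?g r - g0)\<^sup>2" "\<lambda>_. 1" k n] by (simp add: birth_const)
      show "0 \<le> birth k n (\<lambda>r. (?g r - g0)\<^sup>2)"
        using birth_mono[of "\<lambda>_. 0" "\<lambda>r. (?g r - g0)\<^sup>2" k n] by (simp add: birth_const)
    qed
    ultimately show ?thesis using covariance_pot_bound[OF k, of n] by linarith
  qed
  then show ?thesis by blast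
qed

section \<open>Comparison with the normal law\<close>

text \<open>With p = k + 1 and q = m + 1 the increment 1 / (p q) - 1 / (1 + p q) is nonnegative and
  at most 1 / q^2, again majorized by a telescoping sum.\<close>

lemma hsum_harm_bounds:
  "0 \<le> harm m / (real k + 1) - hsum k m" "harm m / (real k + 1) - hsum k m \<le> 2 - 2 / (real m + 1)"
proof -
  have "0 \<le> harm m / (real k + 1) - hsum k m \<and> harm m / (real k + 1) - hsum k m \<le> 2 - 2 / (real m + 1)"
  proof (induction m)
    case 0
    show ?case by (simp add: harm_def hsum_def)
  next
    case (Suc m)
    define q where "q = real m + 1"
    define p where "p = real k + 1"
    have pq: "q \<ge> 1" "p \<ge> 1" by (auto simp: q_def p_def)
    have inc: "harm (Suc m) / p - hsum k (Suc m) = (harm m / p - hsum k m) + (1 / (p * q) - 1 / (1 + p * q))"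
      by (simp add: harm_Suc hsum_Suc tok_def p_def q_def add_divide_distrib inverse_eq_divide algebra_simps)
    have pq0: "p * q > 0" using pq by simp
    then have pq1: "1 + p * q > 0" by linarith
    have "1 / (p * q) - 1 / (1 + p * q) = 1 / ((p * q) * (1 + p * q))"
      using pq pq1 by (simp add: divide_simps)
    also have "\<dots> \<le> 1 / (q * q)"
    proof (rule frac_le)
      have "q \<le> p * q" using pq by (simp add: mult_le_cancel_right1)
      then show "q * q \<le> (p * q) * (1 + p * q)" using pq pq1 by (intro mult_mono) linarith+
    qed (use pq in auto)
    also have "\<dots> \<le> 2 / q - 2 / (q + 1)"
      using pq by (simp add: divide_simps)
    finally have up: "1 / (p * q) - 1 / (1 + p * q) \<le> 2 / q - 2 / (q + 1)" .
    have lo: "0 \<le> 1 / (p * q) - 1 / (1 + p * q)"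
      using frac_le[of 1 1 "p * q" "1 + p * q"] pq0 by simp
    show ?case using Suc inc up lo unfolding p_def[symmetric] by (simp add: q_def add.commute)
  qed
  then show "0 \<le> harm m / (real k + 1) - hsum k m" "harm m / (real k + 1) - hsum k m \<le> 2 - 2 / (real m + 1)"
    by auto
qed

text \<open>3 = 1 + 2: one from comparing \<open>harm m\<close> with the logarithm, two from
  \<open>hsum_harm_bounds\<close>. The logarithm is taken at m + 1, the label of the node whose
  distance is studied.\<close>

lemma hsum_ln_bound: "\<bar>hsum k m - ln (real (Suc m)) / (real k + 1)\<bar> \<le> 3"
proof -
  have 1: "ln (real (Suc m)) \<le> harm m" using ln_le_harm[of m] by (simp add: add.commute)
  have "harm m \<le> (harm (Suc m) :: real)" by (simp add: harm_Suc)
  also have "\<dots> \<le> ln (real (Suc m)) + 1"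
    using euler_mascheroni_sequence_decreasing[of 1 "Suc m"] by (simp add: harm_def)
  finally have "\<bar>harm m - ln (real (Suc m))\<bar> \<le> 1" using 1 by simp
  then have "\<bar>harm m / (real k + 1) - ln (real (Suc m)) / (real k + 1)\<bar> \<le> 1"
    unfolding diff_divide_distrib[symmetric] abs_divide using divide_le_self[of "\<bar>harm m - ln (real (Suc m))\<bar>" "real k + 1"]
    by simp
  moreover have "2 - 2 / (real m + 1) \<le> 2" by simp
  ultimately show ?thesis using hsum_harm_bounds[of m k] by linarith
qed

section \<open>Stability of the normal distribution function under shift and scaling\<close>

lemma std_normal_density_le: "std_normal_density z \<le> exp (- z\<^sup>2 / 2)"
proof -
  have "1 \<le> sqrt (2 * pi)" using pi_gt3 by simp
  then have "1 / sqrt (2 * pi) * exp (- z\<^sup>2 / 2) \<le> 1 * exp (- z\<^sup>2 / 2)"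
    by (intro mult_right_mono) auto
  then show ?thesis by (simp add: std_normal_density_def)
qed

lemma Phi_eq_cdf: "Phi = cdf std_normal_distribution"
  by (simp add: fun_eq_iff Phi_def cdf_def)

lemma Phi_diff_le:
  assumes "x \<le> y" "\<And>z. x \<le> z \<Longrightarrow> z \<le> y \<Longrightarrow> std_normal_density z \<le> c"
  shows "Phi y - Phi x \<le> c * (y - x)"
proof -
  interpret real_distribution std_normal_distribution by (rule real_dist_normal_dist)
  have c0: "c \<ge> 0" using assms(2)[of x] assms(1) normal_density_nonneg[of 0 1 x] by linarith
  have "Phi y - Phi x = measure std_normal_distribution {x<..y}"
  proof (cases "x = y")
    case False
    then show ?thesis using cdf_diff_eq[of x y] assms(1) by (simp add: Phi_eq_cdf)
  qed simp
  also have "ennreal \<dots> = (\<integral>\<^sup>+z. ennreal (std_normal_density z) * indicator {x<..y} z \<partial>lborel)"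
    by (simp add: emeasure_eq_measure[symmetric] emeasure_density)
  also have "\<dots> \<le> (\<integral>\<^sup>+z. ennreal c * indicator {x<..y} z \<partial>lborel)"
    using assms(2) by (intro nn_integral_mono) (auto simp: indicator_def intro!: ennreal_leI)
  also have "\<dots> = ennreal (c * (y - x))"
    using assms(1) c0 by (simp add: nn_integral_cmult_indicator ennreal_mult)
  finally show ?thesis using c0 assms(1) by (simp add: ennreal_le_iff)
qed

lemma Phi_mono: "x \<le> y \<Longrightarrow> Phi x \<le> Phi y"
  unfolding Phi_eq_cdf
  using real_distribution.axioms(1)[OF real_dist_normal_dist] finite_borel_measure.cdf_nondecreasing[OF real_distribution.finite_borel_measure_M[OF real_dist_normal_dist]]
  by simp

lemma Phi_diff_abs_le:
  assumes "\<And>z. min x y \<le> z \<Longrightarrow> z \<le> max x y \<Longrightarrow> std_normal_density z \<le> c"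
  shows "\<bar>Phi y - Phi x\<bar> \<le> c * \<bar>y - x\<bar>"
  using Phi_diff_le[of x y c] Phi_diff_le[of y x c] Phi_mono[of x y] Phi_mono[of y x] assms
  by (cases "x \<le> y") (auto simp: min_def max_def)

lemma Phi_lipschitz: "\<bar>Phi y - Phi x\<bar> \<le> \<bar>y - x\<bar>"
proof -
  have "std_normal_density z \<le> 1" for z
    using std_normal_density_le[of z] order_trans[of _ "exp (- z\<^sup>2 / 2)" 1] by simp
  then show ?thesis using Phi_diff_abs_le[of x y 1] by simp
qed

text \<open>For alpha >= 1/2 every point between x and alpha x has modulus at least |x| / 2, where
  the density is at most exp (- x^2 / 8); this beats the length |alpha - 1| |x| uniformly in
  x.\<close>

lemma Phi_scale_bound:
  assumes \<alpha>: "\<alpha> \<ge> 1 / 2"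
  shows "\<bar>Phi (\<alpha> * x) - Phi x\<bar> \<le> 2 * \<bar>\<alpha> - 1\<bar>"
proof -
  have "std_normal_density z \<le> exp (- x\<^sup>2 / 8)" if z: "min x (\<alpha> * x) \<le> z" "z \<le> max x (\<alpha> * x)" for z
  proof -
    have "\<bar>x\<bar> / 2 \<le> \<bar>z\<bar>"
    proof (cases "x \<ge> 0")
      case True
      then have "x / 2 \<le> \<alpha> * x" using mult_right_mono[OF \<alpha>, of x] by simp
      then have "x / 2 \<le> z" using z(1) True by linarith
      then show ?thesis using True by simp
    next
      case False
      then have "\<alpha> * x \<le> x / 2" using mult_right_mono_neg[OF \<alpha>, of x] by simp
      then have "z \<le> x / 2" using z(2) False by linarith
      then show ?thesis using False by simp
    qed
    then have "(\<bar>x\<bar> / 2)\<^sup>2 \<le> \<bar>z\<bar>\<^sup>2" by (intro power_mono) auto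
    then have "- z\<^sup>2 / 2 \<le> - x\<^sup>2 / 8" by (simp add: power_divide)
    then show ?thesis using order_trans[OF std_normal_density_le] by simp
  qed
  then have "\<bar>Phi (\<alpha> * x) - Phi x\<bar> \<le> exp (- x\<^sup>2 / 8) * \<bar>\<alpha> * x - x\<bar>"
    by (rule Phi_diff_abs_le)
  also have "\<alpha> * x - x = (\<alpha> - 1) * x" by (simp add: algebra_simps)
  also have "exp (- x\<^sup>2 / 8) * \<bar>(\<alpha> - 1) * x\<bar> = \<bar>\<alpha> - 1\<bar> * (exp (- x\<^sup>2 / 8) * \<bar>x\<bar>)"
    by (simp add: abs_mult)
  also have "\<dots> \<le> \<bar>\<alpha> - 1\<bar> * 2"
  proof (rule mult_left_mono)
    have "0 \<le> (\<bar>x\<bar> - 2)\<^sup>2" by simp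
    then have "\<bar>x\<bar> \<le> 2 * (1 + x\<^sup>2 / 8)" by (simp add: power2_diff)
    also have "\<dots> \<le> 2 * exp (x\<^sup>2 / 8)" by (intro mult_left_mono exp_ge_add_one_self) auto
    finally have "exp (- x\<^sup>2 / 8) * \<bar>x\<bar> \<le> exp (- x\<^sup>2 / 8) * (2 * exp (x\<^sup>2 / 8))"
      by (intro mult_left_mono) auto
    also have "\<dots> = 2" by (simp add: exp_minus)
    finally show "exp (- x\<^sup>2 / 8) * \<bar>x\<bar> \<le> 2" .
  qed simp
  finally show ?thesis by (simp add: mult.commute)
qed

lemma affine_measurable: "(\<lambda>x. a + b * x) \<in> std_normal_distribution \<rightarrow>\<^sub>M borel"
proof -
  interpret real_distribution std_normal_distribution by (rule real_dist_normal_dist)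
  have "(\<lambda>x::real. a + b * x) \<in> borel_measurable borel"
    by (intro borel_measurable_continuous_onI continuous_intros)
  then show ?thesis unfolding measurable_cong_sets[OF events_eq_borel refl] .
qed

section \<open>The Berry-Esseen bound for fixed k\<close>

context
  fixes k :: nat
  assumes k: "k \<ge> 1"
begin

definition dist_law :: "nat \<Rightarrow> real measure" where
  "dist_law n = distr (measure_pmf (Dist k n)) borel real"

lemma real_distribution_dist_law: "real_distribution (dist_law n)"
  unfolding dist_law_def by (rule prob_space.real_distribution_distr) (auto simp: prob_space_measure_pmf)

lemma finite_Dist: "finite (set_pmf (Dist k n))"
  unfolding Dist_def using ktree_support[OF k] by simp

lemma integrable_dist_law: "integrable (dist_law n) (\<lambda>x. x)"
  unfolding dist_law_def
  by (simp add: integrable_distr_eq integrable_measure_pmf_finite finite_Dist)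

text \<open>The factor \<open>cis t\<close> is the last edge, from node m + 1 to the lower level of
  its clique.\<close>

lemma char_dist_law: "char (dist_law (Suc m)) t = cis t * birth k m (level_char k t)"
proof -
  have "char (dist_law (Suc m)) t = measure_pmf.expectation (Dist k (Suc m)) (\<lambda>d. iexp (t * real d))"
    unfolding char_def dist_law_def by (simp add: integral_distr)
  also have "\<dots> = birth k m (\<lambda>r. iexp (t * real (Suc (r div k))))"
    by (rule expectation_Dist[OF k])
  also have "\<dots> = birth k m (\<lambda>r. cis t * level_char k t r)"
    by (simp add: level_char_def cis_conv_exp mult_exp_exp distrib_left)
  finally show ?thesis by (simp only: birth_mult)
qed

lemma cdf_dist_law: "cdf (dist_law n) x = measure_pmf.prob (Dist k n) {d. real d \<le> x}"
  unfolding cdf_def dist_law_def by (simp add: measure_distr vimage_def)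

definition sd :: "nat \<Rightarrow> real" where
  "sd m = sqrt (2 * half_var k * hsum k m)"

definition normal_law :: "nat \<Rightarrow> real measure" where
  "normal_law m = distr std_normal_distribution borel (\<lambda>x. hsum k m / harm k + sd m * x)"

lemma half_var_pos: "half_var k > 0"
  using half_var_bounds[OF k] decay_bounds[OF k] by linarith

lemma sd_sq: "(sd m)\<^sup>2 = 2 * half_var k * hsum k m"
  unfolding sd_def using half_var_pos hsum_nonneg[of k m] by simp

lemma real_distribution_normal_law: "real_distribution (normal_law m)"
  unfolding normal_law_def
  by (rule prob_space.real_distribution_distr[OF _ affine_measurable])
     (rule real_distribution.axioms(1)[OF real_dist_normal_dist])

lemma integrable_normal_law: "integrable (normal_law m) (\<lambda>x. x)"
proof -
  interpret real_distribution std_normal_distribution by (rule real_dist_normal_dist)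
  have "integrable std_normal_distribution (\<lambda>x. x)"
    using integrable_std_normal_distribution_moment[of 1] by simp
  then have int: "integrable std_normal_distribution (\<lambda>x. hsum k m / harm k + sd m * x)"
    by (intro Bochner_Integration.integrable_add integrable_const integrable_mult_right)
  have "(\<lambda>x::real. x) \<in> borel_measurable borel" by (rule measurable_ident_sets) simp
  from integrable_distr_eq[OF affine_measurable this] int show ?thesis
    unfolding normal_law_def by (rule iffD2)
qed

text \<open>Since \<open>lam\<close> is truncated at second order, the main term is exactly a normal
  characteristic function, and the comparison law needs no further approximation.\<close>

lemma char_normal_law: "char (normal_law m) t = exp (lam k t * of_real (hsum k m))"
proof -
  let ?\<mu> = "hsum k m / harm k"
  have "char (normal_law m) t = (CLINT x|std_normal_distribution. iexp (t * (?\<mu> + sd m * x)))"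
    unfolding char_def normal_law_def by (rule integral_distr[OF affine_measurable]) measurable
  also have "\<dots> = (CLINT x|std_normal_distribution. iexp (t * ?\<mu>) * iexp ((t * sd m) * x))"
    by (intro Bochner_Integration.integral_cong refl) (simp add: mult_exp_exp algebra_simps)
  also have "\<dots> = iexp (t * ?\<mu>) * char std_normal_distribution (t * sd m)"
    unfolding char_def by (rule integral_mult_right_zero)
  also have "\<dots> = exp (\<i> * of_real (t * ?\<mu>) + of_real (- (t * sd m)\<^sup>2 / 2))"
    unfolding char_std_normal_distribution by (simp only: exp_add exp_of_real)
  also have "(t * sd m)\<^sup>2 = t\<^sup>2 * (2 * half_var k * hsum k m)" by (simp add: power_mult_distrib sd_sq)
  also have "\<i> * of_real (t * ?\<mu>) + of_real (- (t\<^sup>2 * (2 * half_var k * hsum k m)) / 2) = lam k t * of_real (hsum k m)"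
    by (simp add: lam_def complex_eq_iff)
  finally show ?thesis .
qed

lemma cdf_normal_law:
  assumes "sd m > 0"
  shows "cdf (normal_law m) x = Phi ((x - hsum k m / harm k) / sd m)"
proof -
  have "(\<lambda>z. hsum k m / harm k + sd m * z) -` {..x} = {..(x - hsum k m / harm k) / sd m}"
    using assms by (auto simp: field_simps)
  then show ?thesis unfolding cdf_def normal_law_def Phi_def
    by (simp only: measure_distr[OF affine_measurable atMost_borel] space_density space_lborel space_borel Int_UNIV_right)
qed

text \<open>The comparison law ignores the last edge; this costs |cis t - 1| <= t times the Gaussian
  factor, of the same form as the error of the chain.\<close>

lemma char_difference:
  "\<exists>C\<ge>0. \<forall>t m. 0 < t \<longrightarrow> t \<le> 1 \<longrightarrow>
    cmod (char (dist_law (Suc m)) t - char (normal_law m) t) \<le> t * (C / (1 + t\<^sup>2 * hsum k m))"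
proof -
  obtain C where C: "C \<ge> 0" "\<And>\<theta> n. \<bar>\<theta>\<bar> \<le> 1 \<Longrightarrow>
    cmod (birth k n (level_char k \<theta>) - exp (lam k \<theta> * of_real (hsum k n))) \<le> C * \<bar>\<theta>\<bar> / (1 + \<theta>\<^sup>2 * hsum k n)"
    using birth_char_asymp[OF k] by blast
  have "cmod (char (dist_law (Suc m)) t - char (normal_law m) t) \<le> t * ((C + 1 / half_var k) / (1 + t\<^sup>2 * hsum k m))"
    if t: "0 < t" "t \<le> 1" for t m
  proof -
    let ?F = "birth k m (level_char k t)" and ?X = "exp (lam k t * of_real (hsum k m))"
    define x where "x = t\<^sup>2 * hsum k m"
    have x: "x \<ge> 0" by (simp add: x_def hsum_nonneg)
    have c: "cmod (cis t - 1) \<le> t"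
      using iexp_approx1[of t 0] t by (simp add: cis_conv_exp)
    have X: "cmod ?X \<le> 1 / half_var k / (1 + x)"
    proof -
      have "half_var k * (1 + x) \<le> 1 + half_var k * x"
        using half_var_bounds(2)[OF k] by (simp add: algebra_simps)
      also have "\<dots> \<le> exp (half_var k * x)" by (rule exp_ge_add_one_self)
      finally have "1 / exp (half_var k * x) \<le> 1 / (half_var k * (1 + x))"
        using half_var_pos x by (intro divide_left_mono) auto
      then show ?thesis unfolding norm_exp_lam by (simp add: x_def exp_minus inverse_eq_divide mult_ac)
    qed
    have "char (dist_law (Suc m)) t - char (normal_law m) t = cis t * (?F - ?X) + (cis t - 1) * ?X"
      unfolding char_dist_law char_normal_law by (simp add: algebra_simps)
    also have "cmod \<dots> \<le> C * t / (1 + x) + t * (1 / half_var k / (1 + x))"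
    proof (rule norm_triangle_mono)
      show "cmod (cis t * (?F - ?X)) \<le> C * t / (1 + x)"
        using C(2)[of t m] t by (simp add: norm_mult x_def)
      show "cmod ((cis t - 1) * ?X) \<le> t * (1 / half_var k / (1 + x))"
        unfolding norm_mult using c X t by (intro mult_mono) auto
    qed
    also have "\<dots> = t * ((C + 1 / half_var k) / (1 + x))"
      by (simp add: add_divide_distrib distrib_left mult.commute)
    finally show ?thesis by (simp add: x_def)
  qed
  moreover have "C + 1 / half_var k \<ge> 0" using C half_var_pos by simp
  ultimately show ?thesis by blast
qed

text \<open>The primitive is an arctangent, bounded by pi / 2 < 2. With a = hsum this is the source
  of the rate 1 / sqrt (log n).\<close>

lemma integral_cauchy_kernel:
  assumes a: "a > 0" and C: "C \<ge> 0"
  shows "integrable lborel (\<lambda>t. indicator {0..1} t * (C / (1 + t\<^sup>2 * a)))"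
    and "(\<integral>t. indicator {0..1} t * (C / (1 + t\<^sup>2 * a)) \<partial>lborel) \<le> 2 * C / sqrt a"
proof -
  have pos: "1 + t\<^sup>2 * a > 0" for t using a by (intro add_pos_nonneg) auto
  have "has_bochner_integral lborel (\<lambda>t. C / (1 + t\<^sup>2 * a) * indicator {0..1} t)
      (C * arctan (sqrt a * 1) / sqrt a - C * arctan (sqrt a * 0) / sqrt a)"
  proof (rule has_bochner_integral_FTC_Icc_real)
    fix t :: real
    have "1 + (sqrt a * t)\<^sup>2 = 1 + t\<^sup>2 * a" using a by (simp add: power_mult_distrib)
    then show "((\<lambda>t. C * arctan (sqrt a * t) / sqrt a) has_real_derivative C / (1 + t\<^sup>2 * a)) (at t)"
      using a by (auto intro!: derivative_eq_intros simp: divide_inverse)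
    show "isCont (\<lambda>t. C / (1 + t\<^sup>2 * a)) t"
      using pos[of t] by (intro continuous_intros) auto
  qed simp
  then have *: "has_bochner_integral lborel (\<lambda>t. indicator {0..1} t * (C / (1 + t\<^sup>2 * a))) (C * arctan (sqrt a) / sqrt a)"
    by (simp add: mult.commute)
  then show "integrable lborel (\<lambda>t. indicator {0..1} t * (C / (1 + t\<^sup>2 * a)))"
    by (rule integrable.intros)
  have "arctan (sqrt a) \<le> 2" using arctan_ubound[of "sqrt a"] pi_less_4 by linarith
  then have "C * arctan (sqrt a) / sqrt a \<le> C * 2 / sqrt a"
    using C a by (intro divide_right_mono mult_left_mono) auto
  then show "(\<integral>t. indicator {0..1} t * (C / (1 + t\<^sup>2 * a)) \<partial>lborel) \<le> 2 * C / sqrt a"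
    unfolding has_bochner_integral_integral_eq[OF *] by (simp only: mult.commute)
qed

text \<open>Both terms of the smoothing inequality have order 1 / sqrt hsum: the integral of the
  Fourier error, and the Lipschitz constant 1 / sd of the unscaled normal law.\<close>

lemma normal_approximation:
  "\<exists>C\<ge>0. \<forall>m x. hsum k m > 0 \<longrightarrow>
    \<bar>cdf (dist_law (Suc m)) x - Phi ((x - hsum k m / harm k) / sd m)\<bar> \<le> C / sqrt (hsum k m)"
proof -
  obtain K where K: "K > 0" "\<And>M N b l x. real_distribution M \<Longrightarrow> integrable M (\<lambda>x. x) \<Longrightarrow>
      real_distribution N \<Longrightarrow> integrable N (\<lambda>x. x) \<Longrightarrow>
      integrable lborel (\<lambda>t. indicator {0..1} t * b t) \<Longrightarrow>
      (\<And>t. 0 < t \<Longrightarrow> t \<le> 1 \<Longrightarrow> cmod (char M t - char N t) \<le> t * b t) \<Longrightarrow>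
      0 \<le> l \<Longrightarrow> (\<And>x y. x \<le> y \<Longrightarrow> cdf N y - cdf N x \<le> l * (y - x)) \<Longrightarrow>
      \<bar>cdf M x - cdf N x\<bar> \<le> K * ((\<integral>t. indicator {0..1} t * b t \<partial>lborel) + l)"
    using smoothing_inequality by blast
  obtain C where C: "C \<ge> 0" "\<And>t m. 0 < t \<Longrightarrow> t \<le> 1 \<Longrightarrow>
    cmod (char (dist_law (Suc m)) t - char (normal_law m) t) \<le> t * (C / (1 + t\<^sup>2 * hsum k m))"
    using char_difference by blast
  define q where "q = sqrt (2 * half_var k)"
  have q: "q > 0" using half_var_pos by (simp add: q_def)
  have "\<bar>cdf (dist_law (Suc m)) x - Phi ((x - hsum k m / harm k) / sd m)\<bar> \<le> K * (2 * C + 1 / q) / sqrt (hsum k m)"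
    if a: "hsum k m > 0" for m x
  proof -
    have sd: "sd m = q * sqrt (hsum k m)" by (simp add: sd_def q_def real_sqrt_mult)
    then have sd0: "sd m > 0" using q a by simp
    have lip: "cdf (normal_law m) y - cdf (normal_law m) x \<le> 1 / sd m * (y - x)" if "x \<le> y" for x y
    proof -
      have "cdf (normal_law m) y - cdf (normal_law m) x
          \<le> \<bar>(y - hsum k m / harm k) / sd m - (x - hsum k m / harm k) / sd m\<bar>"
        unfolding cdf_normal_law[OF sd0] using Phi_lipschitz by (meson abs_le_D1)
      also have "\<dots> = 1 / sd m * (y - x)"
        using that sd0 by (simp add: diff_divide_distrib[symmetric])
      finally show ?thesis .
    qed
    have "\<bar>cdf (dist_law (Suc m)) x - cdf (normal_law m) x\<bar>
      \<le> K * ((\<integral>t. indicator {0..1} t * (C / (1 + t\<^sup>2 * hsum k m)) \<partial>lborel) + 1 / sd m)"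
      using sd0 by (intro K(2) real_distribution_dist_law integrable_dist_law real_distribution_normal_law
          integrable_normal_law integral_cauchy_kernel(1) C lip a) auto
    also have "\<dots> \<le> K * (2 * C / sqrt (hsum k m) + 1 / q / sqrt (hsum k m))"
      using K(1) integral_cauchy_kernel(2)[OF a C(1)]
      by (intro mult_left_mono add_mono) (auto simp: sd)
    also have "\<dots> = K * (2 * C + 1 / q) / sqrt (hsum k m)"
      unfolding add_divide_distrib[symmetric] times_divide_eq_right ..
    finally show ?thesis unfolding cdf_normal_law[OF sd0] .
  qed
  moreover have "K * (2 * C + 1 / q) \<ge> 0" using K(1) C(1) q by simp
  ultimately show ?thesis by blast
qed

lemma expectation_Dist_Suc:
  "measure_pmf.expectation (Dist k (Suc m)) real = 1 + birth k m (\<lambda>r. real (r div k))"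
  unfolding expectation_Dist[OF k] by (simp add: birth_add birth_const)

lemma variance_Dist_Suc:
  "measure_pmf.variance (Dist k (Suc m)) real
    = birth k m (\<lambda>r. (real (r div k) - birth k m (\<lambda>r. real (r div k)))\<^sup>2)"
  unfolding expectation_Dist_Suc by (subst expectation_Dist[OF k]) simp

lemma mean_close: "\<bar>measure_pmf.expectation (Dist k (Suc m)) real - hsum k m / harm k\<bar> \<le> 2"
  unfolding expectation_Dist_Suc using level_mean[OF k, of m] by linarith

lemma variance_close:
  "\<exists>B\<ge>0. \<forall>m. \<bar>measure_pmf.variance (Dist k (Suc m)) real - (sd m)\<^sup>2\<bar> \<le> B"
proof -
  obtain B where B: "\<And>n. \<bar>birth k n (\<lambda>r. (real (r div k) - birth k n (\<lambda>r. real (r div k)))\<^sup>2)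
     - harm2 k / harm k ^ 3 * hsum k n\<bar> \<le> B"
    using level_variance[OF k] by blast
  have "(sd m)\<^sup>2 = harm2 k / harm k ^ 3 * hsum k m" for m
    unfolding sd_sq half_var_def by simp
  then show ?thesis using B order_trans[OF abs_ge_zero B[of 0]] unfolding variance_Dist_Suc by (intro exI[of _ B]) simp
qed

text \<open>Passing from the approximate to the true mean shifts the argument by at most 2 / s;
  passing to the true variance scales it by alpha with |alpha - 1| <= B / s. Both effects are of
  order 1 / s.\<close>

lemma standardized_approximation:
  "\<exists>C A. C \<ge> 0 \<and> A > 0 \<and> (\<forall>m x. hsum k m \<ge> A \<longrightarrow>
    \<bar>measure_pmf.prob (Dist k (Suc m)) {d. (real d - measure_pmf.expectation (Dist k (Suc m)) real)
        / sqrt (measure_pmf.variance (Dist k (Suc m)) real) \<le> x} - Phi x\<bar> \<le> C / sqrt (hsum k m))"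
proof -
  obtain C where C: "C \<ge> 0" "\<And>m x. hsum k m > 0 \<Longrightarrow>
    \<bar>cdf (dist_law (Suc m)) x - Phi ((x - hsum k m / harm k) / sd m)\<bar> \<le> C / sqrt (hsum k m)"
    using normal_approximation by blast
  obtain B where B: "B \<ge> 0" "\<And>m. \<bar>measure_pmf.variance (Dist k (Suc m)) real - (sd m)\<^sup>2\<bar> \<le> B"
    using variance_close by blast
  define q where "q = sqrt (2 * half_var k)"
  have q: "q > 0" using half_var_pos by (simp add: q_def)
  \<comment> \<open>Beyond this threshold s^2 >= 1 + 2 B, which makes V positive, s at least 1 and
    alpha at least 1/2.\<close>
  define A where "A = (1 + 2 * B) / (2 * half_var k)"
  have A: "A > 0" using half_var_pos B(1) by (simp add: A_def add_pos_nonneg)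
  have "\<bar>measure_pmf.prob (Dist k (Suc m)) {d. (real d - measure_pmf.expectation (Dist k (Suc m)) real)
        / sqrt (measure_pmf.variance (Dist k (Suc m)) real) \<le> x} - Phi x\<bar> \<le> (C + (2 + 2 * B) / q) / sqrt (hsum k m)"
    if a: "hsum k m \<ge> A" for m x
  proof -
    define \<mu> where "\<mu> = measure_pmf.expectation (Dist k (Suc m)) real"
    define V where "V = measure_pmf.variance (Dist k (Suc m)) real"
    define s where "s = sd m"
    have h0: "hsum k m > 0" using a A by linarith
    have sq: "s = q * sqrt (hsum k m)" by (simp add: s_def sd_def q_def real_sqrt_mult)
    then have s0: "s > 0" using q h0 by simp
    have "2 * half_var k * A \<le> 2 * half_var k * hsum k m"
      using a half_var_pos by (intro mult_left_mono) auto
    then have s2: "s\<^sup>2 \<ge> 1 + 2 * B" using half_var_pos by (simp add: s_def sd_sq A_def)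
    have V: "\<bar>V - s\<^sup>2\<bar> \<le> B" using B(2)[of m] by (simp add: V_def s_def)
    then have V0: "V > 0" using s2 B(1) by linarith
    have s1: "s \<ge> 1"
    proof (rule ccontr)
      assume "\<not> 1 \<le> s"
      then have "s\<^sup>2 < 1" using s0 by (simp add: power_less_one_iff)
      then show False using s2 B(1) by linarith
    qed
    define \<alpha> where "\<alpha> = sqrt V / s"
    have \<alpha>0: "\<alpha> > 0" using V0 s0 by (simp add: \<alpha>_def)
    have "\<alpha>\<^sup>2 - 1 = (V - s\<^sup>2) / s\<^sup>2" using V0 s0 by (simp add: \<alpha>_def power_divide diff_divide_distrib)
    then have "\<bar>\<alpha>\<^sup>2 - 1\<bar> \<le> B / s\<^sup>2" using V s0 by (simp add: abs_divide divide_right_mono)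
    moreover have "\<alpha>\<^sup>2 - 1 = (\<alpha> - 1) * (\<alpha> + 1)" by (simp add: power2_eq_square algebra_simps)
    ultimately have "\<bar>\<alpha> - 1\<bar> * (\<alpha> + 1) \<le> B / s\<^sup>2" using \<alpha>0 by (simp add: abs_mult)
    \<comment> \<open>As alpha + 1 exceeds 1, the error of the ratio is at most that of its square,
      which is known from the variances.\<close>
    moreover have "\<bar>\<alpha> - 1\<bar> * 1 \<le> \<bar>\<alpha> - 1\<bar> * (\<alpha> + 1)" using \<alpha>0 by (intro mult_left_mono) auto
    ultimately have \<alpha>1: "\<bar>\<alpha> - 1\<bar> \<le> B / s\<^sup>2" by simp
    also have "\<dots> \<le> 1 / 2" using s2 B(1) s0 by (simp add: divide_le_eq)
    finally have \<alpha>2: "\<alpha> \<ge> 1 / 2" by linarith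
    have "B / s\<^sup>2 \<le> B / s"
      using B(1) s1 self_le_power[OF s1, of 2] by (intro divide_left_mono) auto
    then have \<alpha>3: "\<bar>\<alpha> - 1\<bar> \<le> B / s" using \<alpha>1 by linarith
    have "{d. (real d - \<mu>) / sqrt V \<le> x} = {d. real d \<le> \<mu> + sqrt V * x}"
      using V0 by (auto simp: field_simps)
    then have P: "measure_pmf.prob (Dist k (Suc m)) {d. (real d - \<mu>) / sqrt V \<le> x} = cdf (dist_law (Suc m)) (\<mu> + sqrt V * x)"
      by (simp add: cdf_dist_law)
    have u: "(\<mu> + sqrt V * x - hsum k m / harm k) / s = \<alpha> * x + (\<mu> - hsum k m / harm k) / s"
      by (simp add: \<alpha>_def add_divide_distrib diff_divide_distrib)
    have 1: "\<bar>cdf (dist_law (Suc m)) (\<mu> + sqrt V * x) - Phi (\<alpha> * x + (\<mu> - hsum k m / harm k) / s)\<bar> \<le> C / sqrt (hsum k m)"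
      using C(2)[OF h0, of "\<mu> + sqrt V * x"] unfolding s_def[symmetric] u .
    have 2: "\<bar>Phi (\<alpha> * x + (\<mu> - hsum k m / harm k) / s) - Phi (\<alpha> * x)\<bar> \<le> 2 / s"
    proof -
      have "\<bar>Phi (\<alpha> * x + (\<mu> - hsum k m / harm k) / s) - Phi (\<alpha> * x)\<bar> \<le> \<bar>(\<mu> - hsum k m / harm k) / s\<bar>"
        using Phi_lipschitz[of "\<alpha> * x + (\<mu> - hsum k m / harm k) / s" "\<alpha> * x"] by simp
      also have "\<dots> \<le> 2 / s" using mean_close[of m] s0 by (simp add: abs_divide divide_right_mono \<mu>_def)
      finally show ?thesis .
    qed
    have 3: "\<bar>Phi (\<alpha> * x) - Phi x\<bar> \<le> 2 * (B / s)"
      by (rule order_trans[OF Phi_scale_bound[OF \<alpha>2] mult_left_mono[OF \<alpha>3]]) simp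
    have "\<bar>measure_pmf.prob (Dist k (Suc m)) {d. (real d - \<mu>) / sqrt V \<le> x} - Phi x\<bar> \<le> C / sqrt (hsum k m) + 2 / s + 2 * (B / s)"
      unfolding P using 1 2 3 by linarith
    also have "\<dots> = (C + (2 + 2 * B) / q) / sqrt (hsum k m)"
      unfolding sq by (simp add: add_divide_distrib)
    finally show ?thesis unfolding \<mu>_def V_def .
  qed
  moreover have "C + (2 + 2 * B) / q \<ge> 0" using C(1) B(1) q by simp
  ultimately show ?thesis using A by blast
qed

end

theorem theorem7:
  fixes k :: nat
  assumes "k \<ge> 1"
  defines "EE \<equiv> \<lambda>n. measure_pmf.expectation (Dist k n) real"
      and "VV \<equiv> \<lambda>n. measure_pmf.variance (Dist k n) real"
  shows "(\<lambda>n. EE n - ln (real n) / ((real k + 1) * harm k)) \<in> O(\<lambda>n. 1)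
       \<and> (\<lambda>n. VV n - harm2 k / ((real k + 1) * (harm k) ^ 3) * ln (real n)) \<in> O(\<lambda>n. 1)
       \<and> (\<lambda>n. SUP x::real. \<bar>measure_pmf.prob (Dist k n)
                 {d. (real d - EE n) / sqrt (VV n) \<le> x} - Phi x\<bar>)
           \<in> O(\<lambda>n. 1 / sqrt (ln (real n)))"
proof (intro conjI)
  note k = assms(1)
  have H: "harm k \<ge> (1::real)" by (rule harm_ge_1[OF k])
  show "(\<lambda>n. EE n - ln (real n) / ((real k + 1) * harm k)) \<in> O(\<lambda>n. 1)"
  \<comment> \<open>5 = 2 + 3, from \<open>mean_close\<close> and
    \<open>hsum_ln_bound\<close>.\<close>
  proof (rule bigoI[of _ 5], rule eventually_sequentiallyI[of 1])
    fix n :: nat assume "1 \<le> n"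
    then obtain m where n: "n = Suc m" by (cases n) auto
    have "\<bar>hsum k m - ln (real n) / (real k + 1)\<bar> / harm k \<le> \<bar>hsum k m - ln (real n) / (real k + 1)\<bar>"
      by (rule divide_le_self[OF _ H]) simp
    also have "\<dots> \<le> 3" unfolding n by (rule hsum_ln_bound)
    finally have *: "\<bar>hsum k m - ln (real n) / (real k + 1)\<bar> / harm k \<le> 3" .
    have "hsum k m / harm k - ln (real n) / ((real k + 1) * harm k)
        = (hsum k m - ln (real n) / (real k + 1)) / harm k"
      by (simp add: diff_divide_distrib)
    then have "\<bar>hsum k m / harm k - ln (real n) / ((real k + 1) * harm k)\<bar> \<le> 3"
      using * H by (simp add: abs_divide)
    then show "norm (EE n - ln (real n) / ((real k + 1) * harm k)) \<le> 5 * norm (1::real)"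
      using mean_close[OF k, of m] unfolding EE_def n by simp
  qed
  obtain B where B: "B \<ge> 0" "\<And>m. \<bar>VV (Suc m) - (sd k m)\<^sup>2\<bar> \<le> B"
    using variance_close[OF k] unfolding VV_def by blast
  show "(\<lambda>n. VV n - harm2 k / ((real k + 1) * (harm k) ^ 3) * ln (real n)) \<in> O(\<lambda>n. 1)"
  proof (rule bigoI[of _ "B + 3"], rule eventually_sequentiallyI[of 1])
    fix n :: nat assume "1 \<le> n"
    then obtain m where n: "n = Suc m" by (cases n) auto
    define v where "v = 2 * half_var k"
    have v: "0 \<le> v" "v \<le> 1" using half_var_bounds[OF k] half_var_pos[OF k] by (auto simp: v_def)
    have "\<bar>v * hsum k m - v * (ln (real n) / (real k + 1))\<bar> = v * \<bar>hsum k m - ln (real n) / (real k + 1)\<bar>"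
      unfolding right_diff_distrib[symmetric] abs_mult using v by simp
    also have "\<dots> \<le> 1 * 3" unfolding n using v by (intro mult_mono hsum_ln_bound) auto
    also have "v * hsum k m = (sd k m)\<^sup>2" unfolding sd_sq[OF k] v_def ..
    also have "v * (ln (real n) / (real k + 1)) = harm2 k / ((real k + 1) * (harm k) ^ 3) * ln (real n)"
      by (simp add: v_def half_var_def mult.commute)
    finally show "norm (VV n - harm2 k / ((real k + 1) * (harm k) ^ 3) * ln (real n)) \<le> (B + 3) * norm (1::real)"
      using B(2)[of m] unfolding n by simp
  qed
  obtain C A where C: "C \<ge> 0" "A > 0" "\<And>m x. hsum k m \<ge> A \<Longrightarrow>
    \<bar>measure_pmf.prob (Dist k (Suc m)) {d. (real d - EE (Suc m)) / sqrt (VV (Suc m)) \<le> x} - Phi x\<bar> \<le> C / sqrt (hsum k m)"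
    using standardized_approximation[OF k] unfolding EE_def VV_def by blast
  define p where "p = real k + 1"
  have p: "p > 0" by (simp add: p_def)
  \<comment> \<open>ln n >= 6 p absorbs the error 3 and leaves hsum >= ln n / (2 p); ln n >= 2 p A
    then places hsum beyond the threshold A.\<close>
  have "eventually (\<lambda>n. ln (real n) \<ge> max (2 * p * A) (6 * p)) sequentially"
    using filterlim_compose[OF ln_at_top filterlim_real_sequentially] unfolding filterlim_at_top by blast
  then have "eventually (\<lambda>n. norm (SUP x::real. \<bar>measure_pmf.prob (Dist k n) {d. (real d - EE n) / sqrt (VV n) \<le> x} - Phi x\<bar>)
     \<le> C * sqrt (2 * p) * norm (1 / sqrt (ln (real n)))) sequentially"
    using eventually_ge_at_top[of 1]
  proof eventually_elim
    case (elim n)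
    then obtain m where n: "n = Suc m" by (cases n) auto
    define L where "L = ln (real n)"
    have L: "L \<ge> 2 * p * A" "L \<ge> 6 * p" using elim by (auto simp: L_def)
    have L0: "L > 0" using L(2) p by (auto intro: less_le_trans[of 0 "6 * p"])
    have "hsum k m \<ge> L / p - 3"
      using hsum_ln_bound[of k m] unfolding L_def n p_def by linarith
    moreover have "3 \<le> L / (2 * p)" using L(2) p by (simp add: pos_le_divide_eq)
    moreover have "L / p = L / (2 * p) + L / (2 * p)" using p by (simp add: field_simps)
    ultimately have h: "hsum k m \<ge> L / (2 * p)" by linarith
    moreover have "A \<le> L / (2 * p)" using L(1) p by (simp add: pos_le_divide_eq mult_ac)
    ultimately have hA: "hsum k m \<ge> A" by linarith
    have b: "C / sqrt (hsum k m) \<le> C * sqrt (2 * p) / sqrt L"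
    proof -
      have "C / sqrt (hsum k m) \<le> C / sqrt (L / (2 * p))"
        using h L0 p C(1) by (intro divide_left_mono) (auto intro!: mult_pos_pos less_le_trans[OF _ h])
      then show ?thesis by (simp add: real_sqrt_divide)
    qed
    let ?f = "\<lambda>x. \<bar>measure_pmf.prob (Dist k n) {d. (real d - EE n) / sqrt (VV n) \<le> x} - Phi x\<bar>"
    have f: "?f x \<le> C * sqrt (2 * p) / sqrt L" for x
      using order_trans[OF C(3)[OF hA, of x] b] unfolding n .
    then have "(SUP x. ?f x) \<le> C * sqrt (2 * p) / sqrt L" by (intro cSUP_least) auto
    \<comment> \<open>Needed to remove the norm around the supremum; the uniform bound
      \<open>f\<close> supplies the boundedness that a real supremum requires.\<close>
    moreover have "0 \<le> (SUP x. ?f x)"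
    proof -
      have "0 \<le> ?f 0" by simp
      also have "\<dots> \<le> (SUP x. ?f x)" using f by (intro cSUP_upper bdd_aboveI2) auto
      finally show ?thesis .
    qed
    ultimately show ?case using L0 by (simp add: L_def[symmetric])
  qed
  then show "(\<lambda>n. SUP x::real. \<bar>measure_pmf.prob (Dist k n) {d. (real d - EE n) / sqrt (VV n) \<le> x} - Phi x\<bar>)
      \<in> O(\<lambda>n. 1 / sqrt (ln (real n)))"
    by (rule bigoI)
qed

end
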